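(* Up to isomorphism, there exist precisely five discrete examples and a one-parameter family of complete projective special real surfaces; that is, each of the following surfaces is a complete projective special real surface, and every complete projective special real surface is isomorphic to exactly one of them: a) $\{(x,y,z)\in\mathbb{R}^3 \mid xyz=1,\ x>0,\ y>0\}$, b) $\{(x,y,z)\in\mathbb{R}^3 \mid x(xy-z^2)=1,\ x>0\}$, c) $\{(x,y,z)\in\mathbb{R}^3 \mid x(yz+x^2)=1,\ x<0,\ y>0\}$, d) $\{(x,y,z)\in\mathbb{R}^3 \mid z(x^2+y^2-z^2)=1,\ z<0\}$, e) $\{(x,y,z)\in\mathbb{R}^3 \mid x(y^2-z^2)+y^3=1,\ y<0,\ x>0\}$, f) $\{(x,y,z)\in\mathbb{R}^3 \mid y^2z-4x^3+3xz^2+bz^3=1,\ z<0,\ 2x>z\}$, where $b\in(-1,1)\subset\mathbb{R}$.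
   Context: Let $h$ be a homogeneous cubic polynomial function on $\mathbb{R}^{n+1}$ and $U\subset\mathbb{R}^{n+1}$ a domain (nonempty connected open set) invariant under multiplication by positive numbers such that $h|_U>0$. Then $\mathcal{H}:=\{x\in U\mid h(x)=1\}$ is a smooth hypersurface, and the negative Hessian $-\partial^2h$ (matrix of second partial derivatives in the linear coordinates) induces by restriction to $T\mathcal{H}\times T\mathcal{H}$ a symmetric tensor field $g_{\mathcal{H}}$ on $\mathcal{H}$. If $g_{\mathcal{H}}$ is positive definite, $\mathcal{H}\subset\mathbb{R}^{n+1}$ is called a projective special real manifold; for $n=2$ it is called a projective special real surface. It is called complete if the Riemannian manifold $(\mathcal{H},g_{\mathcal{H}})$ is complete. Two projective special real manifolds $\mathcal{H},\mathcal{H}'\subset\mathbb{R}^{n+1}$ are called isomorphic if there exists $\varphi\in\mathrm{GL}(n+1,\mathbb{R})$ mapping $\mathcal{H}$ onto $\mathcal{H}'$. *)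

theory Defs
  imports "HOL-Analysis.Analysis"
begin

definition homogeneous_cubic :: "(real ^ 'n \<Rightarrow> real) \<Rightarrow> bool" where
  "homogeneous_cubic h \<longleftrightarrow>
     (\<exists>c :: 'n \<Rightarrow> 'n \<Rightarrow> 'n \<Rightarrow> real.
        \<forall>x. h x = (\<Sum>i\<in>UNIV. \<Sum>j\<in>UNIV. \<Sum>k\<in>UNIV. c i j k * x $ i * x $ j * x $ k))"

definition partial_deriv :: "'n \<Rightarrow> (real ^ 'n \<Rightarrow> real) \<Rightarrow> real ^ 'n \<Rightarrow> real" where
  "partial_deriv i f x = frechet_derivative f (at x) (axis i 1)"

definition hessian :: "(real ^ 'n \<Rightarrow> real) \<Rightarrow> real ^ 'n \<Rightarrow> real ^ 'n ^ 'n" where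
  "hessian f x = (\<chi> i j. partial_deriv i (partial_deriv j f) x)"

definition neg_hessian_form ::
    "(real ^ 'n \<Rightarrow> real) \<Rightarrow> real ^ 'n \<Rightarrow> real ^ 'n \<Rightarrow> real ^ 'n \<Rightarrow> real" where
  "neg_hessian_form h x v w = - (v \<bullet> (hessian h x *v w))"

(* Velocities of curves in S through x; this is the usual tangent space when S is an
   embedded submanifold. *)
definition tangent_vectors :: "'a :: real_normed_vector set \<Rightarrow> 'a \<Rightarrow> 'a set" where
  "tangent_vectors S x =
     {v. \<exists>\<gamma> :: real \<Rightarrow> 'a. \<gamma> 0 = x \<and> (\<forall>\<^sub>F t in nhds 0. \<gamma> t \<in> S) \<and>
           (\<gamma> has_vector_derivative v) (at 0)}"

definition curve_speed ::
    "('a :: real_normed_vector \<Rightarrow> 'a \<Rightarrow> 'a \<Rightarrow> real) \<Rightarrow> (real \<Rightarrow> 'a) \<Rightarrow> real \<Rightarrow> real" where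
  "curve_speed g \<gamma> t =
     sqrt (g (\<gamma> t) (vector_derivative \<gamma> (at t)) (vector_derivative \<gamma> (at t)))"

(* A valid_path is only C^1 off a finite set, without one-sided limits of the derivative
   there, so its speed need not be integrable.  Such curves have infinite length and are
   left out; otherwise integral would assign them length 0. *)
definition admissible_curves ::
    "('a :: real_normed_vector \<Rightarrow> 'a \<Rightarrow> 'a \<Rightarrow> real) \<Rightarrow> 'a set \<Rightarrow> 'a \<Rightarrow> 'a \<Rightarrow> (real \<Rightarrow> 'a) set" where
  "admissible_curves g S x y =
     {\<gamma>. valid_path \<gamma> \<and> path_image \<gamma> \<subseteq> S \<and> pathstart \<gamma> = x \<and> pathfinish \<gamma> = y \<and>
         curve_speed g \<gamma> integrable_on {0..1}}"

(* The value 0 off S is a dummy: Metric_space requires a nonnegative symmetric function on the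
   whole type.  On S, the infimum is over a nonempty set only if S is connected, as it is
   for the hypersurfaces considered below. *)
definition riemannian_dist ::
    "('a :: real_normed_vector \<Rightarrow> 'a \<Rightarrow> 'a \<Rightarrow> real) \<Rightarrow> 'a set \<Rightarrow> 'a \<Rightarrow> 'a \<Rightarrow> real" where
  "riemannian_dist g S x y =
     (if x \<in> S \<and> y \<in> S
      then INF \<gamma> \<in> admissible_curves g S x y. integral {0..1} (curve_speed g \<gamma>)
      else 0)"

(* The ambient space R^(n+1) is real ^ 'n with CARD('n) = n + 1. *)
definition psr_datum :: "(real ^ 'n \<Rightarrow> real) \<Rightarrow> (real ^ 'n) set \<Rightarrow> (real ^ 'n) set \<Rightarrow> bool" where
  "psr_datum h U H \<longleftrightarrow>
     homogeneous_cubic h \<and>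
     open U \<and> connected U \<and> U \<noteq> {} \<and>
     (\<forall>x\<in>U. \<forall>r>0. r *\<^sub>R x \<in> U) \<and>
     (\<forall>x\<in>U. h x > 0) \<and>
     H = {x \<in> U. h x = 1} \<and>
     (\<forall>x\<in>H. \<forall>v\<in>tangent_vectors H x. v \<noteq> 0 \<longrightarrow> neg_hessian_form h x v v > 0)"

definition projective_special_real :: "(real ^ 'n) set \<Rightarrow> bool" where
  "projective_special_real H \<longleftrightarrow> (\<exists>h U. psr_datum h U H)"

(* H determines h: two such cubics agree on the open cone spanned by H.  Hence the metric
   does not depend on the choice of h and U. *)
definition complete_projective_special_real :: "(real ^ 'n) set \<Rightarrow> bool" where
  "complete_projective_special_real H \<longleftrightarrow>
     (\<exists>h U. psr_datum h U H \<and>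
        Metric_space.mcomplete H (riemannian_dist (neg_hessian_form h) H))"

definition psr_isomorphic :: "(real ^ 'n) set \<Rightarrow> (real ^ 'n) set \<Rightarrow> bool" where
  "psr_isomorphic H H' \<longleftrightarrow>
     (\<exists>A :: real ^ 'n ^ 'n. invertible A \<and> (\<lambda>x. A *v x) ` H = H')"

datatype surface_label = SurfA | SurfB | SurfC | SurfD | SurfE | SurfF real

fun model_surface :: "surface_label \<Rightarrow> (real ^ 3) set" where
  "model_surface SurfA =
     {vector [x, y, z] | x y z. x * y * z = 1 \<and> x > 0 \<and> y > 0}"
| "model_surface SurfB =
     {vector [x, y, z] | x y z. x * (x * y - z\<^sup>2) = 1 \<and> x > 0}"
| "model_surface SurfC =
     {vector [x, y, z] | x y z. x * (y * z + x\<^sup>2) = 1 \<and> x < 0 \<and> y > 0}"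
| "model_surface SurfD =
     {vector [x, y, z] | x y z. z * (x\<^sup>2 + y\<^sup>2 - z\<^sup>2) = 1 \<and> z < 0}"
| "model_surface SurfE =
     {vector [x, y, z] | x y z. x * (y\<^sup>2 - z\<^sup>2) + y ^ 3 = 1 \<and> y < 0 \<and> x > 0}"
| "model_surface (SurfF b) =
     {vector [x, y, z] | x y z.
        y\<^sup>2 * z - 4 * x ^ 3 + 3 * x * z\<^sup>2 + b * z ^ 3 = 1 \<and> z < 0 \<and> 2 * x > z}"

definition surface_labels :: "surface_label set" where
  "surface_labels = {SurfA, SurfB, SurfC, SurfD, SurfE} \<union> SurfF ` {-1<..<1}"

end

theory Submission
  imports Defs
begin

text \<open>
  Everything is phrased for the polar form \<open>T\<close> of \<open>h\<close>; the metric is \<open>-6 T(x, v, v)\<close>, and a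
  hyperbolic cone is complete iff it is a connected component of \<open>{h > 0}\<close>. If it is not, the metric
  is bounded near a missing boundary point of the level set, which is reached by a curve of finite
  length. If it is, look at \<open>h (p + t v) = 1 - m t\<^sup>2 + \<tau> t\<^sup>3\<close> for a tangent vector \<open>v\<close> at \<open>p\<close>:
  hyperbolicity along this line forces \<open>27 \<tau>\<^sup>2 \<le> 4 m\<^sup>3\<close>. Hence the logarithm of the linear form
  \<open>T(p, p, \<cdot>)\<close> is Lipschitz for the metric, and its sublevel sets are compact.

  In dimension 3, coordinates adapted to \<open>p\<close> give \<open>h = x\<^sup>3 - x (y\<^sup>2 + z\<^sup>2) + P(y, z)\<close> with
  \<open>27 P\<^sup>2 \<le> 4 (y\<^sup>2 + z\<^sup>2)\<^sup>3\<close>. If equality occurs, the boundary of the cone contains a singular point of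
  the cubic, and expanding there gives the surfaces a, b, c and e. Otherwise the quotient of the
  Hessian determinant by \<open>h\<close> attains its minimum on the cone; at the minimum \<open>P\<close> is trace free, hence
  \<open>P = c Re (y + i z)\<^sup>3\<close> after a rotation. The value \<open>c = 0\<close> is d, and \<open>0 < c < 2 / (3 \<surd>3)\<close> is the
  family f. The surfaces are told apart by the singular points of the cubic and, since the minimum is
  unique, by \<open>c\<close>.
\<close>

section \<open>Polarisation of cubic forms\<close>

text \<open>The bound \<open>27 \<tau>^2 \<le> 4 m^3\<close> is the sign of the discriminant of
  \<open>1 - m t^2 + \<tau> t^3\<close>. If it failed, there would be a single real root, so one of
  the two rays from p would stay in the component forever, and hyperbolicity could be tested far out
  on it. The bound also recovers the whole cone from one p by three explicit inequalities
  (\<open>cone_iff\<close>). Equality puts a double root on the ray; the direction is then extremal,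
  so the transversal derivative vanishes too and the point is singular.

  In the remaining case the quotient of the Hessian determinant D by h must not approach its infimum
  at the boundary; ruling out real flexes there makes D nonzero where h vanishes. As D changes by
  the constant factor \<open>(det A)^2\<close>, the minimal rays are intrinsic, and for trace free P
  the identity \<open>27 D = 3 h + (4 - 27 c^2) x (y^2 + z^2)\<close> shows hyperbolicity and
  uniqueness of the minimum. The parameter t with \<open>t^2 = 1 + 54 c^2\<close> makes the
  Weierstrass coefficient b rational.\<close>

definition polar :: "('a::real_vector \<Rightarrow> real) \<Rightarrow> 'a \<Rightarrow> 'a \<Rightarrow> 'a \<Rightarrow> real" where
  "polar h x y z = (h (x + y + z) - h (x + y) - h (x + z) - h (y + z) + h x + h y + h z) / 6"

lemma polar_ac: "polar h x y z = polar h y x z" "polar h x y z = polar h x z y"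
  by (simp_all add: polar_def add.commute add.left_commute)

text \<open>The coefficients of a \<open>homogeneous_cubic\<close> need not be symmetric, so the six
  permutations are averaged. This explicit form serves to prove that \<open>polar\<close> is
  trilinear.\<close>

definition coeff_form :: "('n::finite \<Rightarrow> 'n \<Rightarrow> 'n \<Rightarrow> real) \<Rightarrow> real ^ 'n \<Rightarrow> real ^ 'n \<Rightarrow> real ^ 'n \<Rightarrow> real" where
  "coeff_form c x y z = (\<Sum>i\<in>UNIV. \<Sum>j\<in>UNIV. \<Sum>k\<in>UNIV. c i j k *
      (x $ i * y $ j * z $ k + x $ i * z $ j * y $ k + y $ i * x $ j * z $ k
        + y $ i * z $ j * x $ k + z $ i * x $ j * y $ k + z $ i * y $ j * x $ k) / 6)"

lemma homogeneous_cubic_polar: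
  assumes "homogeneous_cubic h"
  obtains c where "polar h = coeff_form c" "\<And>x. h x = polar h x x x"
proof -
  from assms obtain c where
    c: "\<And>x. h x = (\<Sum>i\<in>UNIV. \<Sum>j\<in>UNIV. \<Sum>k\<in>UNIV. c i j k * x $ i * x $ j * x $ k)"
    by (auto simp: homogeneous_cubic_def)
  have 1: "polar h = coeff_form c"
    by (intro ext, simp only: polar_def coeff_form_def c sum_subtractf[symmetric] sum.distrib[symmetric]
        sum_divide_distrib, intro sum.cong refl) (simp add: field_simps)
  have 2: "h x = polar h x x x" for x
    unfolding 1 c coeff_form_def by (intro sum.cong refl) (simp add: field_simps)
  show ?thesis using that 1 2 by blast
qed

locale cubic =
  fixes h :: "real ^ 'n \<Rightarrow> real"
  assumes homogeneous: "homogeneous_cubic h"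
begin

abbreviation "T \<equiv> polar h"

lemma diag: "T x x x = h x"
  using homogeneous_cubic_polar[OF homogeneous] by metis

lemma add1: "T (x + y) u v = T x u v + T y u v"
proof -
  obtain c where c: "T = coeff_form c" using homogeneous_cubic_polar[OF homogeneous] by metis
  show ?thesis unfolding c
    by (simp only: coeff_form_def sum.distrib[symmetric], intro sum.cong refl) (simp add: field_simps)
qed

lemma scale1: "T (r *\<^sub>R x) u v = r * T x u v"
proof -
  obtain c where c: "T = coeff_form c" using homogeneous_cubic_polar[OF homogeneous] by metis
  show ?thesis unfolding c
    by (simp only: coeff_form_def sum_distrib_left, intro sum.cong refl) (simp add: field_simps)
qed

lemma add2: "T u (x + y) v = T u x v + T u y v" and add3: "T u v (x + y) = T u v x + T u v y"
  using add1[of x y u v] by (simp_all add: polar_ac)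

lemma scale2: "T u (r *\<^sub>R x) v = r * T u x v" and scale3: "T u v (r *\<^sub>R x) = r * T u v x"
  using scale1[of r x u v] by (simp_all add: polar_ac)

lemma minus1: "T (- x) u v = - T x u v" and minus2: "T u (- x) v = - T u x v"
  and minus3: "T u v (- x) = - T u v x"
  using scale1[of "-1"] scale2[of _ "-1"] scale3[of _ _ "-1"] by simp_all

lemma diff1: "T (x - y) u v = T x u v - T y u v" and diff2: "T u (x - y) v = T u x v - T u y v"
  and diff3: "T u v (x - y) = T u v x - T u v y"
  using add1[of x "-y"] add2[of _ x "-y"] add3[of _ _ x "-y"]
  by (simp_all add: minus1 minus2 minus3)

lemma zero1 [simp]: "T 0 u v = 0" and zero2 [simp]: "T u 0 v = 0" and zero3 [simp]: "T u v 0 = 0"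
  using scale1[of 0] scale2[of _ 0] scale3[of _ _ 0] by simp_all

lemmas expand = add1 add2 add3 scale1 scale2 scale3 minus1 minus2 minus3 diff1 diff2 diff3

lemma sum3: "T u v (\<Sum>i\<in>I. f i) = (\<Sum>i\<in>I. T u v (f i))"
  by (induction I rule: infinite_finite_induct) (auto simp: add3)

lemma scale: "h (r *\<^sub>R x) = r ^ 3 * h x"
proof -
  have "h (r *\<^sub>R x) = T (r *\<^sub>R x) (r *\<^sub>R x) (r *\<^sub>R x)" by (simp only: diag)
  also have "\<dots> = r ^ 3 * T x x x" by (simp only: expand power3_eq_cube mult.assoc)
  finally show ?thesis by (simp only: diag)
qed

lemma zero [simp]: "h 0 = 0"
  using diag[of 0] by simp

lemma add: "h (x + v) = h x + 3 * T x x v + 3 * T x v v + h v"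
proof -
  have "T v x x = T x x v" "T x v x = T x x v" "T v x v = T x v v" "T v v x = T x v v"
    by (simp_all add: polar_ac)
  then have "T (x + v) (x + v) (x + v) = T x x x + 3 * T x x v + 3 * T x v v + T v v v"
    by (simp only: expand)
  then show ?thesis by (simp only: diag)
qed

lemma add_scale: "h (x + t *\<^sub>R v) = h x + 3 * t * T x x v + 3 * t\<^sup>2 * T x v v + t ^ 3 * h v"
  by (simp add: add scale expand power2_eq_square)

lemma polar_components: "T u v w = (\<Sum>l\<in>UNIV. w $ l * T u v (axis l 1))"
proof -
  have "w = (\<Sum>l\<in>UNIV. (w $ l) *\<^sub>R axis l 1)"
    using basis_expansion[of w] by (simp add: scalar_mult_eq_scaleR)
  then have "T u v w = T u v (\<Sum>l\<in>UNIV. (w $ l) *\<^sub>R axis l 1)" by simp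
  then show ?thesis by (simp add: sum3 scale3)
qed

section \<open>Calculus of the polar form\<close>

lemma bounded_bilinear_polar: "bounded_bilinear (\<lambda>x y. T x y z)"
  unfolding bilinear_conv_bounded_bilinear[symmetric] bilinear_def
  by (auto intro!: linearI simp: expand)

text \<open>The first two slots are differentiated as a bounded bilinear product; the third is
  expanded in coordinates, which turns the trilinear product rule into sums of ordinary
  ones.\<close>

lemma has_derivative_polar [derivative_intros]:
  assumes "(f has_derivative f') (at x within S)" "(g has_derivative g') (at x within S)"
    "(k has_derivative k') (at x within S)"
  shows "((\<lambda>x. T (f x) (g x) (k x)) has_derivative
           (\<lambda>v. T (f' v) (g x) (k x) + T (f x) (g' v) (k x) + T (f x) (g x) (k' v))) (at x within S)"
proof -
  have k: "((\<lambda>x. k x $ i) has_derivative (\<lambda>v. k' v $ i)) (at x within S)" for i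
    by (auto intro!: bounded_linear.has_derivative[OF bounded_linear_vec_nth] assms)
  have "((\<lambda>x. \<Sum>l\<in>UNIV. k x $ l * T (f x) (g x) (axis l 1)) has_derivative
      (\<lambda>v. \<Sum>l\<in>UNIV. k x $ l * (T (f x) (g' v) (axis l 1) + T (f' v) (g x) (axis l 1))
        + k' v $ l * T (f x) (g x) (axis l 1))) (at x within S)"
    by (intro has_derivative_sum has_derivative_mult
        bounded_bilinear.FDERIV[OF bounded_bilinear_polar] k assms)
  moreover have "(\<Sum>l\<in>UNIV. k x $ l * (T (f x) (g' v) (axis l 1) + T (f' v) (g x) (axis l 1))
        + k' v $ l * T (f x) (g x) (axis l 1))
      = T (f' v) (g x) (k x) + T (f x) (g' v) (k x) + T (f x) (g x) (k' v)" for v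
    by (simp add: polar_components[of _ _ "k x"] polar_components[of _ _ "k' v"]
        sum.distrib distrib_left)
  ultimately show ?thesis
    by (simp add: polar_components[of "f _" "g _" "k _"])
qed

lemma continuous_on_polar [continuous_intros]:
  assumes "continuous_on S f" "continuous_on S g" "continuous_on S k"
  shows "continuous_on S (\<lambda>x. T (f x) (g x) (k x))"
  unfolding polar_components[of "f _" "g _" "k _"]
  by (intro continuous_intros assms bounded_bilinear.continuous_on[OF bounded_bilinear_polar])

lemma continuous_on_form [continuous_intros]:
  assumes "continuous_on S f"
  shows "continuous_on S (\<lambda>x. h (f x))"
  using continuous_on_polar[OF assms assms assms] by (simp add: diag)

lemma has_derivative_form [derivative_intros]:
  assumes "(f has_derivative f') (at x within S)"
  shows "((\<lambda>x. h (f x)) has_derivative (\<lambda>v. 3 * T (f x) (f x) (f' v))) (at x within S)"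
proof -
  have "T a (f x) (f x) = T (f x) (f x) a" "T (f x) a (f x) = T (f x) (f x) a" for a
    by (simp_all add: polar_ac)
  then show ?thesis
    using has_derivative_polar[OF assms assms assms] by (simp add: diag)
qed

lemma hessian_eq: "hessian h x $ i $ j = 6 * T x (axis i 1) (axis j 1)"
proof -
  have "partial_deriv j h y = 3 * T y y (axis j 1)" for y j
    using frechet_derivative_at[OF has_derivative_form[OF has_derivative_ident], symmetric, of y]
    by (simp add: partial_deriv_def)
  then have 1: "partial_deriv j h = (\<lambda>y. 3 * T y y (axis j 1))" for j
    by blast
  have "((\<lambda>y. T y y (axis j 1)) has_derivative
      (\<lambda>v. T v x (axis j 1) + T x v (axis j 1) + T x x 0)) (at x)"
    by (rule has_derivative_polar[OF has_derivative_ident has_derivative_ident has_derivative_const])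
  then have "((\<lambda>y. 3 * T y y (axis j 1)) has_derivative
      (\<lambda>v. 3 * (T v x (axis j 1) + T x v (axis j 1) + T x x 0))) (at x)"
    by (rule has_derivative_mult_right)
  then have "partial_deriv i (\<lambda>y. 3 * T y y (axis j 1)) x
      = 3 * (T (axis i 1) x (axis j 1) + T x (axis i 1) (axis j 1) + T x x 0)"
    unfolding partial_deriv_def by (rule frechet_derivative_at[symmetric, THEN fun_cong])
  then show ?thesis
    using polar_ac(1)[of h "axis i 1" x "axis j 1"] by (simp add: hessian_def 1)
qed

lemma neg_hessian_form_eq: "neg_hessian_form h x v w = - 6 * T x v w"
proof -
  have "T x v w = T x w v" by (simp add: polar_ac)
  also have "\<dots> = (\<Sum>i\<in>UNIV. v $ i * T x w (axis i 1))"
    by (rule polar_components)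
  also have "\<dots> = (\<Sum>i\<in>UNIV. v $ i * T x (axis i 1) w)"
    by (simp only: polar_ac(2))
  also have "\<dots> = (\<Sum>i\<in>UNIV. v $ i * (\<Sum>j\<in>UNIV. w $ j * T x (axis i 1) (axis j 1)))"
    by (simp only: polar_components[of x _ w])
  finally show ?thesis
    by (simp add: neg_hessian_form_def inner_vec_def matrix_vector_mult_def hessian_eq
        sum_distrib_left mult_ac sum_negf)
qed

text \<open>Boundedness on the compact product of three unit spheres, extended by homogeneity in
  each slot.\<close>

lemma polar_bound:
  obtains B where "B > 0" "\<And>x y z. \<bar>T x y z\<bar> \<le> B * norm x * norm y * norm z"
proof -
  let ?K = "sphere (0::real^'n) 1 \<times> sphere (0::real^'n) 1 \<times> sphere (0::real^'n) 1"
  have "compact ((\<lambda>(x,y,z). T x y z) ` ?K)"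
    by (intro compact_continuous_image compact_Times compact_sphere)
      (auto simp: case_prod_unfold intro!: continuous_intros)
  then obtain B where B: "B > 0" "\<And>x y z. norm x = 1 \<Longrightarrow> norm y = 1 \<Longrightarrow> norm z = 1 \<Longrightarrow> \<bar>T x y z\<bar> \<le> B"
    using compact_imp_bounded[THEN bounded_pos[THEN iffD1]] by (force simp: image_iff)
  have "\<bar>T x y z\<bar> \<le> B * norm x * norm y * norm z" for x y z
  proof (cases "x = 0 \<or> y = 0 \<or> z = 0")
    case False
    have "T x y z = norm x * norm y * norm z * T (sgn x) (sgn y) (sgn z)"
      using False by (simp add: sgn_div_norm expand field_simps)
    then have "\<bar>T x y z\<bar> = norm x * norm y * norm z * \<bar>T (sgn x) (sgn y) (sgn z)\<bar>"
      by (simp add: abs_mult)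
    also have "\<dots> \<le> norm x * norm y * norm z * B"
      using False by (intro mult_left_mono B) (auto simp: norm_sgn)
    finally show ?thesis by (simp add: mult_ac)
  qed auto
  then show ?thesis using that B(1) by blast
qed

end

section \<open>Hyperbolic cones\<close>

definition level :: "('a \<Rightarrow> real) \<Rightarrow> 'a set \<Rightarrow> 'a set" where
  "level h U = {x \<in> U. h x = 1}"

text \<open>Together with \<open>T x x x = h x > 0\<close>, the last axiom says that the bilinear
  form \<open>T x\<close> is Lorentzian with x timelike. It is imposed on the whole cone rather than
  on the level set, so that points need not be normalised before it is applied.\<close>

locale hyperbolic = cubic h for h :: "real ^ 'n \<Rightarrow> real" +
  fixes U :: "(real ^ 'n) set"
  assumes open_cone: "open U" and connected_cone: "connected U" and nonempty: "U \<noteq> {}"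
    and cone: "x \<in> U \<Longrightarrow> r > 0 \<Longrightarrow> r *\<^sub>R x \<in> U"
    and pos: "x \<in> U \<Longrightarrow> h x > 0"
    and neg: "x \<in> U \<Longrightarrow> T x x v = 0 \<Longrightarrow> v \<noteq> 0 \<Longrightarrow> T x v v < 0"

text \<open>Being open and connected, U is then a connected component of {h > 0}.\<close>

locale maximal_hyperbolic = hyperbolic +
  assumes maximal: "x \<in> closure U \<Longrightarrow> h x > 0 \<Longrightarrow> x \<in> U"

lemma (in cubic) has_vector_derivative_form:
  assumes "(\<gamma> has_vector_derivative v) (at t within S)"
  shows "((\<lambda>t. h (\<gamma> t)) has_real_derivative 3 * T (\<gamma> t) (\<gamma> t) v) (at t within S)"
proof -
  have "((\<lambda>t. h (\<gamma> t)) has_derivative (\<lambda>s. 3 * T (\<gamma> t) (\<gamma> t) (s *\<^sub>R v))) (at t within S)"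
    using assms unfolding has_vector_derivative_def by (rule has_derivative_form)
  moreover have "(\<lambda>s. 3 * T (\<gamma> t) (\<gamma> t) (s *\<^sub>R v)) = (*) (3 * T (\<gamma> t) (\<gamma> t) v)"
    by (auto simp: scale3)
  ultimately show ?thesis
    by (simp add: has_field_derivative_def)
qed

section \<open>Radial projection onto the level set\<close>

context cubic
begin

text \<open>The exponent is forced by cubic homogeneity; the value is meaningful only where h is
  positive.\<close>

definition retract :: "real ^ 'n \<Rightarrow> real ^ 'n" where
  "retract x = (h x powr (-1/3)) *\<^sub>R x"

lemma form_retract:
  assumes "h x > 0" shows "h (retract x) = 1"
proof -
  have "(h x powr (-1/3)) ^ 3 = h x powr (-1)"
    using assms by (simp add: power3_eq_cube flip: powr_add)
  then show ?thesis
    using assms by (simp add: retract_def scale powr_minus_divide)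
qed

lemma retract_level: "h x = 1 \<Longrightarrow> retract x = x"
  by (simp add: retract_def)

lemma has_vector_derivative_retract:
  assumes "(\<gamma> has_vector_derivative v) (at t within S)" and "h (\<gamma> t) > 0"
  shows "((\<lambda>t. retract (\<gamma> t)) has_vector_derivative
     (h (\<gamma> t) powr (-1/3)) *\<^sub>R (v - (T (\<gamma> t) (\<gamma> t) v / h (\<gamma> t)) *\<^sub>R \<gamma> t)) (at t within S)"
proof -
  have "((\<lambda>t. h (\<gamma> t) powr (-1/3)) has_real_derivative
      - (h (\<gamma> t) powr (-1/3) / h (\<gamma> t)) * T (\<gamma> t) (\<gamma> t) v) (at t within S)"
  proof (rule DERIV_chain'[OF has_vector_derivative_form[OF assms(1)]
        has_real_derivative_powr[OF assms(2), of "-1/3"], THEN DERIV_cong])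
    have "h (\<gamma> t) powr (-1/3 - 1) = h (\<gamma> t) powr (-1/3) / h (\<gamma> t)"
      using assms(2) by (simp only: powr_diff powr_one)
    then show "-1/3 * h (\<gamma> t) powr (-1/3 - 1) * (3 * T (\<gamma> t) (\<gamma> t) v)
        = - (h (\<gamma> t) powr (-1/3) / h (\<gamma> t)) * T (\<gamma> t) (\<gamma> t) v"
      by simp
  qed
  from has_vector_derivative_scaleR[OF this assms(1)] show ?thesis
    using assms(2)
    by (simp add: retract_def algebra_simps)
qed

lemma continuous_on_retract:
  assumes "continuous_on S f" "\<And>x. x \<in> S \<Longrightarrow> h (f x) > 0"
  shows "continuous_on S (\<lambda>x. retract (f x))"
  unfolding retract_def
  by (intro continuous_intros continuous_on_form assms) (auto dest: assms(2))

text \<open>The vector is the projection of v along x onto the \<open>T x\<close>-orthogonal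
  complement of x, which is the tangent plane; the first identity is Pythagoras for the form
  \<open>T x\<close>.\<close>

lemma polar_retract_tangent:
  assumes "h x > 0"
  shows "T x (v - (T x x v / h x) *\<^sub>R x) (v - (T x x v / h x) *\<^sub>R x)
    = T x v v - (T x x v)\<^sup>2 / h x" and "T x x (v - (T x x v / h x) *\<^sub>R x) = 0"
proof -
  have "T x v x = T x x v" by (rule polar_ac)
  then show "T x (v - (T x x v / h x) *\<^sub>R x) (v - (T x x v / h x) *\<^sub>R x)
    = T x v v - (T x x v)\<^sup>2 / h x"
    using assms by (simp add: expand diag field_simps power2_eq_square)
  show "T x x (v - (T x x v / h x) *\<^sub>R x) = 0"
    using assms by (simp add: expand diag)
qed

text \<open>The curve is the straight line in direction \<open>v\<close>, pushed back onto the level set radially.\<close>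

lemma tangent_vector_levelI:
  assumes U: "open U" "\<And>x r. x \<in> U \<Longrightarrow> r > 0 \<Longrightarrow> r *\<^sub>R x \<in> U" "\<And>x. x \<in> U \<Longrightarrow> h x > 0"
    and x: "x \<in> level h U" and v: "T x x v = 0"
  shows "v \<in> tangent_vectors (level h U) x"
proof -
  have hx: "h x = 1" "x \<in> U" using x by (auto simp: level_def)
  let ?\<gamma> = "\<lambda>t::real. x + t *\<^sub>R v"
  have "(?\<gamma> has_vector_derivative v) (at 0)"
    by (auto intro!: derivative_eq_intros)
  from has_vector_derivative_retract[OF this]
  have "((\<lambda>t. retract (?\<gamma> t)) has_vector_derivative v) (at 0)"
    using v hx by simp
  moreover have "\<forall>\<^sub>F t in nhds 0. ?\<gamma> t \<in> U"
  proof (rule topological_tendstoD[OF _ U(1)])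
    have "(?\<gamma> \<longlongrightarrow> x + 0 *\<^sub>R v) (nhds 0)"
      by (intro tendsto_intros filterlim_ident)
    then show "(?\<gamma> \<longlongrightarrow> x) (nhds 0)" by simp
  qed (use hx in simp)
  then have "\<forall>\<^sub>F t in nhds 0. retract (?\<gamma> t) \<in> level h U"
  proof eventually_elim
    case (elim t)
    then have "0 < h (?\<gamma> t)" by (rule U(3))
    then show ?case using U(2)[OF elim] form_retract by (auto simp: level_def retract_def)
  qed
  ultimately show ?thesis
    using retract_level[OF hx(1)]
    by (auto simp: tangent_vectors_def intro!: exI[of _ "\<lambda>t. retract (?\<gamma> t)"])
qed

end

context hyperbolic
begin

lemma retract_in_level: "x \<in> U \<Longrightarrow> retract x \<in> level h U"
  using form_retract[OF pos] cone pos by (fastforce simp: level_def retract_def)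

lemma level_nonempty: "level h U \<noteq> {}"
  using nonempty retract_in_level by blast

lemma tangent_vectors_level:
  assumes "x \<in> level h U"
  shows "tangent_vectors (level h U) x = {v. T x x v = 0}"
proof (intro set_eqI iffI)
  fix v assume "v \<in> tangent_vectors (level h U) x"
  then obtain \<gamma> where \<gamma>: "\<gamma> 0 = x" "\<forall>\<^sub>F t in nhds 0. \<gamma> t \<in> level h U"
    "(\<gamma> has_vector_derivative v) (at 0)"
    by (auto simp: tangent_vectors_def)
  have "((\<lambda>t. h (\<gamma> t)) has_real_derivative 3 * T x x v) (at 0)"
    using has_vector_derivative_form[OF \<gamma>(3)] by (simp add: \<gamma>(1))
  moreover have "\<forall>\<^sub>F t in nhds 0. h (\<gamma> t) = 1"
    using \<gamma>(2) by eventually_elim (simp add: level_def)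
  then have "((\<lambda>t. h (\<gamma> t)) has_real_derivative 0) (at 0)"
    using DERIV_cong_ev[of 0 0 "\<lambda>t. h (\<gamma> t)" "\<lambda>_. 1" 0 0] by simp
  ultimately show "v \<in> {v. T x x v = 0}"
    using DERIV_unique by fastforce
next
  fix v assume "v \<in> {v. T x x v = 0}"
  then show "v \<in> tangent_vectors (level h U) x"
    using tangent_vector_levelI[OF open_cone cone pos assms] by simp
qed

end

text \<open>A \<open>psr_datum\<close> tests only points of the level set; a point of U is moved
  there by radial scaling, which preserves the sign of \<open>T x v v\<close>. The forward direction
  applies \<open>tangent_vector_levelI\<close> before hyperbolicity is known, which is why that
  lemma carries explicit hypotheses.\<close>

lemma psr_datum_iff: "psr_datum h U H \<longleftrightarrow> hyperbolic h U \<and> H = level h U"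
proof
  assume psr: "psr_datum h U H"
  then have H: "H = level h U" by (simp add: psr_datum_def level_def)
  interpret cubic h using psr by unfold_locales (simp add: psr_datum_def)
  have tv: "v \<in> tangent_vectors (level h U) x" if "x \<in> level h U" "T x x v = 0" for x v
    using psr that by (intro tangent_vector_levelI) (auto simp: psr_datum_def)
  have "T x v v < 0" if x: "x \<in> U" and "T x x v = 0" "v \<noteq> 0" for x v
  proof -
    have hx: "h x > 0" using psr x by (auto simp: psr_datum_def)
    let ?r = "h x powr (-1/3)"
    have r: "?r > 0" using hx by simp
    have y: "?r *\<^sub>R x \<in> level h U"
      using form_retract[OF hx] psr x r by (auto simp: level_def psr_datum_def retract_def)
    have "T (?r *\<^sub>R x) (?r *\<^sub>R x) v = 0"
      using that by (simp add: expand)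
    then have "T (?r *\<^sub>R x) v v < 0"
      using psr tv[OF y] y that H by (auto simp: psr_datum_def neg_hessian_form_eq)
    then show ?thesis using r hx by (simp add: expand mult_less_0_iff)
  qed
  then have "hyperbolic h U"
    using psr by unfold_locales (auto simp: psr_datum_def)
  then show "hyperbolic h U \<and> H = level h U" using H by blast
next
  assume *: "hyperbolic h U \<and> H = level h U"
  then interpret hyperbolic h U by simp
  show "psr_datum h U H"
    unfolding psr_datum_def
    using * homogeneous open_cone connected_cone nonempty cone pos neg tangent_vectors_level
    by (auto simp: neg_hessian_form_eq level_def)
qed

section \<open>The bound on the cubic part, and the cone seen from one base point\<close>

context maximal_hyperbolic
begin

text \<open>A connected set leaving U would meet its frontier, and a frontier point with h > 0
  belongs to U by maximality although U is open.\<close>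

lemma connected_subset:
  assumes "connected C" "C \<inter> U \<noteq> {}" "\<And>x. x \<in> C \<Longrightarrow> h x > 0"
  shows "C \<subseteq> U"
proof (rule ccontr)
  assume "\<not> C \<subseteq> U"
  then have "C \<inter> frontier U \<noteq> {}"
    using connected_Int_frontier[of C U] assms by blast
  then obtain x where "x \<in> C" "x \<in> closure U" "x \<notin> U"
    using open_cone by (auto simp: frontier_def interior_open)
  then show False using maximal assms(3) by blast
qed

lemma segment_in_cone:
  assumes "x \<in> U" "\<And>t. 0 \<le> t \<Longrightarrow> t \<le> 1 \<Longrightarrow> h (x + t *\<^sub>R v) > 0"
  shows "x + v \<in> U"
proof -
  let ?C = "(\<lambda>t. x + t *\<^sub>R v) ` {0..1}"
  have "connected ?C"
    by (intro connected_continuous_image continuous_intros connected_Icc)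
  moreover have "x \<in> ?C" by (auto simp: image_iff intro!: bexI[of _ 0])
  ultimately have "?C \<subseteq> U"
    using assms by (intro connected_subset) auto
  then show ?thesis by (auto simp: image_iff dest!: subsetD[of _ _ "x + v"] intro!: bexI[of _ 1])
qed

text \<open>For \<open>t = 9 h(v) / 2\<close> the Hessian of the restriction of \<open>h\<close> to the plane spanned by \<open>p\<close> and \<open>v\<close>
  is not Lorentzian at \<open>p + t v\<close>, but if the bound failed this point would lie in the cone.\<close>

lemma cubic_bound_aux:
  assumes p: "p \<in> U" "h p = 1" and v: "T p p v = 0" and m: "- 3 * T p v v = 1"
  shows "27 * (h v)\<^sup>2 \<le> 4"
proof (rule ccontr)
  assume "\<not> ?thesis"
  then have c: "27 * (h v)\<^sup>2 > 4" by simp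
  define t where "t = 9 * h v / 2"
  define q where "q = p + t *\<^sub>R v"
  have Tp: "T p v v = - 1 / 3" using m by simp
  have hs: "h (p + s *\<^sub>R v) = 1 - s\<^sup>2 + s ^ 3 * h v" for s
    using p v Tp by (simp add: add_scale)
  have fpos: "1 - s\<^sup>2 + s ^ 3 * c > 0" if s: "s * c \<ge> 0" and cc: "27 * c\<^sup>2 > 4" for s c :: real
  proof -
    have pos: "1 - s\<^sup>2 + s ^ 3 * c > 0" if "s \<ge> 0" "c > 0" "27 * c\<^sup>2 > 4" for s c :: real
    proof -
      have "(2 / sqrt 27)\<^sup>2 < c\<^sup>2" using that by (simp add: power_divide)
      then have c: "2 / sqrt 27 < c" by (rule power2_less_imp_less) (use that in auto)
      show ?thesis
      proof (cases "s = 0")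
        case False
        define r where "r = sqrt 3"
        have r: "r > 0" "r\<^sup>2 = 3" by (simp_all add: r_def)
        have "sqrt 27 = 3 * r" unfolding r_def
          using real_sqrt_mult[of 9 3] by simp
        then have c: "2 / (3 * r) < c" using c by simp
        then have "s ^ 3 * (2 / (3 * r)) < s ^ 3 * c"
          using False that by (intro mult_strict_left_mono) auto
        \<comment> \<open>At the borderline value 2 / (3 r) of c, with r = sqrt 3, the cubic has the
          double root r, so it is nonnegative for s \<ge> 0; a larger c makes it positive.\<close>
        moreover have "2 * s ^ 3 / (3 * r) - s\<^sup>2 + 1 = (s - r)\<^sup>2 * (2 * s + r) / (3 * r)"
        proof -
          have "(s - r)\<^sup>2 * (2 * s + r) = 2 * s ^ 3 - 3 * r * s\<^sup>2 + r * r\<^sup>2"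
            by (simp add: power2_eq_square power3_eq_cube algebra_simps)
          then show ?thesis using r by (simp add: field_simps)
        qed
        moreover have "(s - r)\<^sup>2 * (2 * s + r) / (3 * r) \<ge> 0"
          using that r by simp
        ultimately show ?thesis by simp
      qed simp
    qed
    show ?thesis
    proof (cases "c > 0")
      case True
      then show ?thesis using pos[of s c] s cc by (simp add: zero_le_mult_iff)
    next
      case False
      then have "c < 0" using cc by (cases "c = 0") auto
      then show ?thesis using pos[of "-s" "-c"] s cc by (simp add: zero_le_mult_iff power3_eq_cube)
    qed
  qed
  have "p + t *\<^sub>R v \<in> U"
  proof (rule segment_in_cone[OF p(1)])
    fix s :: real assume "0 \<le> s" "s \<le> 1"
    then have "s * t * h v \<ge> 0"
      by (simp add: t_def)
    then show "h (p + s *\<^sub>R (t *\<^sub>R v)) > 0"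
      using hs[of "s * t"] fpos[of "s * t" "h v"] c by simp
  qed
  then have q: "q \<in> U" by (simp add: q_def)
  have sym: "T v p p = T p p v" "T p v p = T p p v" "T v p v = T p v v" "T v v p = T p v v"
    by (simp_all add: polar_ac)
  let ?A = "1 - t\<^sup>2 / 3" and ?B = "- 2 * t / 3 + t\<^sup>2 * h v" and ?D = "- 1 / 3 + t * h v"
  have A: "T q q p = ?A" and B: "T q q v = ?B" and C: "T q p p = 1" and E: "T q p v = - t / 3"
    and D: "T q v v = ?D"
    using p v Tp by (simp_all add: q_def expand sym diag power2_eq_square algebra_simps)
  \<comment> \<open>w lies in the plane of p and v and is annihilated by \<open>T q q\<close>, so
    \<open>T q w w\<close> is h q times the Gram determinant of \<open>T q\<close> on p, v. That
    determinant is -1/3 + t h(v) - t^2/9; it is largest at t = 9 h(v) / 2, where it equals 9 h(v)^2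
    / 4 - 1/3, positive once the bound fails.\<close>
  define w where "w = ?B *\<^sub>R p - ?A *\<^sub>R v"
  have "T q q w = 0"
    by (simp add: w_def expand A B)
  moreover have "w \<noteq> 0"
  proof
    assume w0: "w = 0"
    have "T p p w = ?B" "T p v w = ?A / 3"
      using p v Tp by (simp_all add: w_def expand sym diag)
    then have "?A = 0" "?B = 0" using w0 by simp_all
    moreover have "T q q (p + t *\<^sub>R v) = T q q p + t * T q q v" by (simp only: expand)
    then have "h q = ?A + t * ?B" using A B by (simp only: q_def[symmetric] diag)
    ultimately have "h q = 0" by simp
    then show False using pos[OF q] by simp
  qed
  ultimately have "T q w w < 0" by (rule neg[OF q])
  moreover have "T q v p = T q p v" by (rule polar_ac)
  then have "T q (b *\<^sub>R p - a *\<^sub>R v) (b *\<^sub>R p - a *\<^sub>R v)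
      = b\<^sup>2 - 2 * a * b * (- t / 3) + a\<^sup>2 * ?D" for a b
    by (simp add: expand C D E power2_eq_square algebra_simps)
  then have "T q w w = ?B\<^sup>2 - 2 * ?A * ?B * (- t / 3) + ?A\<^sup>2 * ?D"
    by (simp only: w_def)
  moreover have "?B\<^sup>2 - 2 * ?A * ?B * (- t / 3) + ?A\<^sup>2 * ?D \<ge> 0"
  proof -
    have "?B\<^sup>2 - 2 * ?A * ?B * (- t / 3) + ?A\<^sup>2 * ?D
      = (1 - t\<^sup>2 + t ^ 3 * h v) * (- 1 / 3 + t * h v - t\<^sup>2 / 9)"
      by (simp add: field_simps power2_eq_square power3_eq_cube)
    moreover have "1 - t\<^sup>2 + t ^ 3 * h v \<ge> 0" using hs[of t] pos[OF q] by (simp add: q_def)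
    moreover have "- 1 / 3 + t * h v - t\<^sup>2 / 9 \<ge> 0"
      using c by (simp add: t_def power2_eq_square field_simps)
    ultimately show ?thesis by simp
  qed
  ultimately show False by linarith
qed

text \<open>Both sides are homogeneous of degree six in v, which reduces the claim to
  \<open>- 3 * T p v v = 1\<close>.\<close>

lemma cubic_bound:
  assumes p: "p \<in> U" "h p = 1" and v: "T p p v = 0"
  shows "27 * (h v)\<^sup>2 \<le> 4 * (- 3 * T p v v) ^ 3"
proof (cases "v = 0")
  case False
  define m where "m = - 3 * T p v v"
  have m: "m > 0" using neg[OF p(1) v False] by (simp add: m_def)
  define r where "r = 1 / sqrt m"
  have r: "r\<^sup>2 = 1 / m" using m by (simp add: r_def power_divide)
  have "27 * (h (r *\<^sub>R v))\<^sup>2 \<le> 4"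
  proof (rule cubic_bound_aux[OF p])
    show "T p p (r *\<^sub>R v) = 0" using v by (simp add: expand)
    have "- 3 * T p (r *\<^sub>R v) (r *\<^sub>R v) = r\<^sup>2 * m"
      by (simp add: expand m_def power2_eq_square)
    then show "- 3 * T p (r *\<^sub>R v) (r *\<^sub>R v) = 1" using r m by simp
  qed
  moreover have "(h (r *\<^sub>R v))\<^sup>2 = (r\<^sup>2) ^ 3 * (h v)\<^sup>2"
    by (simp add: scale power_mult_distrib flip: power_mult)
  ultimately show ?thesis
    using m unfolding r m_def[symmetric] by (simp add: power_divide field_simps)
qed simp

end

text \<open>Typically l = \<open>T p p q\<close>, m = \<open>- 3 * T p v v\<close> and \<tau> =
  \<open>h v\<close> for the tangential part v of q; then m \<le> 3 l^2 says that
  \<open>T p q q \<ge> 0\<close>.\<close>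

lemma cubic_ray_bound:
  fixes l m \<tau> :: real
  assumes \<tau>: "27 * \<tau>\<^sup>2 \<le> 4 * m ^ 3" and m: "0 \<le> m" "m \<le> 3 * l\<^sup>2" and l: "l \<ge> 0"
  shows "3 * \<bar>\<tau>\<bar> \<le> 2 * l * m"
proof (rule power2_le_imp_le)
  have "m ^ 3 \<le> 3 * l\<^sup>2 * m\<^sup>2"
    using mult_right_mono[OF m(2), of "m\<^sup>2"] by (simp add: power2_eq_square power3_eq_cube mult_ac)
  then show "(3 * \<bar>\<tau>\<bar>)\<^sup>2 \<le> (2 * l * m)\<^sup>2"
    using \<tau> by (simp add: power_mult_distrib)
qed (use m l in simp)

text \<open>The difference of the two sides is (1 - s) ((1 + s) l m - (1 + s + s^2) \<tau>).
  Geometrically, h does not fall below its end value while the tangential part is scaled from 0 to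
  1.\<close>

lemma cubic_ray_mono:
  fixes l m \<tau> s :: real
  assumes \<tau>: "27 * \<tau>\<^sup>2 \<le> 4 * m ^ 3" and m: "0 \<le> m" "m \<le> 3 * l\<^sup>2" and l: "l \<ge> 0"
    and s: "0 \<le> s" "s \<le> 1" 
  shows "l ^ 3 - l * m + \<tau> \<le> l ^ 3 - s\<^sup>2 * (l * m) + s ^ 3 * \<tau>"
proof -
  have 1: "3 * \<tau> \<le> 2 * l * m" using cubic_ray_bound[OF \<tau> m l] by simp
  have "(1 + s + s\<^sup>2) * (3 * \<tau>) \<le> (1 + s + s\<^sup>2) * (2 * l * m)"
    using s by (intro mult_left_mono 1) auto
  also have "\<dots> = 2 * (1 + s + s\<^sup>2) * (l * m)" by simp
  also have "\<dots> \<le> 3 * (1 + s) * (l * m)"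
  proof (rule mult_right_mono)
    have "s * s \<le> s" using s mult_left_le[of s s] by simp
    then show "2 * (1 + s + s\<^sup>2) \<le> 3 * (1 + s)" using s by (simp add: power2_eq_square)
  qed (use m l in simp)
  finally have "0 \<le> (1 + s) * (l * m) - (1 + s + s\<^sup>2) * \<tau>" by linarith
  then have "0 \<le> (1 - s) * ((1 + s) * (l * m) - (1 + s + s\<^sup>2) * \<tau>)"
    using s by (intro mult_nonneg_nonneg) auto
  then show ?thesis by (simp add: algebra_simps power2_eq_square power3_eq_cube)
qed

text \<open>Here the left side is \<tau> - 2 l^3, and the ray bound gives \<tau> \<le> 2
  l^3.\<close>

lemma cubic_ray_end:
  fixes l m \<tau> :: real
  assumes \<tau>: "27 * \<tau>\<^sup>2 \<le> 4 * m ^ 3" and m: "m = 3 * l\<^sup>2" and l: "l \<ge> 0"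
  shows "l ^ 3 - l * m + \<tau> \<le> 0"
  using cubic_ray_bound[OF \<tau> _ _ l] m l by (simp add: power2_eq_square power3_eq_cube)

context maximal_hyperbolic
begin

lemma base_decomposition:
  assumes p: "h p = 1"
  defines "l \<equiv> \<lambda>q. T p p q" and "v \<equiv> \<lambda>q. q - T p p q *\<^sub>R p"
  shows "T p p (v q) = 0" "T p (v q) (v q) = T p q q - (l q)\<^sup>2"
    "h (l q *\<^sub>R p + s *\<^sub>R v q) = (l q) ^ 3 - s\<^sup>2 * (l q * (- 3 * T p (v q) (v q))) + s ^ 3 * h (v q)"
proof -
  have sym: "T p q p = T p p q" by (rule polar_ac)
  show 1: "T p p (v q) = 0"
    using p by (simp add: v_def expand diag)
  show "T p (v q) (v q) = T p q q - (l q)\<^sup>2"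
    using p by (simp add: v_def l_def expand diag sym power2_eq_square)
  show "h (l q *\<^sub>R p + s *\<^sub>R v q) = (l q) ^ 3 - s\<^sup>2 * (l q * (- 3 * T p (v q) (v q))) + s ^ 3 * h (v q)"
    using p 1 by (simp add: add_scale scale expand)
qed

text \<open>The connected set U cannot cross the boundary of the region l > 0,
  \<open>T p q q > 0\<close>, where h \<le> 0 by \<open>cubic_ray_end\<close>. Conversely, on the
  segment from l p to q the form stays at least h q by \<open>cubic_ray_mono\<close>, so the segment
  stays in U.\<close>

lemma cone_iff:
  assumes p: "p \<in> U" "h p = 1"
  shows "q \<in> U \<longleftrightarrow> T p p q > 0 \<and> T p q q > 0 \<and> h q > 0"
proof
  define l where "l q = T p p q" for q
  define v where "v q = q - T p p q *\<^sub>R p" for q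
  have dec: "T p p (v q) = 0" "T p (v q) (v q) = T p q q - (l q)\<^sup>2"
    "h (l q *\<^sub>R p + s *\<^sub>R v q) = (l q) ^ 3 - s\<^sup>2 * (l q * (- 3 * T p (v q) (v q))) + s ^ 3 * h (v q)"
    for q s unfolding l_def v_def by (rule base_decomposition[OF p(2)])+
  have q_eq: "l q *\<^sub>R p + 1 *\<^sub>R v q = q" for q by (simp add: l_def v_def)
  have bound: "27 * (h (v q))\<^sup>2 \<le> 4 * (- 3 * T p (v q) (v q)) ^ 3" for q
    by (rule cubic_bound[OF p dec(1)])
  have m0: "- 3 * T p (v q) (v q) \<ge> 0" for q
    using neg[OF p(1) dec(1)] by (cases "v q = 0") (auto simp: less_imp_le)
  let ?S = "{q. l q > 0 \<and> T p q q > 0}"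
  have "open ?S"
    unfolding l_def by (intro open_Collect_conj open_Collect_less continuous_intros)
  have cl: "closure ?S \<subseteq> {q. l q \<ge> 0 \<and> T p q q \<ge> 0}"
    unfolding l_def
    by (intro closure_minimal closed_Collect_conj closed_Collect_le continuous_intros) auto
  {
    assume q: "q \<in> U"
    show "T p p q > 0 \<and> T p q q > 0 \<and> h q > 0"
    proof (rule ccontr)
      assume "\<not> ?thesis"
      then have "q \<in> U - ?S" using q pos[OF q] by (auto simp: l_def)
      moreover have "p \<in> U \<inter> ?S" using p by (simp add: l_def diag)
      ultimately obtain x where x: "x \<in> U" "x \<in> frontier ?S"
        using connected_Int_frontier[OF connected_cone, of ?S] by blast
      then have x1: "l x \<ge> 0" "T p x x \<ge> 0" "l x = 0 \<or> T p x x = 0"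
        using cl \<open>open ?S\<close> by (auto simp: frontier_def interior_open)
      from x1(3) show False
      proof
        assume l0: "l x = 0"
        then have "T p (v x) (v x) \<ge> 0" using x1 dec(2)[of x] by simp
        then have "v x = 0" using neg[OF p(1) dec(1), of x] by force
        then have "x = 0" using q_eq[of x] l0 by simp
        then show False using pos[OF x(1)] by simp
      next
        assume "T p x x = 0"
        then have "- 3 * T p (v x) (v x) = 3 * (l x)\<^sup>2" using dec(2)[of x] by simp
        from cubic_ray_end[OF bound this x1(1)] have "h x \<le> 0"
          using dec(3)[of x 1] q_eq[of x] by simp
        then show False using pos[OF x(1)] by simp
      qed
    qed
  next
    assume q: "T p p q > 0 \<and> T p q q > 0 \<and> h q > 0"
    then have "l q *\<^sub>R p \<in> U" using cone p by (simp add: l_def)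
    then have "l q *\<^sub>R p + v q \<in> U"
    proof (rule segment_in_cone)
      fix t :: real assume t: "0 \<le> t" "t \<le> 1"
      have "- 3 * T p (v q) (v q) \<le> 3 * (l q)\<^sup>2" using q dec(2)[of q] by simp
      from cubic_ray_mono[OF bound m0 this _ t]
      show "h (l q *\<^sub>R p + t *\<^sub>R v q) > 0"
        using dec(3)[of q t] dec(3)[of q 1] q_eq[of q] q by (simp add: l_def)
    qed
    then show "q \<in> U" using q_eq[of q] by simp
  }
qed

text \<open>If it failed, the zero x + t v of the linear form \<open>T p p\<close> would be so close
  to x that h stays positive on the segment between them; the zero would then lie in the cone, where
  the form is positive.\<close>

lemma linear_form_gradient_bound:
  assumes p: "p \<in> U" "h p = 1" and x: "x \<in> U" "h x = 1" and v: "T x x v = 0"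
  shows "3 * (T p p v)\<^sup>2 \<le> 4 * (- 3 * T x v v) * (T p p x)\<^sup>2"
proof (rule ccontr)
  define m where "m = - 3 * T x v v"
  define t where "t = - T p p x / T p p v"
  assume "\<not> ?thesis"
  then have less: "4 * m * (T p p x)\<^sup>2 < 3 * (T p p v)\<^sup>2" by (simp add: m_def)
  have l: "T p p x > 0" using cone_iff[OF p] x by simp
  have m: "m \<ge> 0" using neg[OF x(1) v] by (cases "v = 0") (auto simp: m_def less_imp_le)
  have lv: "T p p v \<noteq> 0"
  proof
    assume "T p p v = 0"
    then have "m * (T p p x)\<^sup>2 < 0" using less by simp
    then show False using m by (simp add: mult_less_0_iff)
  qed
  have k: "t\<^sup>2 * m < 3 / 4"
    using less lv by (simp add: t_def power_divide field_simps)
  have "x + t *\<^sub>R v \<in> U"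
  proof (rule segment_in_cone[OF x(1)])
    fix s :: real assume s: "0 \<le> s" "s \<le> 1"
    define r where "r = s * t"
    have "s\<^sup>2 \<le> 1" using s by (simp add: power_le_one)
    then have "r\<^sup>2 * m \<le> t\<^sup>2 * m"
      using m s by (intro mult_right_mono) (auto simp: r_def power_mult_distrib mult_left_le_one_le)
    then have k': "r\<^sup>2 * m < 3 / 4" using k by simp
    have "27 * (h v)\<^sup>2 * (r\<^sup>2) ^ 3 \<le> 4 * m ^ 3 * (r\<^sup>2) ^ 3"
      using cubic_bound[OF x v] by (intro mult_right_mono) (auto simp: m_def)
    also have "\<dots> = 4 * (r\<^sup>2 * m) ^ 3" by (simp add: power_mult_distrib)
    \<comment> \<open>With the quadratic term below 3/4, the cubic term is at most 1/4, because 4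
      (3/4)^3 = 27/16. So h stays above 1 - 3/4 - 1/4 = 0.\<close>
    also have "\<dots> \<le> 4 * (3 / 4) ^ 3"
      using k' m by (intro mult_left_mono power_mono) auto
    finally have "27 * (r ^ 3 * h v)\<^sup>2 \<le> 27 * (1 / 16)"
      by (simp add: power_mult_distrib power3_eq_cube mult_ac flip: power_mult)
    then have "(r ^ 3 * h v)\<^sup>2 \<le> (1 / 4)\<^sup>2"
    by (simp add: power2_eq_square[of "1 / 4 :: real"])
    then have "\<bar>r ^ 3 * h v\<bar> \<le> 1 / 4" by (rule power2_le_imp_le[OF power2_abs[THEN ord_eq_le_trans]]) simp
    moreover have "h (x + r *\<^sub>R v) = 1 - r\<^sup>2 * m + r ^ 3 * h v"
      using x v by (simp add: add_scale m_def)
    ultimately show "h (x + s *\<^sub>R (t *\<^sub>R v)) > 0"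
      using k' by (simp add: r_def)
  qed
  then have "T p p (x + t *\<^sub>R v) > 0" using cone_iff[OF p] by simp
  moreover have "T p p (x + t *\<^sub>R v) = 0" using lv by (simp add: expand t_def)
  ultimately show False by simp
qed

text \<open>With l = \<open>T p p q\<close>, the quadratic form 2 l^2 - \<open>T p q q\<close> is
  positive definite, as it equals l^2 - \<open>T p v v\<close> for the tangential part v; on the
  cone \<open>T p q q > 0\<close>, so it is below 2 R^2. Closedness uses maximality: limit points
  still have h = 1.\<close>

lemma compact_sublevel:
  assumes p: "p \<in> U" "h p = 1"
  shows "compact {x \<in> level h U. T p p x \<le> R}"
proof (rule compact_eq_bounded_closed[THEN iffD2], intro conjI)
  let ?A = "{x \<in> level h U. T p p x \<le> R}"
  let ?\<Phi> = "\<lambda>q. 2 * (T p p q)\<^sup>2 - T p q q"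
  have pd: "?\<Phi> q > 0" if "q \<noteq> 0" for q
  proof -
    define v where "v = q - T p p q *\<^sub>R p"
    note dec = base_decomposition[OF p(2), of q, folded v_def]
    show ?thesis
    proof (cases "v = 0")
      case True
      then have "T p p q \<noteq> 0" using that by (auto simp: v_def)
      then show ?thesis using dec(2) True by simp
    next
      case False
      then have "T p v v < 0" by (rule neg[OF p(1) dec(1)])
      then show ?thesis using dec(2) zero_le_power2[of "T p p q"] by linarith
    qed
  qed
  obtain \<epsilon> where \<epsilon>: "\<epsilon> > 0" "\<And>q. norm q = 1 \<Longrightarrow> ?\<Phi> q \<ge> \<epsilon>"
  proof -
    have "sphere (0::real^'a) 1 \<noteq> {}" by simp
    moreover have "continuous_on (sphere 0 1) ?\<Phi>" by (intro continuous_intros)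
    ultimately obtain q0 where "norm q0 = 1" "\<And>q. norm q = 1 \<Longrightarrow> ?\<Phi> q0 \<le> ?\<Phi> q"
      using continuous_attains_inf[of "sphere (0::real^'a) 1" ?\<Phi>] by (auto simp: compact_sphere)
    then show ?thesis using that[of "?\<Phi> q0"] pd[of q0] by force
  qed
  have \<Phi>: "\<epsilon> * (norm q)\<^sup>2 \<le> ?\<Phi> q" for q
  proof (cases "q = 0")
    case False
    then have "\<epsilon> \<le> ?\<Phi> (sgn q)" by (intro \<epsilon>) (simp add: norm_sgn)
    also have "\<dots> = ?\<Phi> q / (norm q)\<^sup>2"
      by (simp add: sgn_div_norm expand power2_eq_square diff_divide_distrib) (simp add: field_simps)
    finally show ?thesis using False by (simp add: field_simps)
  qed simp
  have "norm q \<le> sqrt (2 * R\<^sup>2 / \<epsilon>)" if "q \<in> ?A" for q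
  proof (rule real_le_rsqrt)
    have q: "0 < T p p q" "0 < T p q q" "T p p q \<le> R"
      using that cone_iff[OF p, of q] by (auto simp: level_def)
    then have "(T p p q)\<^sup>2 \<le> R\<^sup>2" by (intro power_mono) auto
    then have "\<epsilon> * (norm q)\<^sup>2 \<le> 2 * R\<^sup>2" using \<Phi>[of q] q by linarith
    then show "(norm q)\<^sup>2 \<le> 2 * R\<^sup>2 / \<epsilon>" using \<epsilon> by (simp add: field_simps)
  qed
  then show "bounded ?A" unfolding bounded_iff by blast
  have "?A = closure U \<inter> {x. h x = 1} \<inter> {x. T p p x \<le> R}"
    using maximal closure_subset[of U] by (force simp: level_def)
  moreover have "closed {x. h x = 1}" "closed {x. T p p x \<le> R}"
    by (intro closed_Collect_eq closed_Collect_le continuous_intros continuous_on_form)+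
  ultimately show "closed ?A" by (simp add: closed_Int)
qed

end

section \<open>Length of curves\<close>

text \<open>Including the endpoints in the exceptional set makes all other parameters interior, so
  that two-sided derivatives are available.\<close>

lemma valid_path_regular:
  fixes \<gamma> :: "real \<Rightarrow> 'a::real_normed_vector"
  assumes "valid_path \<gamma>"
  obtains F where "finite F" "{0, 1} \<subseteq> F"
    "\<And>t. t \<in> {0..1} - F \<Longrightarrow> 0 < t \<and> t < 1 \<and> (\<gamma> has_vector_derivative vector_derivative \<gamma> (at t)) (at t)"
proof -
  obtain S where S: "finite S" "\<And>t. t \<in> {0..1} - S \<Longrightarrow> \<gamma> differentiable at t"
    using assms by (auto simp: valid_path_def piecewise_C1_differentiable_on_def C1_differentiable_on_eq)
  show ?thesis
    by (rule that[of "S \<union> {0, 1}"]) (use S in \<open>auto simp: less_le vector_derivative_works\<close>)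
qed

text \<open>Reversing and joining curves depends on the metric only through this scaling
  law.\<close>

locale quadratic_speed =
  fixes g :: "'a::real_normed_vector \<Rightarrow> 'a \<Rightarrow> 'a \<Rightarrow> real" and S :: "'a set"
  assumes homogeneous_speed: "g x (r *\<^sub>R v) (r *\<^sub>R v) = r\<^sup>2 * g x v v"
begin

lemma curve_speed_reparametrise:
  assumes "(\<gamma> has_vector_derivative v) (at (m * t + c))"
  shows "curve_speed g (\<lambda>t. \<gamma> (m * t + c)) t = \<bar>m\<bar> * curve_speed g \<gamma> (m * t + c)"
proof -
  have "((\<gamma> \<circ> (\<lambda>t. m * t + c)) has_vector_derivative m *\<^sub>R v) (at t)"
    by (rule vector_diff_chain_at) (auto intro!: derivative_eq_intros assms)
  then have "vector_derivative (\<lambda>t. \<gamma> (m * t + c)) (at t) = m *\<^sub>R v"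
    by (auto simp: o_def intro: vector_derivative_at)
  then show ?thesis
    using vector_derivative_at[OF assms]
    by (simp add: curve_speed_def homogeneous_speed real_sqrt_mult)
qed

lemma curve_speed_cong:
  assumes "\<forall>\<^sub>F s in nhds t. \<gamma> s = \<gamma>' s"
  shows "curve_speed g \<gamma> t = curve_speed g \<gamma>' t"
proof -
  have "vector_derivative \<gamma> (at t) = vector_derivative \<gamma>' (at t)"
    by (rule vector_derivative_cong_eq) (use assms in auto)
  moreover have "\<gamma> t = \<gamma>' t" using assms eventually_nhds_x_imp_x by blast
  ultimately show ?thesis by (simp add: curve_speed_def)
qed

lemma admissible_reversepath:
  assumes \<gamma>: "\<gamma> \<in> admissible_curves g S x y"
  shows "reversepath \<gamma> \<in> admissible_curves g S y x"
    "integral {0..1} (curve_speed g (reversepath \<gamma>)) = integral {0..1} (curve_speed g \<gamma>)"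
proof -
  have vp: "valid_path \<gamma>" and int: "curve_speed g \<gamma> integrable_on {0..1}"
    using \<gamma> by (auto simp: admissible_curves_def)
  obtain F where F: "finite F" "\<And>t. t \<in> {0..1} - F \<Longrightarrow>
     0 < t \<and> t < 1 \<and> (\<gamma> has_vector_derivative vector_derivative \<gamma> (at t)) (at t)"
    using valid_path_regular[OF vp] by metis
  let ?i = "integral {0..1} (curve_speed g \<gamma>)"
  have "((\<lambda>t. curve_speed g \<gamma> (- 1 * t + 1)) has_integral ?i) {0..1}"
    using has_integral_affinity01[OF integrable_integral[OF int], of "-1" 1] by simp
  then have "(curve_speed g (reversepath \<gamma>) has_integral ?i) {0..1}"
  proof (rule has_integral_spike_finite[rotated 2])
    show "finite ((\<lambda>t. 1 - t) ` F)" using F by simp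
    fix t assume "t \<in> {0..1} - (\<lambda>t. 1 - t) ` F"
    then have "- 1 * t + 1 \<in> {0..1} - F" by (auto simp: image_iff)
    from curve_speed_reparametrise[OF F(2)[OF this, THEN conjunct2, THEN conjunct2]]
    show "curve_speed g (reversepath \<gamma>) t = curve_speed g \<gamma> (- 1 * t + 1)"
      by (simp add: reversepath_def)
  qed
  then show "reversepath \<gamma> \<in> admissible_curves g S y x"
    "integral {0..1} (curve_speed g (reversepath \<gamma>)) = integral {0..1} (curve_speed g \<gamma>)"
    using \<gamma> by (auto simp: admissible_curves_def valid_path_imp_reverse)
qed

lemma admissible_join:
  assumes \<gamma>: "\<gamma> \<in> admissible_curves g S x y" "\<gamma>' \<in> admissible_curves g S y z"
  shows "\<gamma> +++ \<gamma>' \<in> admissible_curves g S x z"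
    "integral {0..1} (curve_speed g (\<gamma> +++ \<gamma>'))
      = integral {0..1} (curve_speed g \<gamma>) + integral {0..1} (curve_speed g \<gamma>')"
proof -
  have vp: "valid_path \<gamma>" "valid_path \<gamma>'"
    and int: "curve_speed g \<gamma> integrable_on {0..1}" "curve_speed g \<gamma>' integrable_on {0..1}"
    using \<gamma> by (auto simp: admissible_curves_def)
  obtain F where F: "finite F" "\<And>t. t \<in> {0..1} - F \<Longrightarrow>
     0 < t \<and> t < 1 \<and> (\<gamma> has_vector_derivative vector_derivative \<gamma> (at t)) (at t)"
    using valid_path_regular[OF vp(1)] by metis
  obtain F' where F': "finite F'" "\<And>t. t \<in> {0..1} - F' \<Longrightarrow>
     0 < t \<and> t < 1 \<and> (\<gamma>' has_vector_derivative vector_derivative \<gamma>' (at t)) (at t)"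
    using valid_path_regular[OF vp(2)] by metis
  let ?i = "integral {0..1} (curve_speed g \<gamma>)" and ?i' = "integral {0..1} (curve_speed g \<gamma>')"
  have 1: "((\<lambda>t. 2 * curve_speed g \<gamma> (2 * t + 0)) has_integral ?i) {0..1/2}"
    using has_integral_affinity01[OF integrable_integral[OF int(1)], of 2 0, THEN has_integral_cmul[where c=2]]
    by (simp_all only: image_affinity_atLeastAtMost_div_diff, simp_all)
  have 2: "((\<lambda>t. 2 * curve_speed g \<gamma>' (2 * t + -1)) has_integral ?i') {1/2..1}"
    using has_integral_affinity01[OF integrable_integral[OF int(2)], of 2 "-1", THEN has_integral_cmul[where c=2]]
    by (simp_all only: image_affinity_atLeastAtMost_div_diff, simp_all)
  have "(curve_speed g (\<gamma> +++ \<gamma>') has_integral ?i) {0..1/2}"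
  proof (rule has_integral_spike_finite[OF _ _ 1])
    \<comment> \<open>The joined path may have a corner at 1/2; the other exceptional parameters are
      the rescaled ones of the first path.\<close>
    show "finite (insert (1/2) ((\<lambda>t. 2 * t + 0) -` F))"
      using F by (intro finite.insertI finite_vimageI) (auto intro: inj_onI)
    fix t :: real assume t: "t \<in> {0..1/2} - insert (1/2) ((\<lambda>t. 2 * t + 0) -` F)"
    then have *: "2 * t + 0 \<in> {0..1} - F" by auto
    have "\<forall>\<^sub>F s in nhds t. s < 1/2" using t by (intro order_tendstoD(2)[OF filterlim_ident]) auto
    then have "\<forall>\<^sub>F s in nhds t. (\<gamma> +++ \<gamma>') s = \<gamma> (2 * s + 0)"
      by eventually_elim (simp add: joinpaths_def)
    from curve_speed_cong[OF this]
    show "curve_speed g (\<gamma> +++ \<gamma>') t = 2 * curve_speed g \<gamma> (2 * t + 0)"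
      using curve_speed_reparametrise[OF F(2)[OF *, THEN conjunct2, THEN conjunct2]] by simp
  qed
  moreover have "(curve_speed g (\<gamma> +++ \<gamma>') has_integral ?i') {1/2..1}"
  proof (rule has_integral_spike_finite[OF _ _ 2])
    show "finite (insert (1/2) ((\<lambda>t. 2 * t + -1) -` F'))"
      using F' by (intro finite.insertI finite_vimageI) (auto intro: inj_onI)
    fix t :: real assume t: "t \<in> {1/2..1} - insert (1/2) ((\<lambda>t. 2 * t + -1) -` F')"
    then have *: "2 * t + -1 \<in> {0..1} - F'" by auto
    have "\<forall>\<^sub>F s in nhds t. s > 1/2" using t by (intro order_tendstoD(1)[OF filterlim_ident]) auto
    then have "\<forall>\<^sub>F s in nhds t. (\<gamma> +++ \<gamma>') s = \<gamma>' (2 * s + -1)"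
      by eventually_elim (simp add: joinpaths_def)
    from curve_speed_cong[OF this]
    show "curve_speed g (\<gamma> +++ \<gamma>') t = 2 * curve_speed g \<gamma>' (2 * t + -1)"
      using curve_speed_reparametrise[OF F'(2)[OF *, THEN conjunct2, THEN conjunct2]] by simp
  qed
  ultimately have "(curve_speed g (\<gamma> +++ \<gamma>') has_integral ?i + ?i') {0..1}"
    by (intro has_integral_combine[where c = "1/2"]) auto
  then show "\<gamma> +++ \<gamma>' \<in> admissible_curves g S x z"
    "integral {0..1} (curve_speed g (\<gamma> +++ \<gamma>')) = ?i + ?i'"
    using \<gamma> by (auto simp: admissible_curves_def valid_path_join path_image_join integral_unique)
qed

end

section \<open>Length and distance on the level set\<close>

context hyperbolic
begin

abbreviation "gH \<equiv> neg_hessian_form h"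
abbreviation "SH \<equiv> level h U"
abbreviation "len \<gamma> \<equiv> integral {0..1} (curve_speed gH \<gamma>)"
abbreviation "dH \<equiv> riemannian_dist gH SH"

sublocale quadratic_speed gH SH
  by unfold_locales (simp add: neg_hessian_form_eq expand power2_eq_square)

lemma admissible_regular:
  assumes \<gamma>: "\<gamma> \<in> admissible_curves gH SH x y"
  obtains F where "finite F" "{0, 1} \<subseteq> F"
    "\<And>t. t \<in> {0..1} - F \<Longrightarrow> 0 < t \<and> t < 1 \<and>
       (\<gamma> has_vector_derivative vector_derivative \<gamma> (at t)) (at t) \<and>
       \<gamma> t \<in> SH \<and> T (\<gamma> t) (\<gamma> t) (vector_derivative \<gamma> (at t)) = 0 \<and> curve_speed gH \<gamma> t \<ge> 0 \<and>
       (curve_speed gH \<gamma> t)\<^sup>2 = - 6 * T (\<gamma> t) (vector_derivative \<gamma> (at t)) (vector_derivative \<gamma> (at t))"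
proof -
  have vp: "valid_path \<gamma>" and im: "path_image \<gamma> \<subseteq> SH"
    using \<gamma> by (auto simp: admissible_curves_def)
  obtain F where F: "finite F" "{0, 1} \<subseteq> F" "\<And>t. t \<in> {0..1} - F \<Longrightarrow>
     0 < t \<and> t < 1 \<and> (\<gamma> has_vector_derivative vector_derivative \<gamma> (at t)) (at t)"
    using valid_path_regular[OF vp] by metis
  have S: "\<gamma> t \<in> SH" if "t \<in> {0..1}" for t using im that by (auto simp: path_image_def)
  have *: "T (\<gamma> t) (\<gamma> t) (vector_derivative \<gamma> (at t)) = 0" if t: "t \<in> {0..1} - F" for t
  proof -
    have "((\<lambda>t. h (\<gamma> t)) has_real_derivative 3 * T (\<gamma> t) (\<gamma> t) (vector_derivative \<gamma> (at t))) (at t)"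
      using F(3)[OF t] by (intro has_vector_derivative_form) auto
    moreover have "\<forall>\<^sub>F s in nhds t. s \<in> {0<..<1}"
      using F(3)[OF t] by (intro eventually_nhds_in_open) auto
    then have "\<forall>\<^sub>F s in nhds t. h (\<gamma> s) = 1"
      by eventually_elim (use S in \<open>auto simp: level_def\<close>)
    then have "((\<lambda>t. h (\<gamma> t)) has_real_derivative 0) (at t)"
      using DERIV_cong_ev[of t t "\<lambda>t. h (\<gamma> t)" "\<lambda>_. 1" 0 0] by simp
    ultimately show ?thesis using DERIV_unique by fastforce
  qed
  have sp: "curve_speed gH \<gamma> t \<ge> 0 \<and>
      (curve_speed gH \<gamma> t)\<^sup>2 = - 6 * T (\<gamma> t) (vector_derivative \<gamma> (at t)) (vector_derivative \<gamma> (at t))"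
    if t: "t \<in> {0..1} - F" for t
  proof -
    have "- 6 * T (\<gamma> t) (vector_derivative \<gamma> (at t)) (vector_derivative \<gamma> (at t)) \<ge> 0"
      using neg[OF _ *[OF t]] S[of t] t
      by (cases "vector_derivative \<gamma> (at t) = 0") (auto simp: level_def less_imp_le)
    then show ?thesis
      unfolding curve_speed_def neg_hessian_form_eq by (metis real_sqrt_ge_zero real_sqrt_pow2)
  qed
  show ?thesis by (rule that[OF F(1,2)]) (use F(3) S * sp in auto)
qed

text \<open>The common tool for comparing length with a function \<psi> along the curve: it is used
  for the curve itself and for the logarithm of a linear form. The end s allows stopping at the
  first exit from a ball. On the finite exceptional set nothing is known about \<psi>' or the speed,
  so both integrands are replaced by 0 there.\<close>

lemma length_bounds_variation:
  fixes \<psi> :: "real \<Rightarrow> 'b::banach"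
  assumes \<gamma>: "\<gamma> \<in> admissible_curves gH SH x y" and s: "0 \<le> s" "s \<le> 1" and "finite F" and K: "K \<ge> 0"
    and cont: "continuous_on {0..s} \<psi>"
    and der: "\<And>t. t \<in> {0<..<s} - F \<Longrightarrow>
      (\<psi> has_vector_derivative \<psi>' t) (at t) \<and> norm (\<psi>' t) \<le> K * curve_speed gH \<gamma> t"
  shows "norm (\<psi> s - \<psi> 0) \<le> K * len \<gamma>"
proof -
  obtain F' where F': "finite F'" "{0, 1} \<subseteq> F'"
    "\<And>t. t \<in> {0..1} - F' \<Longrightarrow> curve_speed gH \<gamma> t \<ge> 0"
    using admissible_regular[OF \<gamma>] by metis
  define E where "E = F \<union> F' \<union> {0, s}"
  have E: "finite E" using F' assms by (simp add: E_def)
  define sp where "sp t = (if t \<in> E then 0 else K * curve_speed gH \<gamma> t)" for t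
  define w where "w t = (if t \<in> E then 0 else \<psi>' t)" for t
  have int: "curve_speed gH \<gamma> integrable_on {0..1}" using \<gamma> by (simp add: admissible_curves_def)
  have "((\<lambda>t. K * curve_speed gH \<gamma> t) has_integral K * len \<gamma>) {0..1}"
    using has_integral_mult_right[OF integrable_integral[OF int]] .
  then have sp: "(sp has_integral K * len \<gamma>) {0..1}"
    by (rule has_integral_spike_finite[OF E, rotated]) (simp add: sp_def)
  then have sps: "sp integrable_on {0..s}"
    using s by (auto intro: integrable_on_subinterval dest: has_integral_integrable)
  have "(\<psi>' has_integral (\<psi> s - \<psi> 0)) {0..s}"
    by (rule fundamental_theorem_of_calculus_interior_strong[OF \<open>finite F\<close>]) (use s der cont in auto)
  then have w: "(w has_integral (\<psi> s - \<psi> 0)) {0..s}"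
    by (rule has_integral_spike_finite[OF E, rotated]) (simp add: w_def)
  have "norm (\<psi> s - \<psi> 0) = norm (integral {0..s} w)" using w by (simp add: integral_unique)
  also have "\<dots> \<le> integral {0..s} sp"
  proof (rule Henstock_Kurzweil_Integration.integral_norm_bound_integral[OF _ sps])
    show "w integrable_on {0..s}" using w by blast
    fix t assume "t \<in> {0..s}"
    then show "norm (w t) \<le> sp t"
      using der[of t] by (auto simp: w_def sp_def E_def)
  qed
  also have "\<dots> \<le> integral {0..1} sp"
    using s sps sp F'(3) K by (intro integral_subset_le) (auto simp: sp_def E_def)
  also have "\<dots> = K * len \<gamma>" using sp by (simp add: integral_unique)
  finally show ?thesis .
qed

lemma length_nonneg:
  assumes "\<gamma> \<in> admissible_curves gH SH x y"
  shows "0 \<le> len \<gamma>"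
  using length_bounds_variation[OF assms, of 0 "{}" 1 "\<lambda>_. 0::real" "\<lambda>_. 0"] by simp

text \<open>The expression under the root is the metric pulled back to the cone along the radial
  projection. It vanishes on radial vectors, and it is written without \<open>retract\<close> so
  that it can be bounded near points outside U as well.\<close>

lemma retract_curve:
  assumes der: "\<And>t. t \<in> {0..1} \<Longrightarrow> (\<gamma> has_vector_derivative D t) (at t)"
    and contD: "continuous_on {0..1} D" and U: "\<And>t. t \<in> {0..1} \<Longrightarrow> \<gamma> t \<in> U"
  shows "(\<lambda>t. retract (\<gamma> t)) \<in> admissible_curves gH SH (retract (\<gamma> 0)) (retract (\<gamma> 1))"
    "t \<in> {0..1} \<Longrightarrow> curve_speed gH (\<lambda>t. retract (\<gamma> t)) t =
       sqrt (6 * ((T (\<gamma> t) (\<gamma> t) (D t))\<^sup>2 / (h (\<gamma> t))\<^sup>2 - T (\<gamma> t) (D t) (D t) / h (\<gamma> t)))"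
proof -
  let ?\<eta> = "\<lambda>t. retract (\<gamma> t)"
  define E where "E t = (h (\<gamma> t) powr (-1/3)) *\<^sub>R (D t - (T (\<gamma> t) (\<gamma> t) (D t) / h (\<gamma> t)) *\<^sub>R \<gamma> t)" for t
  have hp: "h (\<gamma> t) > 0" if "t \<in> {0..1}" for t using U[OF that] pos by blast
  have der': "(?\<eta> has_vector_derivative E t) (at t)" if "t \<in> {0..1}" for t
    unfolding E_def using has_vector_derivative_retract[OF der hp] that by blast
  have cont: "continuous_on {0..1} \<gamma>"
    using der by (meson continuous_at_imp_continuous_on has_vector_derivative_continuous)
  have contE: "continuous_on {0..1} E"
    unfolding E_def using hp
    by (intro continuous_intros continuous_on_form cont contD) (auto dest: hp)
  have "?\<eta> C1_differentiable_on {0..1}"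
    unfolding C1_differentiable_on_def using der' contE by blast
  then have vp: "valid_path ?\<eta>"
    by (simp add: valid_path_def C1_differentiable_imp_piecewise)
  have speed: "curve_speed gH ?\<eta> t =
       sqrt (6 * ((T (\<gamma> t) (\<gamma> t) (D t))\<^sup>2 / (h (\<gamma> t))\<^sup>2 - T (\<gamma> t) (D t) (D t) / h (\<gamma> t)))"
    if t: "t \<in> {0..1}" for t
  proof -
    let ?r = "h (\<gamma> t) powr (-1/3)"
    let ?w = "D t - (T (\<gamma> t) (\<gamma> t) (D t) / h (\<gamma> t)) *\<^sub>R \<gamma> t"
    have r3: "?r ^ 3 = 1 / h (\<gamma> t)"
      using hp[OF t] by (simp add: power3_eq_cube powr_minus_divide flip: powr_add)
    have "gH (?\<eta> t) (E t) (E t) = - 6 * ?r ^ 3 * T (\<gamma> t) ?w ?w"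
      unfolding neg_hessian_form_eq E_def retract_def scale1 scale2 scale3
      by (simp add: power3_eq_cube mult_ac)
    also have "\<dots> = 6 * ((T (\<gamma> t) (\<gamma> t) (D t))\<^sup>2 / (h (\<gamma> t))\<^sup>2 - T (\<gamma> t) (D t) (D t) / h (\<gamma> t))"
      unfolding polar_retract_tangent(1)[OF hp[OF t]] r3
      using hp[OF t] by (simp add: field_simps power2_eq_square)
    finally show ?thesis
      using vector_derivative_at[OF der'[OF t]] by (simp add: curve_speed_def)
  qed
  have "(\<lambda>t. sqrt (6 * ((T (\<gamma> t) (\<gamma> t) (D t))\<^sup>2 / (h (\<gamma> t))\<^sup>2 - T (\<gamma> t) (D t) (D t) / h (\<gamma> t))))
      integrable_on {0..1}"
    by (intro integrable_continuous_real continuous_intros continuous_on_form cont contD)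
      (use hp in fastforce)+
  then have "curve_speed gH ?\<eta> integrable_on {0..1}"
    by (rule integrable_eq) (simp add: speed)
  moreover have "path_image ?\<eta> \<subseteq> SH"
    using U retract_in_level by (auto simp: path_image_def)
  ultimately show "?\<eta> \<in> admissible_curves gH SH (retract (\<gamma> 0)) (retract (\<gamma> 1))"
    using vp by (simp add: admissible_curves_def pathstart_def pathfinish_def)
  show "t \<in> {0..1} \<Longrightarrow> curve_speed gH ?\<eta> t =
       sqrt (6 * ((T (\<gamma> t) (\<gamma> t) (D t))\<^sup>2 / (h (\<gamma> t))\<^sup>2 - T (\<gamma> t) (D t) (D t) / h (\<gamma> t)))"
    by (rule speed)
qed

text \<open>Two points of an open connected set are joined by a polynomial path, which the radial
  projection carries to the level set.\<close>

lemma admissible_nonempty: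
  assumes "x \<in> SH" "y \<in> SH"
  shows "admissible_curves gH SH x y \<noteq> {}"
proof -
  have xy: "x \<in> U" "h x = 1" "y \<in> U" "h y = 1" using assms by (auto simp: level_def)
  obtain \<gamma> where \<gamma>: "polynomial_function \<gamma>" "path_image \<gamma> \<subseteq> U" "pathstart \<gamma> = x" "pathfinish \<gamma> = y"
    using connected_open_polynomial_connected[OF open_cone connected_cone xy(1,3)] by blast
  obtain D where D: "polynomial_function D" "\<And>t. (\<gamma> has_vector_derivative D t) (at t)"
    using has_vector_derivative_polynomial_function[OF \<gamma>(1)] by blast
  have "(\<lambda>t. retract (\<gamma> t)) \<in> admissible_curves gH SH (retract (\<gamma> 0)) (retract (\<gamma> 1))"
    by (rule retract_curve(1)[of _ D])
      (use D \<gamma> in \<open>auto simp: path_image_def intro: continuous_on_polymonial_function\<close>)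
  then show ?thesis
    using \<gamma> retract_level xy by (auto simp: pathstart_def pathfinish_def)
qed

lemma dist_le_length:
  assumes "\<gamma> \<in> admissible_curves gH SH x y" "x \<in> SH" "y \<in> SH"
  shows "dH x y \<le> len \<gamma>"
proof -
  have "bdd_below (len ` admissible_curves gH SH x y)"
    by (rule bdd_belowI2[of _ 0]) (rule length_nonneg)
  from cINF_lower[OF this assms(1)] show ?thesis
    using assms(2,3) by (simp add: riemannian_dist_def)
qed

lemma dist_geI:
  assumes "x \<in> SH" "y \<in> SH" "\<And>\<gamma>. \<gamma> \<in> admissible_curves gH SH x y \<Longrightarrow> c \<le> len \<gamma>"
  shows "c \<le> dH x y"
  using assms admissible_nonempty[OF assms(1,2)] by (simp add: riemannian_dist_def cINF_greatest)

lemma dist_lessE: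
  assumes "x \<in> SH" "y \<in> SH" "dH x y < e"
  obtains \<gamma> where "\<gamma> \<in> admissible_curves gH SH x y" "len \<gamma> < e"
proof -
  have "bdd_below (len ` admissible_curves gH SH x y)"
    by (rule bdd_belowI2[of _ 0]) (rule length_nonneg)
  from cINF_less_iff[OF admissible_nonempty[OF assms(1,2)] this, of e]
  have "\<exists>\<gamma> \<in> admissible_curves gH SH x y. len \<gamma> < e"
    using assms by (simp add: riemannian_dist_def)
  then show ?thesis using that by blast
qed

end

section \<open>Completeness\<close>

context hyperbolic
begin

lemma curve_in_level:
  assumes "\<gamma> \<in> admissible_curves gH SH x y"
  shows "continuous_on {0..1} \<gamma>" "\<gamma> 0 = x" "\<gamma> 1 = y" "t \<in> {0..1} \<Longrightarrow> \<gamma> t \<in> SH"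
  using assms valid_path_imp_path[of \<gamma>]
  by (auto simp: admissible_curves_def path_def pathstart_def pathfinish_def path_image_def)

text \<open>On unit tangent vectors over a small closed ball the metric is bounded below by
  compactness, so length dominates Euclidean distance there. The minimum with r accounts for curves
  that leave the ball: they have already covered the distance r.\<close>

lemma dist_lower_bound:
  assumes x: "x \<in> SH"
  obtains c r where "c > 0" "r > 0" "\<And>y. y \<in> SH \<Longrightarrow> c * min r (norm (y - x)) \<le> dH x y"
proof -
  obtain r where r: "r > 0" "cball x r \<subseteq> U"
    using open_cone x open_contains_cball[of U] by (auto simp: level_def)
  define K where "K = {w \<in> cball x r \<times> sphere (0::real^'n) 1. h (fst w) = 1 \<and> T (fst w) (fst w) (snd w) = 0}"
  have "K = (cball x r \<times> sphere (0::real^'n) 1) \<inter> {w. h (fst w) = 1} \<inter> {w. T (fst w) (fst w) (snd w) = 0}"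
    by (auto simp: K_def)
  moreover have "closed {w. h (fst w) = 1}" "closed {w. T (fst w) (fst w) (snd w) = 0}"
    by (intro closed_Collect_eq continuous_intros continuous_on_form)+
  ultimately have "compact K"
    by (auto intro!: compact_Int_closed compact_Times compact_cball compact_sphere)
  have Kneg: "- 6 * T (fst w) (snd w) (snd w) > 0" if "w \<in> K" for w
  proof -
    have "fst w \<in> U" "snd w \<noteq> 0" using that r by (auto simp: K_def)
    then show ?thesis using that neg[of "fst w" "snd w"] by (simp add: K_def)
  qed
  have cont: "continuous_on K (\<lambda>w. - 6 * T (fst w) (snd w) (snd w))"
    by (intro continuous_intros)
  obtain e where e: "e > 0" "\<And>w. w \<in> K \<Longrightarrow> e \<le> - 6 * T (fst w) (snd w) (snd w)"
  \<comment> \<open>K is empty only in ambient dimension one, where there are no unit tangent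
    vectors and any bound serves.\<close>
  proof (cases "K = {}")
    case False
    then obtain w0 where "w0 \<in> K"
      "\<And>w. w \<in> K \<Longrightarrow> - 6 * T (fst w0) (snd w0) (snd w0) \<le> - 6 * T (fst w) (snd w) (snd w)"
      using continuous_attains_inf[OF \<open>compact K\<close> False cont] by blast
    then show ?thesis using that Kneg by blast
  qed (use that[of 1] in auto)
  define c where "c = sqrt e"
  have c: "c > 0" "c\<^sup>2 = e" using e by (simp_all add: c_def)
  have lower: "(c * norm v)\<^sup>2 \<le> - 6 * T z v v"
    if "z \<in> SH" "z \<in> cball x r" "T z z v = 0" for z v
  proof (cases "v = 0")
    case False
    then have "(z, sgn v) \<in> K"
      using that by (auto simp: K_def level_def norm_sgn sgn_div_norm expand)
    from e(2)[OF this] have "e * (norm v)\<^sup>2 \<le> - 6 * T z v v"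
      using False by (simp add: sgn_div_norm expand field_simps power2_eq_square)
    then show ?thesis by (simp only: power_mult_distrib c)
  qed simp
  have "c * min r (norm (y - x)) \<le> dH x y" if y: "y \<in> SH" for y
  proof (rule dist_geI[OF x y])
    fix \<gamma> assume \<gamma>: "\<gamma> \<in> admissible_curves gH SH x y"
    note reg = curve_in_level[OF \<gamma>]
    obtain F where F: "finite F" "{0, 1} \<subseteq> F" "\<And>t. t \<in> {0..1} - F \<Longrightarrow> 0 < t \<and> t < 1 \<and>
       (\<gamma> has_vector_derivative vector_derivative \<gamma> (at t)) (at t) \<and>
       \<gamma> t \<in> SH \<and> T (\<gamma> t) (\<gamma> t) (vector_derivative \<gamma> (at t)) = 0 \<and> curve_speed gH \<gamma> t \<ge> 0 \<and>
       (curve_speed gH \<gamma> t)\<^sup>2 = - 6 * T (\<gamma> t) (vector_derivative \<gamma> (at t)) (vector_derivative \<gamma> (at t))"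
      using admissible_regular[OF \<gamma>] by metis
    have *: "c * norm (\<gamma> s - x) \<le> len \<gamma>"
      if s: "0 \<le> s" "s \<le> 1" and ball: "\<And>t. 0 < t \<Longrightarrow> t < s \<Longrightarrow> \<gamma> t \<in> cball x r" for s
    proof -
      have "norm (\<gamma> s - \<gamma> 0) \<le> (1 / c) * len \<gamma>"
      proof (rule length_bounds_variation[OF \<gamma> s F(1)])
        show "continuous_on {0..s} \<gamma>" using reg(1) s by (auto intro: continuous_on_subset)
        fix t assume t: "t \<in> {0<..<s} - F"
        then have t': "t \<in> {0..1} - F" using s by auto
        have "c * norm (vector_derivative \<gamma> (at t)) \<le> curve_speed gH \<gamma> t"
          by (rule power2_le_imp_le) (use lower[of "\<gamma> t"] F(3)[OF t'] ball[of t] t in auto)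
        then show "(\<gamma> has_vector_derivative vector_derivative \<gamma> (at t)) (at t) \<and>
           norm (vector_derivative \<gamma> (at t)) \<le> 1 / c * curve_speed gH \<gamma> t"
          using F(3)[OF t'] c by (simp add: field_simps)
      qed (use c in simp)
      then show ?thesis using c reg(2) by (simp add: field_simps)
    qed
    \<comment> \<open>The parameters at distance at least r from x; the least of them is the first
      exit time, before which the lower bound on the metric applies.\<close>
    define A where "A = {t \<in> {0..1}. r \<le> norm (\<gamma> t - x)}"
    show "c * min r (norm (y - x)) \<le> len \<gamma>"
    proof (cases "A = {}")
      case True
      have "\<gamma> t \<in> cball x r" if "t \<in> {0..1}" for t
      proof -
        have "t \<notin> A" using True by simp
        then show ?thesis using that by (simp add: A_def dist_norm norm_minus_commute)
      qed
      then have "c * norm (\<gamma> 1 - x) \<le> len \<gamma>"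
        by (intro *) auto
      moreover have "c * min r (norm (y - x)) \<le> c * norm (y - x)"
        using c by (intro mult_left_mono) auto
      ultimately show ?thesis using reg(3) by simp
    next
      case False
      have "closed A"
        unfolding A_def by (intro continuous_on_closed_Collect_le continuous_intros reg(1))
      then have "compact A"
        by (auto simp: compact_eq_bounded_closed A_def intro: bounded_subset[of "{0..1}"])
      then obtain s where s: "s \<in> A" "\<And>t. t \<in> A \<Longrightarrow> s \<le> t"
        using compact_attains_inf[of A] False by blast
      have "c * norm (\<gamma> s - x) \<le> len \<gamma>"
      proof (rule *)
        fix t assume t: "0 < t" "t < s"
        then have "t \<notin> A" using s(2) by force
        then show "\<gamma> t \<in> cball x r" using t s(1) by (auto simp: A_def dist_norm norm_minus_commute)
      qed (use s in \<open>auto simp: A_def\<close>)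
      moreover have "c * min r (norm (y - x)) \<le> c * norm (\<gamma> s - x)"
        using c s(1) by (intro mult_left_mono) (auto simp: A_def)
      ultimately show ?thesis by simp
    qed
  qed
  then show ?thesis using that c r by blast
qed

lemma Metric_space_level: "Metric_space SH dH"
proof
  fix x y
  show "0 \<le> dH x y"
  proof (cases "x \<in> SH \<and> y \<in> SH")
    case True
    then show ?thesis by (intro dist_geI length_nonneg) auto
  qed (auto simp: riemannian_dist_def)
next
  have le: "dH y x \<le> dH x y" if "x \<in> SH" "y \<in> SH" for x y
  proof (rule dist_geI[OF that])
    fix \<gamma> assume "\<gamma> \<in> admissible_curves gH SH x y"
    from admissible_reversepath[OF this] show "dH y x \<le> len \<gamma>"
      using dist_le_length that by metis
  qed
  fix x y
  show "dH x y = dH y x"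
  proof (cases "x \<in> SH \<and> y \<in> SH")
    case True
    then show ?thesis using le by (auto intro: antisym)
  qed (auto simp: riemannian_dist_def)
next
  fix x y assume xy: "x \<in> SH" "y \<in> SH"
  show "dH x y = 0 \<longleftrightarrow> x = y"
  proof
    assume "dH x y = 0"
    obtain c r where "c > 0" "r > 0" "\<And>y. y \<in> SH \<Longrightarrow> c * min r (norm (y - x)) \<le> dH x y"
      using dist_lower_bound[OF xy(1)] by blast
    then have "min r (norm (y - x)) \<le> 0" using xy \<open>dH x y = 0\<close> by (metis mult_le_0_iff not_le)
    then show "x = y" using \<open>r > 0\<close> by (simp add: min_def split: if_splits)
  next
    assume "x = y"
    have x: "x \<in> U" "h x = 1" using xy by (auto simp: level_def)
    have *: "(\<lambda>t::real. retract x) \<in> admissible_curves gH SH (retract x) (retract x)"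
      by (rule retract_curve(1)[of "\<lambda>_. x" "\<lambda>_. 0"]) (use x in auto)
    have "curve_speed gH (\<lambda>t::real. x) = (\<lambda>t. 0)"
      by (simp add: curve_speed_def neg_hessian_form_eq fun_eq_iff)
    then have "dH x x \<le> 0"
      using dist_le_length[OF *] retract_level[OF x(2)] xy by simp
    moreover have "0 \<le> dH x x" using xy by (intro dist_geI length_nonneg) auto
    ultimately show "dH x y = 0" using \<open>x = y\<close> by simp
  qed
next
  fix x y z assume xyz: "x \<in> SH" "y \<in> SH" "z \<in> SH"
  show "dH x z \<le> dH x y + dH y z"
  proof (rule field_le_epsilon)
    fix e :: real assume e: "e > 0"
    obtain \<gamma> where \<gamma>: "\<gamma> \<in> admissible_curves gH SH x y" "len \<gamma> < dH x y + e / 2"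
      using dist_lessE[of x y "dH x y + e / 2"] xyz e by auto
    obtain \<gamma>' where \<gamma>': "\<gamma>' \<in> admissible_curves gH SH y z" "len \<gamma>' < dH y z + e / 2"
      using dist_lessE[of y z "dH y z + e / 2"] xyz e by auto
    show "dH x z \<le> dH x y + dH y z + e"
      using dist_le_length[OF admissible_join(1)[OF \<gamma>(1) \<gamma>'(1)]] admissible_join(2)[OF \<gamma>(1) \<gamma>'(1)]
        \<gamma>(2) \<gamma>'(2) xyz by simp
  qed
qed

sublocale Metric_space SH dH by (rule Metric_space_level)

text \<open>This identifies metric limits with Euclidean ones, so that a limit of a Cauchy sequence
  can be located in the ambient space.\<close>

lemma limitin_imp_tendsto:
  assumes "limitin mtopology \<sigma> x sequentially"
  shows "\<sigma> \<longlonglongrightarrow> x"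
proof (rule LIMSEQ_I)
  have x: "x \<in> SH" and lim: "\<And>e. e > 0 \<Longrightarrow> \<forall>\<^sub>F n in sequentially. \<sigma> n \<in> SH \<and> dH (\<sigma> n) x < e"
    using assms by (auto simp: limitin_metric)
  obtain c r where cr: "c > 0" "r > 0" "\<And>y. y \<in> SH \<Longrightarrow> c * min r (norm (y - x)) \<le> dH x y"
    using dist_lower_bound[OF x] by blast
  fix e :: real assume e: "e > 0"
  have "\<forall>\<^sub>F n in sequentially. \<sigma> n \<in> SH \<and> dH (\<sigma> n) x < c * min r e"
    using lim[of "c * min r e"] cr(1,2) e by simp
  then have "\<forall>\<^sub>F n in sequentially. norm (\<sigma> n - x) < e"
  proof eventually_elim
    case (elim n)
    then have "c * min r (norm (\<sigma> n - x)) < c * min r e"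
      using cr(3)[of "\<sigma> n"] commute[of x "\<sigma> n"] by force
    then show ?case using cr(1) by (auto simp: min_def split: if_splits)
  qed
  then show "\<exists>N. \<forall>n\<ge>N. norm (\<sigma> n - x) < e" by (simp add: eventually_sequentially)
qed

end

text \<open>The point x need not lie in a hyperbolic cone: the bound is applied at a missing
  boundary point as well as at a point of the level set.\<close>

lemma (in cubic) retract_speed_bound:
  assumes x: "h x = 1"
  obtains \<delta> C where "\<delta> > 0" "C \<ge> 0" "\<And>q. q \<in> ball x \<delta> \<Longrightarrow> h q > 0"
    "\<And>q u. q \<in> ball x \<delta> \<Longrightarrow> sqrt (6 * ((T q q u)\<^sup>2 / (h q)\<^sup>2 - T q u u / h q)) \<le> C * norm u"
proof -
  obtain B where B: "B > 0" "\<And>x y z. \<bar>T x y z\<bar> \<le> B * norm x * norm y * norm z"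
    using polar_bound by blast
  have "open {q. h q > 1 / 2}"
    by (intro open_Collect_less continuous_intros continuous_on_form)
  then obtain d where d: "d > 0" "ball x d \<subseteq> {q. h q > 1 / 2}"
    using x open_contains_ball by (metis (mono_tags, lifting) half_gt_zero_iff mem_Collect_eq
        field_sum_of_halves less_add_same_cancel1 zero_less_one)
  define \<delta> where "\<delta> = min d 1"
  define R where "R = norm x + 1"
  \<comment> \<open>On the ball h > 1/2, \<open>T q q u\<close> is at most B R^2 times the norm of u
    and \<open>T q u u\<close> at most B R times its square; the factors 4 and 2 come from dividing
    by h^2 and h.\<close>
  define C where "C = sqrt (6 * (4 * (B * R * R)\<^sup>2 + 2 * (B * R)))"
  have R: "R > 0" by (simp add: R_def add_nonneg_pos)
  have hq: "h q > 1 / 2" "norm q \<le> R" if "q \<in> ball x \<delta>" for q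
  proof -
    show "h q > 1 / 2" using that d by (auto simp: \<delta>_def)
    have "norm q \<le> norm x + norm (q - x)" by (metis add.commute diff_add_cancel norm_triangle_ineq)
    then show "norm q \<le> R" using that by (simp add: \<delta>_def R_def dist_norm norm_minus_commute)
  qed
  have "sqrt (6 * ((T q q u)\<^sup>2 / (h q)\<^sup>2 - T q u u / h q)) \<le> C * norm u" if q: "q \<in> ball x \<delta>" for q u
  proof -
    have "\<bar>T q q u\<bar> \<le> B * R * R * norm u"
      using B(2)[of q q u] hq[OF q] B(1) R
      by (smt (verit, best) mult_left_mono mult_right_mono mult_mono norm_ge_zero mult_nonneg_nonneg)
    then have "(T q q u)\<^sup>2 \<le> (B * R * R * norm u)\<^sup>2"
      by (rule abs_le_square_iff[THEN iffD1, OF order_trans]) simp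
    moreover have "(h q)\<^sup>2 \<ge> 1 / 4"
      using power_mono[of "1 / 2" "h q" 2] hq[OF q] by (simp add: power_divide)
    ultimately have 1: "(T q q u)\<^sup>2 / (h q)\<^sup>2 \<le> (B * R * R * norm u)\<^sup>2 / (1 / 4)"
      by (intro frac_le) auto
    have "\<bar>T q u u\<bar> \<le> B * R * norm u * norm u"
      using B(2)[of q u u] hq[OF q] B(1) R
      by (smt (verit, best) mult_left_mono mult_right_mono mult_mono norm_ge_zero mult_nonneg_nonneg)
    then have "\<bar>T q u u\<bar> / h q \<le> B * R * norm u * norm u / (1 / 2)"
      using hq[OF q] by (intro frac_le) auto
    moreover have "- T q u u / h q \<le> \<bar>T q u u\<bar> / h q"
      using hq[OF q] by (intro divide_right_mono) auto
    ultimately have "6 * ((T q q u)\<^sup>2 / (h q)\<^sup>2 - T q u u / h q)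
        \<le> 6 * ((B * R * R * norm u)\<^sup>2 / (1 / 4) + B * R * norm u * norm u / (1 / 2))"
      using 1 by simp
    also have "\<dots> = (6 * (4 * (B * R * R)\<^sup>2 + 2 * (B * R))) * (norm u)\<^sup>2"
      by (simp add: power2_eq_square algebra_simps)
    finally show ?thesis
      unfolding C_def using real_sqrt_le_mono[of _ "_ * (norm u)\<^sup>2"] by (fastforce simp: real_sqrt_mult)
  qed
  moreover have "C \<ge> 0" using B R by (simp add: C_def)
  ultimately show ?thesis using that[of \<delta> C] hq d by (force simp: \<delta>_def)
qed

context hyperbolic
begin

lemma dist_retract_le:
  assumes C: "\<And>t. t \<in> {0..1} \<Longrightarrow> sqrt (6 * ((T (y + t *\<^sub>R v) (y + t *\<^sub>R v) v)\<^sup>2 / (h (y + t *\<^sub>R v))\<^sup>2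
      - T (y + t *\<^sub>R v) v v / h (y + t *\<^sub>R v))) \<le> C"
    and U: "\<And>t. t \<in> {0..1} \<Longrightarrow> y + t *\<^sub>R v \<in> U"
  shows "dH (retract y) (retract (y + v)) \<le> C"
proof -
  let ?\<gamma> = "\<lambda>t::real. y + t *\<^sub>R v"
  have der: "(?\<gamma> has_vector_derivative v) (at t)" for t
    by (auto intro!: derivative_eq_intros)
  note cv = retract_curve[of ?\<gamma> "\<lambda>_. v", OF der _ U]
  have adm: "(\<lambda>t. retract (?\<gamma> t)) \<in> admissible_curves gH SH (retract y) (retract (y + v))"
    using cv(1) by simp
  have "len (\<lambda>t. retract (?\<gamma> t)) \<le> integral {0..1} (\<lambda>t::real. C)"
    using adm C cv(2) by (intro integral_le) (auto simp: admissible_curves_def)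
  then show ?thesis
    using dist_le_length[OF adm] retract_in_level[OF U[of 0]] retract_in_level[OF U[of 1]] by simp
qed

text \<open>A point x of the closure with h x = 1 outside U is approached along a segment from a
  nearby y in U. The radial projection of the part inside U has finite length, so it yields a Cauchy
  sequence; its metric limit lies in U and is also its Euclidean limit, which lies outside.\<close>

lemma complete_imp_maximal:
  assumes complete: "mcomplete"
  shows "maximal_hyperbolic h U"
proof
  fix x0 assume x0: "x0 \<in> closure U" "h x0 > 0"
  define k where "k = h x0 powr (-1/3)"
  have k: "k > 0" using x0 by (simp add: k_def)
  define x where "x = k *\<^sub>R x0"
  have hx: "h x = 1" using form_retract[OF x0(2)] by (simp add: x_def k_def retract_def)
  have "x \<in> closure U"
  proof -
    have "x \<in> (*\<^sub>R) k ` closure U" unfolding x_def using x0(1) by (rule imageI)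
    also have "\<dots> = closure ((*\<^sub>R) k ` U)" by (rule closure_scaleR)
    also have "\<dots> \<subseteq> closure U" using cone k by (intro closure_mono) auto
    finally show ?thesis .
  qed
  have "x \<in> U"
  proof (rule ccontr)
    assume xU: "x \<notin> U"
    obtain \<delta> C where \<delta>: "\<delta> > 0" "C \<ge> 0" "\<And>q. q \<in> ball x \<delta> \<Longrightarrow> h q > 0"
      "\<And>q u. q \<in> ball x \<delta> \<Longrightarrow> sqrt (6 * ((T q q u)\<^sup>2 / (h q)\<^sup>2 - T q u u / h q)) \<le> C * norm u"
      using retract_speed_bound[OF hx] by metis
    obtain y where y: "y \<in> U" "y \<in> ball x \<delta>"
      using \<open>x \<in> closure U\<close> \<delta>(1) by (auto simp: closure_approachable dist_commute)
    define P where "P t = y + t *\<^sub>R (x - y)" for t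
    have Pball: "P t \<in> ball x \<delta>" if "0 \<le> t" "t \<le> 1" for t
    proof -
      have "P t = (1 - t) *\<^sub>R y + t *\<^sub>R x" by (simp add: P_def algebra_simps)
      then show ?thesis
        using convexD[OF convex_ball y(2) centre_in_ball[THEN iffD2, OF \<delta>(1)], of "1 - t" t] that
        by simp
    qed
    \<comment> \<open>The segment may leave U before reaching x, so the argument is run at the first
      exit point P s.\<close>
    define A where "A = {0..1} \<inter> P -` (- U)"
    have contP: "continuous_on S P" for S unfolding P_def by (intro continuous_intros)
    have "closed A" unfolding A_def using open_cone
      by (intro continuous_closed_preimage contP) auto
    then have "compact A" by (auto simp: compact_eq_bounded_closed A_def intro: bounded_subset[of "{0..1}"])
    moreover have "1 \<in> A" using xU by (simp add: A_def P_def)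
    ultimately obtain s where s: "s \<in> A" "\<And>t. t \<in> A \<Longrightarrow> s \<le> t"
      using compact_attains_inf[of A] by blast
    have s01: "0 < s" "s \<le> 1" "P s \<notin> U"
      using s(1) y by (auto simp: A_def P_def less_le)
    have PU: "P t \<in> U" if "0 \<le> t" "t < s" for t
      using that s(2)[of t] s01 by (force simp: A_def)
    define tn where "tn n = s * (1 - 1 / (real n + 1))" for n
    have tn: "0 \<le> tn n" "tn n < s" for n using s01 by (auto simp: tn_def field_simps)
    have "(\<lambda>n. s * (1 - inverse (real (Suc n)))) \<longlonglongrightarrow> s * (1 - 0)"
      by (intro tendsto_intros LIMSEQ_inverse_real_of_nat)
    then have tnlim: "tn \<longlonglongrightarrow> s"
      by (simp add: tn_def[abs_def] inverse_eq_divide add.commute)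
    define \<sigma> where "\<sigma> n = retract (P (tn n))" for n
    have d\<sigma>: "dH (\<sigma> m) (\<sigma> n) \<le> C * norm (P (tn n) - P (tn m))" for m n
    proof -
      have *: "P (tn m) + t *\<^sub>R (P (tn n) - P (tn m)) = P ((1 - t) * tn m + t * tn n)" for t
        by (simp add: P_def algebra_simps)
      have **: "0 \<le> (1 - t) * tn m + t * tn n" "(1 - t) * tn m + t * tn n < s" if "t \<in> {0..1}" for t
      proof -
        show "0 \<le> (1 - t) * tn m + t * tn n" using that tn by auto
        show "(1 - t) * tn m + t * tn n < s"
          using convex_bound_lt[OF tn(2)[of m] tn(2)[of n], of "1 - t" t] that by simp
      qed
      have "dH (retract (P (tn m))) (retract (P (tn m) + (P (tn n) - P (tn m))))
        \<le> C * norm (P (tn n) - P (tn m))"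
      proof (rule dist_retract_le)
        fix t :: real assume t: "t \<in> {0..1}"
        show "P (tn m) + t *\<^sub>R (P (tn n) - P (tn m)) \<in> U"
          unfolding * using **[OF t] by (intro PU)
        have "P ((1 - t) * tn m + t * tn n) \<in> ball x \<delta>"
          using **[OF t] s01 by (intro Pball) auto
        from \<delta>(4)[OF this]
        show "sqrt (6 * ((T (P (tn m) + t *\<^sub>R (P (tn n) - P (tn m))) (P (tn m) + t *\<^sub>R (P (tn n) - P (tn m))) (P (tn n) - P (tn m)))\<^sup>2
            / (h (P (tn m) + t *\<^sub>R (P (tn n) - P (tn m))))\<^sup>2
          - T (P (tn m) + t *\<^sub>R (P (tn n) - P (tn m))) (P (tn n) - P (tn m)) (P (tn n) - P (tn m)) / h (P (tn m) + t *\<^sub>R (P (tn n) - P (tn m)))))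
          \<le> C * norm (P (tn n) - P (tn m))"
          unfolding * .
      qed
      then show ?thesis by (simp add: \<sigma>_def)
    qed
    have Plim: "(\<lambda>n. P (tn n)) \<longlonglongrightarrow> P s"
      unfolding P_def by (intro tendsto_intros tnlim)
    have \<sigma>S: "\<sigma> n \<in> SH" for n unfolding \<sigma>_def using tn by (intro retract_in_level PU)
    have "MCauchy \<sigma>"
      unfolding MCauchy_def
    proof (intro conjI allI impI)
      show "range \<sigma> \<subseteq> SH" using \<sigma>S by blast
      fix e :: real assume e: "e > 0"
      then have "e / (C + 1) > 0" using \<delta>(2) by simp
      then obtain N where N: "\<And>m n. m \<ge> N \<Longrightarrow> n \<ge> N \<Longrightarrow> norm (P (tn m) - P (tn n)) < e / (C + 1)"
        using LIMSEQ_imp_Cauchy[OF Plim] by (meson CauchyD)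
      have "dH (\<sigma> n) (\<sigma> n') < e" if "N \<le> n" "N \<le> n'" for n n'
      proof -
        have "dH (\<sigma> n) (\<sigma> n') \<le> C * norm (P (tn n') - P (tn n))" by (rule d\<sigma>)
        also have "\<dots> \<le> (C + 1) * norm (P (tn n') - P (tn n))" by (simp add: mult_right_mono)
        also have "\<dots> < (C + 1) * (e / (C + 1))"
          using \<delta>(2) N that by (intro mult_strict_left_mono) auto
        finally show ?thesis using \<delta>(2) by simp
      qed
      then show "\<exists>N. \<forall>n n'. N \<le> n \<longrightarrow> N \<le> n' \<longrightarrow> dH (\<sigma> n) (\<sigma> n') < e" by blast
    qed
    then obtain q where q: "limitin mtopology \<sigma> q sequentially"
      using complete by (auto simp: mcomplete_def)
    then have "\<sigma> \<longlonglongrightarrow> q" "q \<in> SH" by (auto simp: limitin_imp_tendsto limitin_metric)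
    moreover have "\<sigma> \<longlonglongrightarrow> retract (P s)"
    proof -
      have "continuous_on (ball x \<delta>) (\<lambda>q. retract q)"
        by (intro continuous_on_retract continuous_intros \<delta>(3))
      then have "isCont retract (P s)"
        using Pball[of s] s01 by (simp add: continuous_on_eq_continuous_at)
      then show ?thesis unfolding \<sigma>_def using Plim by (rule isCont_tendsto_compose)
    qed
    ultimately have "retract (P s) \<in> U" using LIMSEQ_unique by (fastforce simp: level_def)
    moreover have hP: "h (P s) > 0" using \<delta>(3) Pball s01 by simp
    ultimately have "(1 / h (P s) powr (-1/3)) *\<^sub>R retract (P s) \<in> U" by (intro cone) auto
    then show False using hP s01 by (simp add: retract_def)
  qed
  then have "(1 / k) *\<^sub>R x \<in> U" using k by (intro cone) auto
  then show "x0 \<in> U" using k by (simp add: x_def)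
qed

end

section \<open>Components of {h > 0} are complete\<close>

context maximal_hyperbolic
begin

text \<open>For l = \<open>T p p\<close>, the squared speed being \<open>- 6 * T x v v\<close>, the
  gradient bound reads (dl)^2 \<le> 2/3 speed^2 l^2, which suffices for the Lipschitz constant
  1.\<close>

lemma ln_linear_form_lipschitz:
  assumes p: "p \<in> SH" and x: "x \<in> SH" and y: "y \<in> SH"
  shows "\<bar>ln (T p p y) - ln (T p p x)\<bar> \<le> dH x y"
proof (rule dist_geI[OF x y])
  have p': "p \<in> U" "h p = 1" using p by (auto simp: level_def)
  fix \<gamma> assume \<gamma>: "\<gamma> \<in> admissible_curves gH SH x y"
  note reg = curve_in_level[OF \<gamma>]
  have l: "T p p (\<gamma> t) > 0" if "t \<in> {0..1}" for t
    using cone_iff[OF p', of "\<gamma> t"] reg(4)[OF that] by (simp add: level_def)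
  obtain F where F: "finite F" "{0, 1} \<subseteq> F" "\<And>t. t \<in> {0..1} - F \<Longrightarrow> 0 < t \<and> t < 1 \<and>
     (\<gamma> has_vector_derivative vector_derivative \<gamma> (at t)) (at t) \<and>
     \<gamma> t \<in> SH \<and> T (\<gamma> t) (\<gamma> t) (vector_derivative \<gamma> (at t)) = 0 \<and> curve_speed gH \<gamma> t \<ge> 0 \<and>
     (curve_speed gH \<gamma> t)\<^sup>2 = - 6 * T (\<gamma> t) (vector_derivative \<gamma> (at t)) (vector_derivative \<gamma> (at t))"
    using admissible_regular[OF \<gamma>] by metis
  let ?\<psi> = "\<lambda>t. ln (T p p (\<gamma> t))"
  have "norm (?\<psi> 1 - ?\<psi> 0) \<le> 1 * len \<gamma>"
  proof (rule length_bounds_variation[OF \<gamma> _ _ F(1)])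
    show "continuous_on {0..1} ?\<psi>"
      using l by (intro continuous_intros reg(1)) fastforce
    fix t assume "t \<in> {0<..<1} - F"
    then have t: "t \<in> {0..1} - F" by auto
    let ?v = "vector_derivative \<gamma> (at t)"
    have lt: "T p p (\<gamma> t) > 0" using l t by simp
    have "((\<lambda>t. T p p (\<gamma> t)) has_derivative (\<lambda>s. T 0 p (\<gamma> t) + T p 0 (\<gamma> t) + T p p (s *\<^sub>R ?v))) (at t)"
      using F(3)[OF t] unfolding has_vector_derivative_def
      by (intro has_derivative_polar has_derivative_const) auto
    moreover have "(\<lambda>s. T 0 p (\<gamma> t) + T p 0 (\<gamma> t) + T p p (s *\<^sub>R ?v)) = (*) (T p p ?v)"
      by (auto simp: scale3)
    ultimately have "((\<lambda>t. T p p (\<gamma> t)) has_real_derivative T p p ?v) (at t)"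
      by (simp add: has_field_derivative_def)
    from DERIV_chain2[where f = ln and g = "\<lambda>t. T p p (\<gamma> t)", OF DERIV_ln_divide[OF lt] this]
    have 1: "(?\<psi> has_real_derivative T p p ?v / T p p (\<gamma> t)) (at t)" by simp
    have "\<bar>T p p ?v\<bar> \<le> curve_speed gH \<gamma> t * T p p (\<gamma> t)"
    proof (rule power2_le_imp_le)
      have "3 * (T p p ?v)\<^sup>2 \<le> 4 * (- 3 * T (\<gamma> t) ?v ?v) * (T p p (\<gamma> t))\<^sup>2"
        using F(3)[OF t] by (intro linear_form_gradient_bound p') (auto simp: level_def)
      also have "\<dots> = 2 * (curve_speed gH \<gamma> t)\<^sup>2 * (T p p (\<gamma> t))\<^sup>2"
        using F(3)[OF t] by simp
      also have "\<dots> \<le> 3 * (curve_speed gH \<gamma> t * T p p (\<gamma> t))\<^sup>2"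
        by (simp add: power_mult_distrib)
      finally show "\<bar>T p p ?v\<bar>\<^sup>2 \<le> (curve_speed gH \<gamma> t * T p p (\<gamma> t))\<^sup>2" by simp
    qed (use F(3)[OF t] lt in simp)
    then show "(?\<psi> has_vector_derivative T p p ?v / T p p (\<gamma> t)) (at t) \<and>
       norm (T p p ?v / T p p (\<gamma> t)) \<le> 1 * curve_speed gH \<gamma> t"
      using 1 lt by (simp add: has_real_derivative_iff_has_vector_derivative field_simps)
  qed auto
  then show "\<bar>ln (T p p y) - ln (T p p x)\<bar> \<le> len \<gamma>" using reg by simp
qed

text \<open>Along a Cauchy sequence the logarithm of the linear form is bounded, so the sequence
  stays in a compact sublevel set. A Euclidean limit of a subsequence is a metric limit because the
  metric is bounded near it, and a Cauchy sequence with a convergent subsequence converges.\<close>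

lemma complete: "mcomplete"
  unfolding mcomplete_def
proof (intro allI impI)
  fix \<sigma> assume \<sigma>: "MCauchy \<sigma>"
  then have \<sigma>S: "\<sigma> n \<in> SH" for n by (auto simp: MCauchy_def)
  obtain p where p: "p \<in> SH" using level_nonempty by blast
  have p': "p \<in> U" "h p = 1" using p by (auto simp: level_def)
  obtain N where N: "\<And>n n'. N \<le> n \<Longrightarrow> N \<le> n' \<Longrightarrow> dH (\<sigma> n) (\<sigma> n') < 1"
    using \<sigma> unfolding MCauchy_def by (metis zero_less_one)
  define R where "R = exp (ln (T p p (\<sigma> N)) + 1)"
  have R: "T p p (\<sigma> (N + n)) \<le> R" for n
  proof -
    have "ln (T p p (\<sigma> (N + n))) \<le> ln (T p p (\<sigma> N)) + 1"
      using ln_linear_form_lipschitz[OF p \<sigma>S[of N] \<sigma>S[of "N + n"]] N[of N "N + n"] by simp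
    moreover have "T p p (\<sigma> (N + n)) > 0"
      using cone_iff[OF p'] \<sigma>S[of "N + n"] by (simp add: level_def)
    ultimately show ?thesis unfolding R_def by (metis exp_le_cancel_iff exp_ln)
  qed
  have "seq_compact {x \<in> SH. T p p x \<le> R}"
    using compact_sublevel[OF p'] by (rule compact_imp_seq_compact)
  then obtain x r where xr: "x \<in> SH" "strict_mono r" "((\<lambda>n. \<sigma> (N + n)) \<circ> r) \<longlonglongrightarrow> x"
    using seq_compactE[of _ "\<lambda>n. \<sigma> (N + n)"] R \<sigma>S by (metis (mono_tags, lifting) mem_Collect_eq)
  have hx: "x \<in> U" "h x = 1" using xr by (auto simp: level_def)
  obtain \<delta> C where \<delta>: "\<delta> > 0" "C \<ge> 0" "\<And>q. q \<in> ball x \<delta> \<Longrightarrow> h q > 0"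
    "\<And>q u. q \<in> ball x \<delta> \<Longrightarrow> sqrt (6 * ((T q q u)\<^sup>2 / (h q)\<^sup>2 - T q u u / h q)) \<le> C * norm u"
    using retract_speed_bound[OF hx(2)] by metis
  have near: "dH y x \<le> C * norm (x - y)" if y: "y \<in> SH" "y \<in> ball x \<delta>" for y
  proof -
    have ball: "y + t *\<^sub>R (x - y) \<in> ball x \<delta>" if "t \<in> {0..1}" for t
    proof -
      have "y + t *\<^sub>R (x - y) = (1 - t) *\<^sub>R y + t *\<^sub>R x" by (simp add: algebra_simps)
      then show ?thesis
        using convexD[OF convex_ball y(2) centre_in_ball[THEN iffD2, OF \<delta>(1)], of "1 - t" t] that
        by simp
    qed
    \<comment> \<open>The ball is connected and h is positive on it, so it lies in the component
      U.\<close>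
    have "x \<in> ball x \<delta> \<inter> U" using hx \<delta>(1) by simp
    then have "ball x \<delta> \<subseteq> U" using \<delta>(3) by (intro connected_subset connected_ball) blast+
    then have "dH (retract y) (retract (y + (x - y))) \<le> C * norm (x - y)"
      using ball by (intro dist_retract_le \<delta>(4)) auto
    then show ?thesis using y hx retract_level by (simp add: level_def)
  qed
  define \<rho> where "\<rho> n = N + r n" for n
  have "strict_mono \<rho>" using xr(2) by (simp add: \<rho>_def strict_mono_def)
  moreover have "limitin mtopology (\<sigma> \<circ> \<rho>) x sequentially"
    unfolding limitin_metric
  proof (intro conjI allI impI xr(1))
    have lim: "(\<lambda>n. \<sigma> (\<rho> n)) \<longlonglongrightarrow> x" using xr(3) by (simp add: \<rho>_def o_def)
    fix e :: real assume e: "e > 0"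
    then have "min \<delta> (e / (C + 1)) > 0" using \<delta> by simp
    with lim have "\<forall>\<^sub>F n in sequentially. dist (\<sigma> (\<rho> n)) x < min \<delta> (e / (C + 1))"
      by (rule tendstoD)
    then show "\<forall>\<^sub>F n in sequentially. (\<sigma> \<circ> \<rho>) n \<in> SH \<and> dH ((\<sigma> \<circ> \<rho>) n) x < e"
    proof eventually_elim
      case (elim n)
      have "dH (\<sigma> (\<rho> n)) x \<le> C * norm (x - \<sigma> (\<rho> n))"
        using elim by (intro near \<sigma>S) (simp add: dist_commute)
      also have "\<dots> \<le> (C + 1) * norm (x - \<sigma> (\<rho> n))" by (simp add: mult_right_mono)
      also have "\<dots> < (C + 1) * (e / (C + 1))"
        using \<delta>(2) elim by (intro mult_strict_left_mono) (auto simp: dist_norm norm_minus_commute)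
      finally show ?case using \<delta>(2) \<sigma>S by simp
    qed
  qed
  ultimately show "\<exists>x. limitin mtopology \<sigma> x sequentially"
    using MCauchy_convergent_subsequence[OF \<sigma>] by blast
qed

end

theorem complete_projective_special_real_iff:
  "complete_projective_special_real H \<longleftrightarrow> (\<exists>h U. maximal_hyperbolic h U \<and> H = level h U)"
proof
  assume "complete_projective_special_real H"
  then obtain h U where *: "hyperbolic h U" "H = level h U"
    "Metric_space.mcomplete (level h U) (riemannian_dist (neg_hessian_form h) (level h U))"
    by (auto simp: complete_projective_special_real_def psr_datum_iff)
  from hyperbolic.complete_imp_maximal[OF *(1,3)] *(2)
  show "\<exists>h U. maximal_hyperbolic h U \<and> H = level h U" by blast
next
  assume "\<exists>h U. maximal_hyperbolic h U \<and> H = level h U"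
  then obtain h U where *: "maximal_hyperbolic h U" "H = level h U" by blast
  interpret maximal_hyperbolic h U by fact
  show "complete_projective_special_real H"
    unfolding complete_projective_special_real_def psr_datum_iff
    using complete *(2) hyperbolic_axioms by blast
qed

section \<open>Linear equivalence\<close>

lemma homogeneous_cubic_zero: "homogeneous_cubic (\<lambda>x. 0)"
  unfolding homogeneous_cubic_def by (rule exI[of _ "\<lambda>_ _ _. 0"]) simp

lemma homogeneous_cubic_cmult:
  assumes "homogeneous_cubic f" shows "homogeneous_cubic (\<lambda>x. r * f x)"
proof -
  obtain c where "\<And>x. f x = (\<Sum>i\<in>UNIV. \<Sum>j\<in>UNIV. \<Sum>k\<in>UNIV. c i j k * x $ i * x $ j * x $ k)"
    using assms by (auto simp: homogeneous_cubic_def)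
  then show ?thesis
    unfolding homogeneous_cubic_def
    by (intro exI[of _ "\<lambda>i j k. r * c i j k"]) (simp add: sum_distrib_left mult.assoc)
qed

lemma homogeneous_cubic_add:
  assumes "homogeneous_cubic f" "homogeneous_cubic g" shows "homogeneous_cubic (\<lambda>x. f x + g x)"
proof -
  obtain c d where "\<And>x. f x = (\<Sum>i\<in>UNIV. \<Sum>j\<in>UNIV. \<Sum>k\<in>UNIV. c i j k * x $ i * x $ j * x $ k)"
    "\<And>x. g x = (\<Sum>i\<in>UNIV. \<Sum>j\<in>UNIV. \<Sum>k\<in>UNIV. d i j k * x $ i * x $ j * x $ k)"
    using assms by (auto simp: homogeneous_cubic_def)
  then show ?thesis
    unfolding homogeneous_cubic_def
    by (intro exI[of _ "\<lambda>i j k. c i j k + d i j k"]) (simp add: sum.distrib distrib_right)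
qed

lemma homogeneous_cubic_diff:
  assumes "homogeneous_cubic f" "homogeneous_cubic g" shows "homogeneous_cubic (\<lambda>x. f x - g x)"
  using homogeneous_cubic_add[OF assms(1) homogeneous_cubic_cmult[OF assms(2), of "-1"]] by simp

lemma homogeneous_cubic_sum:
  assumes "\<And>i. i \<in> I \<Longrightarrow> homogeneous_cubic (f i)" shows "homogeneous_cubic (\<lambda>x. \<Sum>i\<in>I. f i x)"
  using assms
  by (induction I rule: infinite_finite_induct) (auto intro: homogeneous_cubic_zero homogeneous_cubic_add)

lemma homogeneous_cubic_product:
  fixes f g k :: "real ^ 'n \<Rightarrow> real"
  assumes "linear f" "linear g" "linear k"
  shows "homogeneous_cubic (\<lambda>x. f x * g x * k x)"
proof -
  have *: "l x = (\<Sum>i\<in>UNIV. l (axis i 1) * x $ i)" if "linear l" for l :: "real ^ 'n \<Rightarrow> real" and x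
  proof -
    have "l x = l (\<Sum>i\<in>UNIV. (x $ i) *\<^sub>R axis i 1)"
      using basis_expansion[of x] by (simp add: scalar_mult_eq_scaleR)
    also have "\<dots> = (\<Sum>i\<in>UNIV. (x $ i) *\<^sub>R l (axis i 1))"
      using that by (simp add: linear_sum linear_scale)
    finally show ?thesis by (simp add: mult.commute)
  qed
  have "f x * g x * k x = (\<Sum>i\<in>UNIV. \<Sum>j\<in>UNIV. \<Sum>m\<in>UNIV.
      f (axis i 1) * g (axis j 1) * k (axis m 1) * x $ i * x $ j * x $ m)" for x
  proof -
    have "f x * g x * k x = (\<Sum>i\<in>UNIV. f (axis i 1) * x $ i) *
        (\<Sum>j\<in>UNIV. \<Sum>m\<in>UNIV. (g (axis j 1) * x $ j) * (k (axis m 1) * x $ m))"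
    proof -
      have "g x * k x = (\<Sum>j\<in>UNIV. \<Sum>m\<in>UNIV. (g (axis j 1) * x $ j) * (k (axis m 1) * x $ m))"
        by (simp only: *[OF assms(2), of x] *[OF assms(3), of x] sum_product)
      then show ?thesis by (simp only: *[OF assms(1), of x] mult.assoc)
    qed
    also have "\<dots> = (\<Sum>i\<in>UNIV. f (axis i 1) * x $ i *
        (\<Sum>j\<in>UNIV. \<Sum>m\<in>UNIV. (g (axis j 1) * x $ j) * (k (axis m 1) * x $ m)))"
      by (rule sum_distrib_right)
    finally show ?thesis by (simp add: sum_distrib_left mult_ac)
  qed
  then show ?thesis
    unfolding homogeneous_cubic_def
    by (intro exI[of _ "\<lambda>i j m. f (axis i 1) * g (axis j 1) * k (axis m 1)"]) simp
qed

lemma linear_vec_nth: "linear (\<lambda>x. x $ i)"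
  by (simp add: linear_iff)

lemmas homogeneous_cubic_monomial =
  homogeneous_cubic_product[OF linear_vec_nth linear_vec_nth linear_vec_nth]

lemma homogeneous_cubic_compose:
  fixes h :: "real ^ 'n \<Rightarrow> real" and A :: "real ^ 'n ^ 'n"
  assumes "homogeneous_cubic h"
  shows "homogeneous_cubic (\<lambda>x. h (A *v x))"
proof -
  obtain c where c: "\<And>x. h x = (\<Sum>i\<in>UNIV. \<Sum>j\<in>UNIV. \<Sum>k\<in>UNIV. c i j k * x $ i * x $ j * x $ k)"
    using assms by (auto simp: homogeneous_cubic_def)
  have lin: "linear (\<lambda>x. (A *v x) $ i)" for i
    by (simp add: linear_iff matrix_vector_right_distrib matrix_vector_mult_scaleR)
  show ?thesis unfolding c mult.assoc
    by (intro homogeneous_cubic_sum homogeneous_cubic_cmult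
        homogeneous_cubic_product[OF lin lin lin, unfolded mult.assoc])
qed

lemma polar_compose:
  "polar (\<lambda>x. h ((A :: real ^ 'n ^ 'm) *v x)) x y z = polar h (A *v x) (A *v y) (A *v z)"
  by (simp add: polar_def matrix_vector_right_distrib)

lemma invertible_kernel:
  fixes A :: "real ^ 'n ^ 'n"
  shows "invertible A \<longleftrightarrow> (\<forall>x. A *v x = 0 \<longrightarrow> x = 0)"
  by (metis invertible_left_inverse matrix_left_invertible_ker)

lemma invertible_surj:
  fixes A :: "real ^ 'n ^ 'n"
  assumes "invertible A" obtains x where "A *v x = y"
  using assms by (metis invertible_def matrix_vector_mul_assoc matrix_vector_mul_lid)

lemma invertible_inj:
  fixes A :: "real ^ 'n ^ 'n"
  assumes "invertible A" "A *v x = A *v y" shows "x = y"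
  using assms by (metis invertible_def matrix_vector_mul_assoc matrix_vector_mul_lid)

lemma continuous_on_matrix_mult:
  fixes A :: "real ^ 'n ^ 'm"
  shows "continuous_on S (\<lambda>x. A *v x)"
  by (simp add: linear_continuous_on linear_conv_bounded_linear[symmetric])

lemma maximal_hyperbolic_compose:
  fixes A :: "real ^ 'n ^ 'n"
  assumes "maximal_hyperbolic h U" and A: "invertible A"
  shows "maximal_hyperbolic (\<lambda>x. h (A *v x)) {x. A *v x \<in> U}"
proof -
  interpret maximal_hyperbolic h U by fact
  obtain B where B: "A ** B = mat 1" "B ** A = mat 1" using A by (auto simp: invertible_def)
  have AB: "A *v (B *v x) = x" "B *v (A *v x) = x" for x
    by (simp_all add: matrix_vector_mul_assoc B)
  show ?thesis
  proof
    show "homogeneous_cubic (\<lambda>x. h (A *v x))"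
      by (rule homogeneous_cubic_compose[OF homogeneous])
    show "open {x. A *v x \<in> U}"
      using open_vimage[OF open_cone continuous_on_matrix_mult[of UNIV A]]
      by (simp add: vimage_def)
    have "{x. A *v x \<in> U} = (\<lambda>x. B *v x) ` U"
      using AB by (auto simp: image_iff) metis
    then show "connected {x. A *v x \<in> U}"
      using connected_continuous_image[OF continuous_on_matrix_mult connected_cone] by simp
    obtain u where "u \<in> U" using nonempty by blast
    then show "{x. A *v x \<in> U} \<noteq> {}" using AB(1)[of u] by (metis empty_iff mem_Collect_eq)
    show "r *\<^sub>R x \<in> {x. A *v x \<in> U}" if "x \<in> {x. A *v x \<in> U}" "r > 0" for x r
      using that cone by (simp add: matrix_vector_mult_scaleR)
    show "h (A *v x) > 0" if "x \<in> {x. A *v x \<in> U}" for x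
      using that pos by simp
    show "polar (\<lambda>x. h (A *v x)) x v v < 0"
      if "x \<in> {x. A *v x \<in> U}" "polar (\<lambda>x. h (A *v x)) x x v = 0" "v \<noteq> 0" for x v
    proof -
      have "A *v v \<noteq> 0" using that(3) AB(2)[of v] by auto
      then show ?thesis using that neg by (simp add: polar_compose[of h A])
    qed
    show "x \<in> {x. A *v x \<in> U}" if "x \<in> closure {x. A *v x \<in> U}" "h (A *v x) > 0" for x
    proof -
      have "(\<lambda>x. A *v x) ` closure {x. A *v x \<in> U} \<subseteq> closure U"
        by (rule image_closure_subset[OF continuous_on_matrix_mult closed_closure])
          (use closure_subset in blast)
      then show ?thesis using that maximal by blast
    qed
  qed
qed

lemma level_compose:
  fixes A :: "real ^ 'n ^ 'n"
  assumes A: "invertible A"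
  shows "(\<lambda>x. A *v x) ` level (\<lambda>x. h (A *v x)) {x. A *v x \<in> U} = level h U"
proof (intro equalityI subsetI)
  fix y assume y: "y \<in> level h U"
  obtain x where "A *v x = y" using invertible_surj[OF A] by blast
  with y show "y \<in> (\<lambda>x. A *v x) ` level (\<lambda>x. h (A *v x)) {x. A *v x \<in> U}"
    by (auto simp: level_def)
qed (auto simp: level_def)

section \<open>Isomorphisms of level sets and rigidity\<close>

lemma psr_isomorphic_refl: "psr_isomorphic H H"
  unfolding psr_isomorphic_def by (rule exI[of _ "mat 1"]) (simp add: invertible_def exI[of _ "mat 1"])

lemma psr_isomorphic_sym:
  fixes H :: "(real ^ 'n) set"
  assumes "psr_isomorphic H H'" shows "psr_isomorphic H' H"
proof -
  obtain A where A: "invertible A" "(\<lambda>x. A *v x) ` H = H'"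
    using assms by (auto simp: psr_isomorphic_def)
  then obtain B where B: "A ** B = mat 1" "B ** A = mat 1" by (auto simp: invertible_def)
  have "(\<lambda>x. B *v x) ` H' = H"
    using A(2) B by (force simp: image_image matrix_vector_mul_assoc)
  then show ?thesis using B by (auto simp: psr_isomorphic_def invertible_def)
qed

lemma psr_isomorphic_trans:
  fixes H :: "(real ^ 'n) set"
  assumes "psr_isomorphic H H'" "psr_isomorphic H' H''" shows "psr_isomorphic H H''"
proof -
  obtain A B where "invertible A" "(\<lambda>x. A *v x) ` H = H'" "invertible B" "(\<lambda>x. B *v x) ` H' = H''"
    using assms by (auto simp: psr_isomorphic_def)
  then have "invertible (B ** A)" "(\<lambda>x. (B ** A) *v x) ` H = H''"
    by (auto simp: invertible_mult image_image simp flip: matrix_vector_mul_assoc)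
  then show ?thesis by (auto simp: psr_isomorphic_def)
qed

lemma psr_isomorphic_compose:
  fixes A :: "real ^ 'n ^ 'n"
  assumes "invertible A"
  shows "psr_isomorphic (level (\<lambda>x. h (A *v x)) {x. A *v x \<in> U}) (level h U)"
  using assms level_compose[OF assms] unfolding psr_isomorphic_def by blast

text \<open>Both cones are components of the same set {h > 0}. This is how a transported cone is
  later recognised from a single point.\<close>

lemma maximal_hyperbolic_unique:
  assumes "maximal_hyperbolic h U" "maximal_hyperbolic h V" "U \<inter> V \<noteq> {}"
  shows "U = V"
proof
  interpret U: maximal_hyperbolic h U by fact
  interpret V: maximal_hyperbolic h V by fact
  show "U \<subseteq> V"
    using V.connected_subset[OF U.connected_cone] U.pos assms(3) by blast
  show "V \<subseteq> U"
    using U.connected_subset[OF V.connected_cone] V.pos assms(3) by blast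
qed

lemma (in cubic) vanishes_on_open:
  assumes "open S" "S \<noteq> {}" "\<And>x. x \<in> S \<Longrightarrow> h x = 0"
  shows "h v = 0"
proof -
  obtain x where x: "x \<in> S" using assms by blast
  have "\<forall>\<^sub>F t in at (0::real). x + t *\<^sub>R v \<in> S"
  proof (rule topological_tendstoD[OF _ assms(1)])
    have "((\<lambda>t. x + t *\<^sub>R v) \<longlongrightarrow> x + 0 *\<^sub>R v) (at 0)" by (intro tendsto_intros)
    then show "((\<lambda>t. x + t *\<^sub>R v) \<longlongrightarrow> x) (at 0)" by simp
  qed (rule x)
  then obtain d where d: "d > 0" "\<And>t. t \<noteq> 0 \<Longrightarrow> \<bar>t\<bar> < d \<Longrightarrow> x + t *\<^sub>R v \<in> S"
    by (auto simp: eventually_at dist_real_def)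
  \<comment> \<open>Small enough that t, -t and 2 t are all admissible; the values at these three
    parameters determine the coefficients of a cubic without constant term.\<close>
  define t where "t = d / 3"
  define a b where "a = 3 * T x x v" and "b = 3 * T x v v"
  have *: "s * a + s\<^sup>2 * b + s ^ 3 * h v = 0" if "s \<noteq> 0" "\<bar>s\<bar> < d" for s
    using assms(3)[OF d(2)[OF that]] assms(3)[OF x] by (simp add: add_scale a_def b_def algebra_simps)
  have t: "t > 0" "3 * t = d" using d by (simp_all add: t_def)
  have 1: "t * a + t\<^sup>2 * b + t ^ 3 * h v = 0" "- t * a + t\<^sup>2 * b - t ^ 3 * h v = 0"
    "2 * t * a + 4 * t\<^sup>2 * b + 8 * t ^ 3 * h v = 0"
    using *[of t] *[of "-t"] *[of "2 * t"] t by (simp_all add: power_mult_distrib)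
  then have "6 * (t ^ 3 * h v) = 0" by argo
  then show ?thesis using t by simp
qed

text \<open>A linear map between the level sets extends to the cones by scaling; the forms then
  agree on a nonempty open set, hence everywhere.\<close>

lemma psr_isomorphic_imp_compose:
  fixes h h' :: "real ^ 'n \<Rightarrow> real"
  assumes "maximal_hyperbolic h U" "maximal_hyperbolic h' U'"
    and "psr_isomorphic (level h U) (level h' U')"
  obtains A where "invertible A" "\<And>x. h x = h' (A *v x)" "U = {x. A *v x \<in> U'}"
proof -
  interpret X: maximal_hyperbolic h U by fact
  interpret Y: maximal_hyperbolic h' U' by fact
  obtain A where A: "invertible A" "(\<lambda>x. A *v x) ` level h U = level h' U'"
    using assms(3) by (auto simp: psr_isomorphic_def)
  have fwd: "A *v x \<in> U' \<and> h x = h' (A *v x)" if x: "x \<in> U" for x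
  proof -
    define r where "r = h x powr (-1/3)"
    have r: "r > 0" using X.pos[OF x] by (simp add: r_def)
    have "r *\<^sub>R x \<in> level h U" using X.retract_in_level[OF x] by (simp add: X.retract_def r_def)
    then have "A *v (r *\<^sub>R x) \<in> level h' U'" "h (r *\<^sub>R x) = 1"
      using A(2) by (auto simp: level_def)
    then have 1: "r *\<^sub>R (A *v x) \<in> U'" "h' (r *\<^sub>R (A *v x)) = h (r *\<^sub>R x)"
      by (auto simp: level_def matrix_vector_mult_scaleR)
    have "(1 / r) *\<^sub>R (r *\<^sub>R (A *v x)) \<in> U'"
      by (rule Y.cone[OF 1(1)]) (use r in simp)
    then show ?thesis using r 1(2) by (simp add: X.scale Y.scale)
  qed
  have bwd: "x \<in> U" if x: "A *v x \<in> U'" for x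
  proof -
    define r where "r = h' (A *v x) powr (-1/3)"
    have r: "r > 0" using Y.pos[OF x] by (simp add: r_def)
    have "A *v (r *\<^sub>R x) \<in> level h' U'"
      using Y.retract_in_level[OF x] by (simp add: Y.retract_def matrix_vector_mult_scaleR r_def)
    then have "A *v (r *\<^sub>R x) \<in> (\<lambda>x. A *v x) ` level h U" by (simp only: A(2))
    then obtain y where "y \<in> level h U" "A *v (r *\<^sub>R x) = A *v y" by blast
    then have "r *\<^sub>R x \<in> U" using invertible_inj[OF A(1)] by (auto simp: level_def)
    then have "(1 / r) *\<^sub>R (r *\<^sub>R x) \<in> U" by (rule X.cone) (use r in simp)
    then show ?thesis using r by simp
  qed
  interpret diff: cubic "\<lambda>x. h x - h' (A *v x)"
    by unfold_locales
      (intro homogeneous_cubic_diff homogeneous_cubic_compose X.homogeneous Y.homogeneous)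
  have "h x - h' (A *v x) = 0" for x
    by (rule diff.vanishes_on_open[OF X.open_cone X.nonempty]) (simp add: fwd)
  then show ?thesis using that[OF A(1)] fwd bwd by fastforce
qed

section \<open>Gram determinants\<close>

definition gram :: "(real ^ 'n \<Rightarrow> real) \<Rightarrow> real ^ 'n \<Rightarrow> real ^ 'n ^ 'm \<Rightarrow> real ^ 'm ^ 'm" where
  "gram h x B = (\<chi> i j. polar h x (B $ i) (B $ j))"

lemma (in cubic) det_gram: "det (gram h x B) = (det B)\<^sup>2 * det (gram h x (mat 1))"
proof -
  have ax: "(mat 1 :: real ^ 'n ^ 'n) $ i = axis i 1" for i
    by (simp add: mat_def axis_def vec_eq_iff)
  have "gram h x B $ i $ j = (B ** gram h x (mat 1) ** transpose B) $ i $ j" for i j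
  proof -
    have "T x (B $ i) (B $ j) = (\<Sum>l\<in>UNIV. B $ j $ l * T x (B $ i) (axis l 1))"
      by (rule polar_components)
    also have "\<dots> = (\<Sum>l\<in>UNIV. B $ j $ l * T x (axis l 1) (B $ i))"
      by (simp only: polar_ac(2)[of h x "B $ i"])
    also have "\<dots> = (\<Sum>l\<in>UNIV. B $ j $ l * (\<Sum>k\<in>UNIV. B $ i $ k * T x (axis l 1) (axis k 1)))"
      by (simp only: polar_components[of x _ "B $ i"])
    also have "\<dots> = (\<Sum>l\<in>UNIV. (\<Sum>k\<in>UNIV. B $ i $ k * T x (axis k 1) (axis l 1)) * B $ j $ l)"
    proof (rule sum.cong[OF refl])
      fix l :: 'n
      have "(\<Sum>k\<in>UNIV. B $ i $ k * T x (axis l 1) (axis k 1))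
          = (\<Sum>k\<in>UNIV. B $ i $ k * T x (axis k 1) (axis l 1))"
        by (intro sum.cong refl arg_cong2[where f = "(*)"] polar_ac(2))
      then show "B $ j $ l * (\<Sum>k\<in>UNIV. B $ i $ k * T x (axis l 1) (axis k 1))
          = (\<Sum>k\<in>UNIV. B $ i $ k * T x (axis k 1) (axis l 1)) * B $ j $ l"
        by (simp only: mult.commute)
    qed
    finally show ?thesis
      by (simp add: gram_def matrix_matrix_mult_def transpose_def ax)
  qed
  then have "gram h x B = B ** gram h x (mat 1) ** transpose B" by (simp add: vec_eq_iff)
  then show ?thesis by (simp add: det_mul det_transpose power2_eq_square)
qed

text \<open>The polar form is one sixth of the Hessian, so this is the Hessian determinant divided
  by 6 to the power of the dimension.\<close>

abbreviation hess_det :: "(real ^ 'n \<Rightarrow> real) \<Rightarrow> real ^ 'n \<Rightarrow> real" where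
  "hess_det h x \<equiv> det (gram h x (mat 1))"

lemma hess_det_compose:
  fixes A :: "real ^ 'n ^ 'n"
  assumes "homogeneous_cubic h"
  shows "hess_det (\<lambda>x. h (A *v x)) x = (det A)\<^sup>2 * hess_det h (A *v x)"
proof -
  interpret cubic h by unfold_locales fact
  have ax: "(mat 1 :: real ^ 'n ^ 'n) $ i = axis i 1" for i
    by (simp add: mat_def axis_def vec_eq_iff)
  have "A *v axis i 1 = transpose A $ i" for i
    by (simp add: matrix_vector_mult_basis column_def transpose_def)
  then have "gram (\<lambda>x. h (A *v x)) x (mat 1) = gram h (A *v x) (transpose A)"
    by (simp only: gram_def polar_compose[of h A] ax)
  then show ?thesis using det_gram[of "A *v x" "transpose A"] by (simp only: det_transpose)
qed

lemma det_eq_0_relation: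
  fixes a b c :: "real ^ 3"
  assumes "det (vector [a, b, c] :: real ^ 3 ^ 3) = 0"
  obtains x y z where "x *\<^sub>R a + y *\<^sub>R b + z *\<^sub>R c = 0" "x \<noteq> 0 \<or> y \<noteq> 0 \<or> z \<noteq> 0"
proof -
  define B where "B = (vector [a, b, c] :: real ^ 3 ^ 3)"
  have "\<not> invertible (transpose B)" using assms by (simp add: invertible_det_nz det_transpose B_def)
  then obtain u where u: "transpose B *v u = 0" "u \<noteq> 0" unfolding invertible_kernel by blast
  have "transpose B *v u = (u $ 1) *\<^sub>R (B $ 1) + (u $ 2) *\<^sub>R (B $ 2) + (u $ 3) *\<^sub>R (B $ 3)"
    by (rule vec_eq_iff[THEN iffD2], rule allI) (simp add: matrix_vector_mult_def transpose_def sum_3)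
  then have "(u $ 1) *\<^sub>R a + (u $ 2) *\<^sub>R b + (u $ 3) *\<^sub>R c = 0"
    using u(1) unfolding B_def vector_3 by simp
  moreover have "u $ 1 \<noteq> 0 \<or> u $ 2 \<noteq> 0 \<or> u $ 3 \<noteq> 0"
    using u(2) by (simp add: vec_eq_iff forall_3)
  ultimately show ?thesis by (rule that)
qed

text \<open>A signature count: \<open>T x\<close> is positive on x, negative on the tangential part
  u of v, and has positive determinant, so its signature is (1, 2). Concretely,
  \<open>T x w w \<ge> 0\<close> would make the Gram determinant of x, w, u both nonpositive and
  nonnegative; the three vectors would be dependent, which forces w = 0.\<close>

lemma negative_on_tangent_plane:
  fixes h :: "real ^ 3 \<Rightarrow> real"
  assumes "homogeneous_cubic h" and x: "h x > 0" and D: "hess_det h x > 0" and v: "polar h x v v < 0"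
    and w: "polar h x x w = 0" "w \<noteq> 0"
  shows "polar h x w w < 0"
proof (rule ccontr)
  interpret cubic h by unfold_locales fact
  assume "\<not> ?thesis"
  then have ww: "T x w w \<ge> 0" by simp
  define u where "u = v - (T x x v / h x) *\<^sub>R x"
  have u: "T x x u = 0" "T x u u = T x v v - (T x x v)\<^sup>2 / h x"
    unfolding u_def using polar_retract_tangent[OF x] by auto
  have uu: "T x u u < 0" using v x u(2) by (simp add: add_neg_nonpos diff_less_eq less_le_trans)
  let ?B = "vector [x, w, u] :: real ^ 3 ^ 3"
  have sym: "T x w x = 0" "T x u x = 0" "T x u w = T x w u"
    using w u by (simp_all add: polar_ac)
  have "det (gram h x ?B) = h x * (T x w w * T x u u - (T x w u)\<^sup>2)"
    by (simp add: det_3 gram_def vector_3 w u sym diag power2_eq_square algebra_simps)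
  moreover have "det (gram h x ?B) = (det ?B)\<^sup>2 * hess_det h x" by (rule det_gram)
  ultimately have *: "h x * (T x w w * T x u u - (T x w u)\<^sup>2) = (det ?B)\<^sup>2 * hess_det h x" by simp
  have le: "T x w w * T x u u \<le> 0" using ww uu by (simp add: mult_nonneg_nonpos)
  have "(det ?B)\<^sup>2 * hess_det h x \<ge> 0" using D by simp
  then have "T x w w * T x u u - (T x w u)\<^sup>2 \<ge> 0"
    using * x by (metis zero_le_mult_iff not_le)
  then have z: "T x w w * T x u u = 0" "(T x w u)\<^sup>2 = 0"
    using le zero_le_power2[of "T x w u"] by linarith+
  have "T x w w * T x u u - (T x w u)\<^sup>2 = 0" by (simp only: z)
  then have "(det ?B)\<^sup>2 * hess_det h x = 0" using * by (simp only: mult_zero_right)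
  then have "det ?B = 0" using D by simp
  then obtain a b c where abc: "a *\<^sub>R x + b *\<^sub>R w + c *\<^sub>R u = 0" "a \<noteq> 0 \<or> b \<noteq> 0 \<or> c \<noteq> 0"
    using det_eq_0_relation by blast
  have "T x x (a *\<^sub>R x + b *\<^sub>R w + c *\<^sub>R u) = a * h x"
    by (simp add: expand w u diag)
  then have a: "a = 0" using abc(1) x by simp
  have "T x u (a *\<^sub>R x + b *\<^sub>R w + c *\<^sub>R u) = c * T x u u"
    using z by (simp add: expand sym)
  then have c: "c = 0" using abc(1) uu by simp
  show False using a c abc w by simp
qed

section \<open>Normal forms\<close>

text \<open>The base point is (1, 0, 0). The binomial factors 3 make a, b, c, d the values of the
  polar form on the last two axes.\<close>

definition std_form :: "real \<Rightarrow> real \<Rightarrow> real \<Rightarrow> real \<Rightarrow> real ^ 3 \<Rightarrow> real" where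
  "std_form a b c d v = v $ 1 ^ 3 - v $ 1 * ((v $ 2)\<^sup>2 + (v $ 3)\<^sup>2)
     + (a * v $ 2 ^ 3 + 3 * b * (v $ 2)\<^sup>2 * v $ 3 + 3 * c * v $ 2 * (v $ 3)\<^sup>2 + d * v $ 3 ^ 3)"

text \<open>These are the inequalities of \<open>cone_iff\<close> at p = (1, 0, 0), where
  \<open>T p q q\<close> is x^2 - (y^2 + z^2) / 3.\<close>

definition std_cone :: "real \<Rightarrow> real \<Rightarrow> real \<Rightarrow> real \<Rightarrow> (real ^ 3) set" where
  "std_cone a b c d = {v. v $ 1 > 0 \<and> (v $ 2)\<^sup>2 + (v $ 3)\<^sup>2 < 3 * (v $ 1)\<^sup>2 \<and> std_form a b c d v > 0}"

text \<open>A cubic with a node at (1, 0, 0) whose branch tangents are the lines where the second or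
  the third coordinate vanishes. It is a triangle, a conic with a secant, or irreducible, as none,
  one or both of \<alpha>, \<beta> are nonzero.\<close>

definition node_form :: "real \<Rightarrow> real \<Rightarrow> real ^ 3 \<Rightarrow> real" where
  "node_form \<alpha> \<beta> v = v $ 1 * v $ 2 * v $ 3 - \<alpha> * v $ 2 ^ 3 - \<beta> * v $ 3 ^ 3"

definition node_cone :: "real \<Rightarrow> real \<Rightarrow> (real ^ 3) set" where
  "node_cone \<alpha> \<beta> = {v. v $ 2 > 0 \<and> v $ 3 > 0 \<and> node_form \<alpha> \<beta> v > 0}"

text \<open>A conic together with its tangent line x = 0 at (0, 1, 0).\<close>

definition tangent_form :: "real ^ 3 \<Rightarrow> real" where
  "tangent_form v = v $ 1 * (v $ 1 * v $ 2 - (v $ 3)\<^sup>2)"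

definition tangent_cone :: "(real ^ 3) set" where
  "tangent_cone = {v. v $ 1 > 0 \<and> tangent_form v > 0}"

lemma homogeneous_std_form: "homogeneous_cubic (std_form a b c d)"
proof -
  have "std_form a b c d = (\<lambda>v. v $ 1 * v $ 1 * v $ 1 - v $ 1 * v $ 2 * v $ 2 - v $ 1 * v $ 3 * v $ 3
     + (a * (v $ 2 * v $ 2 * v $ 2) + (3 * b) * (v $ 2 * v $ 2 * v $ 3)
      + (3 * c) * (v $ 2 * v $ 3 * v $ 3) + d * (v $ 3 * v $ 3 * v $ 3)))"
    by (simp add: fun_eq_iff std_form_def power2_eq_square power3_eq_cube algebra_simps)
  from arg_cong[OF this, of homogeneous_cubic] show ?thesis
    by (rule iffD2) (intro homogeneous_cubic_add homogeneous_cubic_diff homogeneous_cubic_cmult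
        homogeneous_cubic_monomial)
qed

lemma homogeneous_node_form: "homogeneous_cubic (node_form \<alpha> \<beta>)"
proof -
  have "node_form \<alpha> \<beta> = (\<lambda>v. v $ 1 * v $ 2 * v $ 3 - \<alpha> * (v $ 2 * v $ 2 * v $ 2) - \<beta> * (v $ 3 * v $ 3 * v $ 3))"
    by (simp add: fun_eq_iff node_form_def power3_eq_cube)
  from arg_cong[OF this, of homogeneous_cubic] show ?thesis
    by (rule iffD2) (intro homogeneous_cubic_diff homogeneous_cubic_cmult homogeneous_cubic_monomial)
qed

lemma homogeneous_tangent_form: "homogeneous_cubic tangent_form"
proof -
  have "tangent_form = (\<lambda>v. v $ 1 * v $ 1 * v $ 2 - v $ 1 * v $ 3 * v $ 3)"
    by (simp add: fun_eq_iff tangent_form_def power2_eq_square algebra_simps)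
  from arg_cong[OF this, of homogeneous_cubic] show ?thesis
    by (rule iffD2) (intro homogeneous_cubic_diff homogeneous_cubic_monomial)
qed

lemma polar_times_6:
  "6 * polar h x y z = h (x + y + z) - h (x + y) - h (x + z) - h (y + z) + h x + h y + h z"
  by (simp add: polar_def)

lemma polar_std_form:
  "polar (std_form a b c d) x y z = (6 * (x $ 1 * y $ 1 * z $ 1)
     - 2 * (x $ 1 * (y $ 2 * z $ 2 + y $ 3 * z $ 3) + y $ 1 * (x $ 2 * z $ 2 + x $ 3 * z $ 3)
        + z $ 1 * (x $ 2 * y $ 2 + x $ 3 * y $ 3))
     + 6 * (a * x $ 2 * y $ 2 * z $ 2
       + b * (x $ 2 * y $ 2 * z $ 3 + x $ 2 * y $ 3 * z $ 2 + x $ 3 * y $ 2 * z $ 2)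
       + c * (x $ 2 * y $ 3 * z $ 3 + x $ 3 * y $ 2 * z $ 3 + x $ 3 * y $ 3 * z $ 2)
       + d * x $ 3 * y $ 3 * z $ 3)) / 6" (is "_ = ?r / 6")
proof -
  have "6 * polar (std_form a b c d) x y z = ?r"
    unfolding polar_times_6 std_form_def vector_add_component by algebra
  then show ?thesis by simp
qed

lemma polar_node_form:
  "polar (node_form \<alpha> \<beta>) x y z =
     (x $ 1 * (y $ 2 * z $ 3 + y $ 3 * z $ 2) + y $ 1 * (x $ 2 * z $ 3 + x $ 3 * z $ 2)
        + z $ 1 * (x $ 2 * y $ 3 + x $ 3 * y $ 2)
     - 6 * (\<alpha> * x $ 2 * y $ 2 * z $ 2 + \<beta> * x $ 3 * y $ 3 * z $ 3)) / 6" (is "_ = ?r / 6")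
proof -
  have "6 * polar (node_form \<alpha> \<beta>) x y z = ?r"
    unfolding polar_times_6 node_form_def vector_add_component by algebra
  then show ?thesis by simp
qed

lemma polar_tangent_form:
  "polar tangent_form x y z =
     2 * (x $ 1 * y $ 1 * z $ 2 + x $ 1 * y $ 2 * z $ 1 + x $ 2 * y $ 1 * z $ 1
      - x $ 1 * y $ 3 * z $ 3 - x $ 3 * y $ 1 * z $ 3 - x $ 3 * y $ 3 * z $ 1) / 6" (is "_ = ?r / 6")
proof -
  have "6 * polar tangent_form x y z = ?r"
    unfolding polar_times_6 tangent_form_def vector_add_component by algebra
  then show ?thesis by simp
qed

lemma hess_det_node_form:
  "108 * hess_det (node_form \<alpha> \<beta>) v = node_form \<alpha> \<beta> v + 4 * \<alpha> * v $ 2 ^ 3 + 4 * \<beta> * v $ 3 ^ 3"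
  by (simp add: det_3 gram_def polar_node_form mat_def node_form_def) algebra

lemma hess_det_tangent_form: "27 * hess_det tangent_form v = v $ 1 ^ 3"
  by (simp add: det_3 gram_def polar_tangent_form mat_def) algebra

text \<open>For a trace free cubic part, the excess of 27 D over 3 h is a multiple of x (y^2 + z^2),
  which vanishes in the cone only on the base ray. Both hyperbolicity and the unique minimum of D /
  h are read off from this.\<close>

lemma hess_det_std_form:
  "27 * hess_det (std_form a b (-a) (-b)) v = 3 * std_form a b (-a) (-b) v
     + (4 - 27 * (a\<^sup>2 + b\<^sup>2)) * (v $ 1 * ((v $ 2)\<^sup>2 + (v $ 3)\<^sup>2))"
  by (simp add: det_3 gram_def polar_std_form mat_def std_form_def)
    (simp add: field_simps, algebra)

section \<open>Hyperbolicity of the explicit models\<close>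

lemma continuous_on_vector_3:
  fixes f g k :: "'a::topological_space \<Rightarrow> real"
  assumes "continuous_on S f" "continuous_on S g" "continuous_on S k"
  shows "continuous_on S (\<lambda>x. vector [f x, g x, k x] :: real ^ 3)"
proof -
  have "(\<lambda>x. vector [f x, g x, k x] :: real ^ 3)
      = (\<lambda>x. \<chi> i. if i = 1 then f x else if i = 2 then g x else k x)"
    by (simp add: fun_eq_iff vec_eq_iff forall_3 vector_3)
  moreover have "continuous_on S (\<lambda>x. if i = 1 then f x else if i = 2 then g x else k x)" for i :: 3
    using assms by (cases "i = 1"; cases "i = 2") auto
  ultimately show ?thesis by (simp only:) (rule continuous_on_vec_lambda)
qed

text \<open>Hyperbolicity reduces to D > 0 and one negative direction at each point. C collects the
  inequalities of the cone other than h > 0, and maximality is tested on the closure of C.\<close>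

lemma maximal_hyperbolicI:
  fixes h :: "real ^ 3 \<Rightarrow> real"
  assumes hom: "homogeneous_cubic h"
    and U: "U = C \<inter> {v. h v > 0}" and C: "open C" and "connected U" "U \<noteq> {}"
    and cone: "\<And>v r. v \<in> C \<Longrightarrow> r > 0 \<Longrightarrow> r *\<^sub>R v \<in> C"
    and max: "\<And>v. v \<in> closure C \<Longrightarrow> h v > 0 \<Longrightarrow> v \<in> C"
    and D: "\<And>v. v \<in> U \<Longrightarrow> hess_det h v > 0"
    and n: "\<And>v. v \<in> U \<Longrightarrow> \<exists>w. polar h v w w < 0"
  shows "maximal_hyperbolic h U"
proof -
  interpret cubic h by unfold_locales fact
  show ?thesis
  proof
    have "open {v. h v > 0}" by (intro open_Collect_less continuous_intros continuous_on_form)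
    then show "open U" using C by (simp add: U open_Int)
    show "r *\<^sub>R x \<in> U" if "x \<in> U" "r > 0" for x r
      using that cone by (simp add: U scale)
    show "h x > 0" if "x \<in> U" for x using that by (simp add: U)
    show "T x v v < 0" if x: "x \<in> U" and v: "T x x v = 0" "v \<noteq> 0" for x v
    proof -
      obtain w where "T x w w < 0" using n[OF x] by blast
      then show ?thesis
        using negative_on_tangent_plane[OF hom _ D[OF x] _ v] x by (simp add: U)
    qed
    show "x \<in> U" if "x \<in> closure U" "h x > 0" for x
      using that max closure_mono[of U C] by (auto simp: U)
  qed fact+
qed

lemma vec3_eq_iff: "v = w \<longleftrightarrow> v $ 1 = w $ 1 \<and> v $ 2 = w $ 2 \<and> v $ 3 = w $ 3" for v w :: "'a ^ 3"
  by (simp add: vec_eq_iff forall_3)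

lemma convex_positive_coordinate: "convex {v :: real ^ 'n. v $ i > 0}"
  using convex_linear_vimage[OF linear_vec_nth convex_real_interval(3)[of 0], of i]
  by (simp add: vimage_def)

lemma maximal_hyperbolic_node:
  assumes ab: "\<alpha> \<ge> 0" "\<beta> \<ge> 0"
  shows "maximal_hyperbolic (node_form \<alpha> \<beta>) (node_cone \<alpha> \<beta>)"
proof (rule maximal_hyperbolicI[OF homogeneous_node_form, where C = "{v. v $ 2 > 0 \<and> v $ 3 > 0}"])
  show "node_cone \<alpha> \<beta> = {v. v $ 2 > 0 \<and> v $ 3 > 0} \<inter> {v. node_form \<alpha> \<beta> v > 0}"
    by (auto simp: node_cone_def)
  show "open {v :: real ^ 3. v $ 2 > 0 \<and> v $ 3 > 0}"
    by (intro open_Collect_conj open_Collect_less continuous_intros)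
  have p: "vector [1 + \<alpha> + \<beta>, 1, 1] \<in> node_cone \<alpha> \<beta>"
    by (simp add: node_cone_def node_form_def vector_3)
  then show "node_cone \<alpha> \<beta> \<noteq> {}" by blast
  \<comment> \<open>The equation for the form is solved for the first coordinate, so that the value
    of h and the last two coordinates map the cone onto an open octant.\<close>
  let ?f = "\<lambda>v :: real ^ 3. (vector [(v $ 1 + \<alpha> * v $ 2 ^ 3 + \<beta> * v $ 3 ^ 3) / (v $ 2 * v $ 3), v $ 2, v $ 3] :: real ^ 3)"
  let ?P = "{v :: real ^ 3. v $ 1 > 0 \<and> v $ 2 > 0 \<and> v $ 3 > 0}"
  have "convex ?P"
    by (intro convex_Int[of "{v. v $ 1 > 0}" "{v. v $ 2 > 0 \<and> v $ 3 > 0}", unfolded Int_def mem_Collect_eq]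
        convex_Int[of "{v. v $ 2 > 0}" "{v. v $ 3 > 0}", unfolded Int_def mem_Collect_eq]
        convex_positive_coordinate)
  have "?f ` ?P = node_cone \<alpha> \<beta>"
  proof (intro equalityI subsetI)
    fix v assume v: "v \<in> node_cone \<alpha> \<beta>"
    then have "v = ?f (vector [node_form \<alpha> \<beta> v, v $ 2, v $ 3])"
      by (simp add: vec3_eq_iff vector_3 node_cone_def node_form_def)
    moreover have "vector [node_form \<alpha> \<beta> v, v $ 2, v $ 3] \<in> ?P"
      using v by (simp add: vector_3 node_cone_def)
    ultimately show "v \<in> ?f ` ?P" by (rule image_eqI)
  next
    fix w assume "w \<in> ?f ` ?P"
    then show "w \<in> node_cone \<alpha> \<beta>" by (auto simp: vector_3 node_cone_def node_form_def)
  qed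
  moreover have "continuous_on ?P ?f"
    by (intro continuous_on_vector_3 continuous_intros) auto
  ultimately show "connected (node_cone \<alpha> \<beta>)"
    using connected_continuous_image[of ?P ?f] convex_connected[OF \<open>convex ?P\<close>] by simp
  show "r *\<^sub>R v \<in> {v. v $ 2 > 0 \<and> v $ 3 > 0}" if "v \<in> {v. v $ 2 > 0 \<and> v $ 3 > 0}" "r > 0"
    for v :: "real ^ 3" and r using that by simp
  show "v \<in> {v. v $ 2 > 0 \<and> v $ 3 > 0}"
    if v: "v \<in> closure {v. v $ 2 > 0 \<and> v $ 3 > 0}" and pos: "node_form \<alpha> \<beta> v > 0" for v :: "real ^ 3"
  proof -
    have "closure {v :: real ^ 3. v $ 2 > 0 \<and> v $ 3 > 0} \<subseteq> {v. v $ 2 \<ge> 0 \<and> v $ 3 \<ge> 0}"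
      by (intro closure_minimal closed_Collect_conj closed_Collect_le continuous_intros) auto
    then have ge: "v $ 2 \<ge> 0" "v $ 3 \<ge> 0" using v by auto
    have "v $ 2 \<noteq> 0"
    proof
      assume "v $ 2 = 0"
      then have "\<beta> * v $ 3 ^ 3 < 0" using pos by (simp add: node_form_def)
      then show False using ge ab by (simp add: mult_less_0_iff)
    qed
    moreover have "v $ 3 \<noteq> 0"
    proof
      assume "v $ 3 = 0"
      then have "\<alpha> * v $ 2 ^ 3 < 0" using pos by (simp add: node_form_def)
      then show False using ge ab by (simp add: mult_less_0_iff)
    qed
    ultimately show ?thesis using ge by simp
  qed
  fix v assume v: "v \<in> node_cone \<alpha> \<beta>"
  have "108 * hess_det (node_form \<alpha> \<beta>) v > 0"
    unfolding hess_det_node_form using v ab by (intro add_pos_nonneg) (auto simp: node_cone_def)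
  then show "hess_det (node_form \<alpha> \<beta>) v > 0" by simp
  have "v $ 1 * v $ 2 * v $ 3 > 0"
  proof -
    have "\<alpha> * v $ 2 ^ 3 \<ge> 0" "\<beta> * v $ 3 ^ 3 \<ge> 0" using v ab by (auto simp: node_cone_def)
    then show ?thesis using v by (simp add: node_cone_def node_form_def)
  qed
  then have "v $ 1 > 0" using v by (auto simp: node_cone_def zero_less_mult_iff)
  moreover have "\<alpha> * v $ 2 \<ge> 0" "\<beta> * v $ 3 \<ge> 0" using v ab by (auto simp: node_cone_def)
  ultimately have "polar (node_form \<alpha> \<beta>) v (vector [0, 1, -1]) (vector [0, 1, -1]) < 0"
    by (simp add: polar_node_form vector_3)
  then show "\<exists>w. polar (node_form \<alpha> \<beta>) v w w < 0" by blast
qed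

lemma maximal_hyperbolic_tangent: "maximal_hyperbolic tangent_form tangent_cone"
proof (rule maximal_hyperbolicI[OF homogeneous_tangent_form, where C = "{v. v $ 1 > 0}"])
  show "tangent_cone = {v. v $ 1 > 0} \<inter> {v. tangent_form v > 0}"
    by (auto simp: tangent_cone_def)
  show "open {v :: real ^ 3. v $ 1 > 0}"
    by (intro open_Collect_less continuous_intros)
  have "vector [1, 1, 0] \<in> tangent_cone"
    by (simp add: tangent_cone_def tangent_form_def vector_3)
  then show "tangent_cone \<noteq> {}" by blast
  \<comment> \<open>As for the node, but the form is solved for the second coordinate.\<close>
  let ?f = "\<lambda>v :: real ^ 3. (vector [v $ 1, (v $ 2 / v $ 1 + (v $ 3)\<^sup>2) / v $ 1, v $ 3] :: real ^ 3)"
  let ?P = "{v :: real ^ 3. v $ 1 > 0 \<and> v $ 2 > 0}"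
  have "convex ?P"
    by (intro convex_Int[of "{v. v $ 1 > 0}" "{v. v $ 2 > 0}", unfolded Int_def mem_Collect_eq]
        convex_positive_coordinate)
  have "?f ` ?P = tangent_cone"
  proof (intro equalityI subsetI)
    fix v assume v: "v \<in> tangent_cone"
    then have "v = ?f (vector [v $ 1, tangent_form v, v $ 3])"
      by (simp add: vec3_eq_iff vector_3 tangent_cone_def tangent_form_def)
    moreover have "vector [v $ 1, tangent_form v, v $ 3] \<in> ?P"
      using v by (simp add: vector_3 tangent_cone_def)
    ultimately show "v \<in> ?f ` ?P" by (rule image_eqI)
  next
    fix w assume "w \<in> ?f ` ?P"
    then show "w \<in> tangent_cone" by (auto simp: vector_3 tangent_cone_def tangent_form_def)
  qed
  moreover have "continuous_on ?P ?f"
    by (intro continuous_on_vector_3 continuous_intros) auto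
  ultimately show "connected tangent_cone"
    using connected_continuous_image[of ?P ?f] convex_connected[OF \<open>convex ?P\<close>] by simp
  show "r *\<^sub>R v \<in> {v. v $ 1 > 0}" if "v \<in> {v. v $ 1 > 0}" "r > 0"
    for v :: "real ^ 3" and r using that by simp
  show "v \<in> {v. v $ 1 > 0}"
    if v: "v \<in> closure {v. v $ 1 > 0}" and pos: "tangent_form v > 0" for v :: "real ^ 3"
  proof -
    have "closure {v :: real ^ 3. v $ 1 > 0} \<subseteq> {v. v $ 1 \<ge> 0}"
      by (intro closure_minimal closed_Collect_le continuous_intros) auto
    then show ?thesis using v pos by (force simp: tangent_form_def less_le)
  qed
  fix v assume v: "v \<in> tangent_cone"
  have "27 * hess_det tangent_form v > 0"
    unfolding hess_det_tangent_form using v by (simp add: tangent_cone_def)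
  then show "hess_det tangent_form v > 0" by simp
  have "polar tangent_form v (axis 3 1) (axis 3 1) < 0"
    using v by (simp add: polar_tangent_form tangent_cone_def axis_def)
  then show "\<exists>w. polar tangent_form v w w < 0" by blast
qed

lemma closed_std_cone:
  "closed {v :: real ^ 3. v $ 1 \<ge> 0 \<and> (v $ 2)\<^sup>2 + (v $ 3)\<^sup>2 \<le> 3 * (v $ 1)\<^sup>2}"
  by (intro closed_Collect_conj closed_Collect_le continuous_intros)

text \<open>The cubic part is the real part of (a - i b) (y + i z)^3; adding the square of the
  imaginary part gives (a^2 + b^2) (y^2 + z^2)^3.\<close>

lemma trace_free_bound:
  fixes y z :: real
  assumes "27 * (a\<^sup>2 + b\<^sup>2) \<le> 4"
  shows "27 * (a * y ^ 3 + 3 * b * y\<^sup>2 * z + 3 * (-a) * y * z\<^sup>2 + (-b) * z ^ 3)\<^sup>2 \<le> 4 * (y\<^sup>2 + z\<^sup>2) ^ 3"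
proof -
  have "27 * (a * y ^ 3 + 3 * b * y\<^sup>2 * z + 3 * (-a) * y * z\<^sup>2 + (-b) * z ^ 3)\<^sup>2
      \<le> 27 * ((a * y ^ 3 + 3 * b * y\<^sup>2 * z + 3 * (-a) * y * z\<^sup>2 + (-b) * z ^ 3)\<^sup>2
        + (b * y ^ 3 - 3 * a * y\<^sup>2 * z - 3 * b * y * z\<^sup>2 + a * z ^ 3)\<^sup>2)"
    by simp
  also have "\<dots> = 27 * (a\<^sup>2 + b\<^sup>2) * (y\<^sup>2 + z\<^sup>2) ^ 3" by algebra
  also have "\<dots> \<le> 4 * (y\<^sup>2 + z\<^sup>2) ^ 3"
    using assms by (intro mult_right_mono) auto
  finally show ?thesis .
qed

text \<open>The cone is star-shaped about the base point by \<open>cubic_ray_mono\<close>, its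
  closure adds no point with h > 0 by \<open>cubic_ray_end\<close>, and the determinant is positive
  by \<open>hess_det_std_form\<close>.\<close>

lemma maximal_hyperbolic_trace_free:
  assumes c: "27 * (a\<^sup>2 + b\<^sup>2) \<le> 4"
  shows "maximal_hyperbolic (std_form a b (-a) (-b)) (std_cone a b (-a) (-b))"
proof (rule maximal_hyperbolicI[OF homogeneous_std_form,
      where C = "{v. v $ 1 > 0 \<and> (v $ 2)\<^sup>2 + (v $ 3)\<^sup>2 < 3 * (v $ 1)\<^sup>2}"])
  let ?h = "std_form a b (-a) (-b)" and ?U = "std_cone a b (-a) (-b)"
  let ?C = "{v :: real ^ 3. v $ 1 > 0 \<and> (v $ 2)\<^sup>2 + (v $ 3)\<^sup>2 < 3 * (v $ 1)\<^sup>2}"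
  let ?P = "\<lambda>v :: real ^ 3. a * v $ 2 ^ 3 + 3 * b * (v $ 2)\<^sup>2 * v $ 3 + 3 * (-a) * v $ 2 * (v $ 3)\<^sup>2 + (-b) * v $ 3 ^ 3"
  show "?U = ?C \<inter> {v. ?h v > 0}" by (auto simp: std_cone_def)
  show "open ?C"
    by (intro open_Collect_conj open_Collect_less continuous_intros)
  have e: "axis 1 1 \<in> ?U" by (simp add: std_cone_def std_form_def axis_def)
  then show "?U \<noteq> {}" by blast
  have seg: "closed_segment (axis 1 1) v \<subseteq> ?U" if v: "v \<in> ?U" for v
  proof
    fix w assume "w \<in> closed_segment (axis 1 1) v"
    then obtain t where t: "0 \<le> t" "t \<le> 1" and w: "w = (1 - t) *\<^sub>R axis 1 1 + t *\<^sub>R v"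
      by (auto simp: closed_segment_def)
    define l where "l = 1 - t + t * v $ 1"
    have v': "v $ 1 > 0" "(v $ 2)\<^sup>2 + (v $ 3)\<^sup>2 < 3 * (v $ 1)\<^sup>2" "?h v > 0"
      using v by (auto simp: std_cone_def)
    have ws: "w $ 1 = l" "w $ 2 = t * v $ 2" "w $ 3 = t * v $ 3"
      by (simp_all add: w l_def axis_def)
    have l: "l > 0"
    proof (cases "t = 1")
      case False
      then show ?thesis using t v' by (simp add: l_def add_pos_nonneg)
    qed (use v' in \<open>simp add: l_def\<close>)
    \<comment> \<open>Up to the factor k below, the point w of the segment is v with its last two
      coordinates multiplied by s, so the ray estimate at fixed first coordinate applies.\<close>
    define s where "s = t * v $ 1 / l"
    have s: "0 \<le> s" "s \<le> 1" using t v' l by (auto simp: s_def l_def field_simps)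
    have ls: "t * v $ 1 = l * s" using l by (simp add: s_def)
    define k where "k = l / v $ 1"
    have k: "k > 0" using l v' by (simp add: k_def)
    have lk: "l = k * v $ 1" "t = k * s"
      using v' ls l by (simp_all add: k_def s_def)
    have "s\<^sup>2 \<le> 1" using s by (simp add: power_le_one)
    then have "s\<^sup>2 * ((v $ 2)\<^sup>2 + (v $ 3)\<^sup>2) \<le> 1 * ((v $ 2)\<^sup>2 + (v $ 3)\<^sup>2)"
      by (intro mult_right_mono) auto
    then have "k\<^sup>2 * (s\<^sup>2 * ((v $ 2)\<^sup>2 + (v $ 3)\<^sup>2)) < k\<^sup>2 * (3 * (v $ 1)\<^sup>2)"
      using v'(2) k by (intro mult_strict_left_mono) auto
    then have 1: "(w $ 2)\<^sup>2 + (w $ 3)\<^sup>2 < 3 * (w $ 1)\<^sup>2"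
      unfolding ws lk by (simp add: power_mult_distrib algebra_simps)
    have "v $ 1 ^ 3 - v $ 1 * ((v $ 2)\<^sup>2 + (v $ 3)\<^sup>2) + ?P v
        \<le> v $ 1 ^ 3 - s\<^sup>2 * (v $ 1 * ((v $ 2)\<^sup>2 + (v $ 3)\<^sup>2)) + s ^ 3 * ?P v"
      by (rule cubic_ray_mono[OF trace_free_bound[OF c]]) (use v' s in auto)
    then have "0 < k ^ 3 * (v $ 1 ^ 3 - s\<^sup>2 * (v $ 1 * ((v $ 2)\<^sup>2 + (v $ 3)\<^sup>2)) + s ^ 3 * ?P v)"
      using v'(3) k by (simp add: std_form_def)
    also have "\<dots> = ?h w"
      unfolding std_form_def ws lk by algebra
    finally show "w \<in> ?U" using 1 l ws by (simp add: std_cone_def)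
  qed
  then have "starlike ?U" using e unfolding starlike_def by blast
  then show "connected ?U" by (rule starlike_imp_connected)
  show "r *\<^sub>R v \<in> ?C" if "v \<in> ?C" "r > 0" for v r
    using that by (simp add: power_mult_distrib flip: distrib_left)
  show "v \<in> ?C" if v: "v \<in> closure ?C" and pos: "?h v > 0" for v
  proof -
    have "closure ?C \<subseteq> {v. v $ 1 \<ge> 0 \<and> (v $ 2)\<^sup>2 + (v $ 3)\<^sup>2 \<le> 3 * (v $ 1)\<^sup>2}"
      by (intro closure_minimal closed_std_cone) auto
    then have ge: "v $ 1 \<ge> 0" "(v $ 2)\<^sup>2 + (v $ 3)\<^sup>2 \<le> 3 * (v $ 1)\<^sup>2" using v by auto
    have "(v $ 2)\<^sup>2 + (v $ 3)\<^sup>2 \<noteq> 3 * (v $ 1)\<^sup>2"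
    proof
      assume "(v $ 2)\<^sup>2 + (v $ 3)\<^sup>2 = 3 * (v $ 1)\<^sup>2"
      from cubic_ray_end[OF trace_free_bound[OF c] this ge(1)] show False
        using pos by (simp add: std_form_def)
    qed
    then have lt: "(v $ 2)\<^sup>2 + (v $ 3)\<^sup>2 < 3 * (v $ 1)\<^sup>2" using ge by simp
    moreover have "v $ 1 \<noteq> 0"
    proof
      assume "v $ 1 = 0"
      then have "(v $ 2)\<^sup>2 + (v $ 3)\<^sup>2 < 0" using lt by simp
      then show False using sum_power2_ge_zero[of "v $ 2" "v $ 3"] by simp
    qed
    ultimately show ?thesis using ge by simp
  qed
  fix v assume v: "v \<in> ?U"
  have "27 * hess_det ?h v > 0"
    unfolding hess_det_std_form using v c
    by (intro add_pos_nonneg mult_nonneg_nonneg) (auto simp: std_cone_def)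
  then show "hess_det ?h v > 0" by simp
  \<comment> \<open>The cubic part is harmonic and drops out of the sum, leaving -2/3 of the first
    coordinate of v.\<close>
  have "polar ?h v (axis 2 1) (axis 2 1) + polar ?h v (axis 3 1) (axis 3 1) < 0"
    using v by (simp add: axis_def polar_std_form std_cone_def flip: add_divide_distrib)
  then show "\<exists>w. polar ?h v w w < 0" by (metis add_nonneg_nonneg not_less)
qed

section \<open>Adapted coordinates\<close>

lemma combination_3:
  fixes a b c u :: "real ^ 3"
  shows "transpose (vector [a, b, c]) *v u = (u $ 1) *\<^sub>R a + (u $ 2) *\<^sub>R b + (u $ 3) *\<^sub>R c"
proof -
  have "transpose B *v u = (u $ 1) *\<^sub>R (B $ 1) + (u $ 2) *\<^sub>R (B $ 2) + (u $ 3) *\<^sub>R (B $ 3)"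
    for B :: "real ^ 3 ^ 3"
    by (rule vec_eq_iff[THEN iffD2], rule allI) (simp add: matrix_vector_mult_def transpose_def sum_3)
  from this[of "vector [a, b, c]"] show ?thesis by (simp only: vector_3)
qed

text \<open>Since a component is determined by any of its points, the cones need not be compared:
  one matching point is enough.\<close>

lemma psr_isomorphic_by_matrix:
  fixes A :: "real ^ 'n ^ 'n"
  assumes hU: "maximal_hyperbolic h U" and hU': "maximal_hyperbolic h' U'" and A: "invertible A"
    and eq: "\<And>x. h (A *v x) = h' x" and x: "x \<in> U'" "A *v x \<in> U"
  shows "psr_isomorphic (level h U) (level h' U')"
proof -
  have "(\<lambda>x. h (A *v x)) = h'" using eq by blast
  then have 1: "maximal_hyperbolic h' {x. A *v x \<in> U}"
    using maximal_hyperbolic_compose[OF hU A] by simp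
  have "{x. A *v x \<in> U} = U'"
    by (rule maximal_hyperbolic_unique[OF 1 hU']) (use x in blast)
  then have "psr_isomorphic (level h' U') (level h U)"
    using psr_isomorphic_compose[OF A, of h U] \<open>(\<lambda>x. h (A *v x)) = h'\<close> by simp
  then show ?thesis by (rule psr_isomorphic_sym)
qed

lemma common_kernel:
  fixes f g :: "real ^ 3 \<Rightarrow> real"
  assumes "linear f" "linear g"
  obtains w where "w \<noteq> 0" "f w = 0" "g w = 0"
proof -
  have *: "l w = (\<chi> i. l (axis i 1)) \<bullet> w" if "linear l" for l :: "real ^ 3 \<Rightarrow> real" and w
  proof -
    have "l w = l (\<Sum>i\<in>UNIV. (w $ i) *\<^sub>R axis i 1)"
      using basis_expansion[of w] by (simp add: scalar_mult_eq_scaleR)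
    also have "\<dots> = (\<Sum>i\<in>UNIV. (w $ i) *\<^sub>R l (axis i 1))"
      using that by (simp add: linear_sum linear_scale)
    finally show ?thesis by (simp add: inner_vec_def mult.commute)
  qed
  define B where "B = (vector [\<chi> i. f (axis i 1), \<chi> i. g (axis i 1), 0] :: real ^ 3 ^ 3)"
  have "row 3 B = 0" by (simp add: B_def row_def vector_3 vec_eq_iff)
  then have "det B = 0" by (rule det_zero_row)
  then have "\<not> invertible B" by (simp add: invertible_det_nz)
  then obtain w where w: "B *v w = 0" "w \<noteq> 0" unfolding invertible_kernel by blast
  have "(B *v w) $ 1 = B $ 1 \<bullet> w" "(B *v w) $ 2 = B $ 2 \<bullet> w"
    by (simp_all add: matrix_vector_mult_def inner_vec_def)
  then have "f w = 0" "g w = 0"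
    using w(1) *[OF assms(1), of w] *[OF assms(2), of w] by (simp_all add: B_def vector_3)
  then show ?thesis using that w(2) by blast
qed

lemma (in cubic) linear_polar: "linear (\<lambda>w. T u v w)"
  by (rule linearI) (simp_all add: expand)

lemma (in hyperbolic) normalised_tangent:
  assumes p: "p \<in> U" and w: "T p p w = 0" "w \<noteq> 0"
  obtains r where "r > 0" "- 3 * T p (r *\<^sub>R w) (r *\<^sub>R w) = 1"
proof -
  have m: "T p w w < 0" using neg[OF p w] .
  define r where "r = 1 / sqrt (- 3 * T p w w)"
  have "r\<^sup>2 = 1 / (- 3 * T p w w)" using m by (simp add: r_def power_divide)
  then have "- 3 * T p (r *\<^sub>R w) (r *\<^sub>R w) = 1"
    using m by (simp add: expand power2_eq_square field_simps)
  moreover have "r > 0" using m by (simp add: r_def)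
  ultimately show ?thesis using that by blast
qed

text \<open>The basis consists of p and a basis v, w of the tangent plane that is orthonormal for
  \<open>- 3 * T p\<close>. This fixes all terms containing the first coordinate and leaves the
  cubic part in the other two arbitrary.\<close>

lemma std_coordinates:
  fixes h :: "real ^ 3 \<Rightarrow> real"
  assumes "hyperbolic h U" and p: "p \<in> U" "h p = 1" and v: "polar h p p v = 0" "- 3 * polar h p v v = 1"
  obtains A a b c d where "invertible A" "A *v axis 1 1 = p" "A *v axis 2 1 = v"
    "(\<lambda>x. h (A *v x)) = std_form a b c d"
proof -
  interpret hyperbolic h U by fact
  obtain w0 where w0: "w0 \<noteq> 0" "T p p w0 = 0" "T p v w0 = 0"
    using common_kernel[OF linear_polar[of p p] linear_polar[of p v]] by blast
  obtain r where r: "r > 0" "- 3 * T p (r *\<^sub>R w0) (r *\<^sub>R w0) = 1"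
    using normalised_tangent[OF p(1) w0(2,1)] by blast
  define w where "w = r *\<^sub>R w0"
  have w: "T p p w = 0" "T p v w = 0" "- 3 * T p w w = 1"
    using w0 r by (simp_all add: w_def expand)
  define A where "A = (transpose (vector [p, v, w]) :: real ^ 3 ^ 3)"
  have A: "A *v x = (x $ 1) *\<^sub>R p + (x $ 2) *\<^sub>R v + (x $ 3) *\<^sub>R w" for x
    unfolding A_def by (rule combination_3)
  have sym: "T p v p = 0" "T p w p = 0" "T v p p = 0" "T w p p = 0" "T p w v = 0"
    "T v p v = T p v v" "T v v p = T p v v" "T w p w = T p w w" "T w w p = T p w w"
    "T v p w = 0" "T v w p = 0" "T w p v = 0" "T w v p = 0"
    "T v w v = T v v w" "T w v v = T v v w" "T w v w = T v w w" "T w w v = T v w w"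
    using w v by (simp_all add: polar_ac)
  have Tv: "T p v v = -1/3" "T p w w = -1/3" using v w by simp_all
  have "invertible A"
    unfolding invertible_kernel
  proof (intro allI impI)
    fix x assume x: "A *v x = 0"
    have "T p p (A *v x) = x $ 1" "T p v (A *v x) = x $ 2 * T p v v" "T p w (A *v x) = x $ 3 * T p w w"
      unfolding A by (simp_all add: expand diag p w v sym)
    then show "x = 0" using x Tv by (simp add: vec3_eq_iff)
  qed
  moreover have "A *v axis 1 1 = p" "A *v axis 2 1 = v"
    by (simp_all add: A axis_def)
  moreover have "h (A *v x) = std_form (h v) (T v v w) (T v w w) (h w) x" for x
  proof -
    have "h (A *v x) = T (A *v x) (A *v x) (A *v x)" by (simp only: diag)
    also have "\<dots> = std_form (h v) (T v v w) (T v w w) (h w) x"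
      unfolding A expand unfolding sym w v diag p Tv std_form_def by algebra
    finally show ?thesis .
  qed
  ultimately show ?thesis using that by blast
qed

lemma exists_unit_tangent:
  fixes h :: "real ^ 3 \<Rightarrow> real"
  assumes "hyperbolic h U" and p: "p \<in> U"
  obtains v where "polar h p p v = 0" "- 3 * polar h p v v = 1"
proof -
  interpret hyperbolic h U by fact
  obtain w where w: "w \<noteq> 0" "T p p w = 0"
    using common_kernel[OF linear_polar[of p p] linear_polar[of p p]] by blast
  obtain r where r: "r > 0" "- 3 * T p (r *\<^sub>R w) (r *\<^sub>R w) = 1"
    using normalised_tangent[OF p w(2,1)] by blast
  show ?thesis by (rule that[of "r *\<^sub>R w"]) (use w r in \<open>simp_all add: expand\<close>)
qed

lemma std_form_axis: "std_form a b c d (axis 1 1) = 1"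
  by (simp add: std_form_def axis_def)

lemma std_cone_eq:
  assumes "maximal_hyperbolic (std_form a b c d) U" "axis 1 1 \<in> U"
  shows "U = std_cone a b c d"
proof -
  interpret maximal_hyperbolic "std_form a b c d" U by fact
  have "q \<in> U \<longleftrightarrow> q \<in> std_cone a b c d" for q
    unfolding cone_iff[OF assms(2) std_form_axis]
    by (auto simp: std_cone_def polar_std_form axis_def power2_eq_square)
  then show ?thesis by blast
qed

lemma std_bound:
  assumes "maximal_hyperbolic (std_form a b c d) U" "axis 1 1 \<in> U"
  shows "27 * (a * y ^ 3 + 3 * b * y\<^sup>2 * z + 3 * c * y * z\<^sup>2 + d * z ^ 3)\<^sup>2 \<le> 4 * (y\<^sup>2 + z\<^sup>2) ^ 3"
proof -
  interpret maximal_hyperbolic "std_form a b c d" U by fact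
  have "T (axis 1 1) (axis 1 1) (vector [0, y, z]) = 0"
    by (simp add: polar_std_form axis_def vector_3)
  note bound = cubic_bound[OF assms(2) std_form_axis this]
  have "- 3 * T (axis 1 1) (vector [0, y, z]) (vector [0, y, z]) = y\<^sup>2 + z\<^sup>2"
    by (simp add: polar_std_form axis_def vector_3 power2_eq_square)
  moreover have "std_form a b c d (vector [0, y, z])
      = a * y ^ 3 + 3 * b * y\<^sup>2 * z + 3 * c * y * z\<^sup>2 + d * z ^ 3"
    by (simp add: std_form_def vector_3)
  ultimately show ?thesis using bound by (simp only:)
qed

lemma hess_det_scale:
  fixes h :: "real ^ 3 \<Rightarrow> real"
  assumes "homogeneous_cubic h"
  shows "hess_det h (r *\<^sub>R x) = r ^ 3 * hess_det h x"
proof -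
  interpret cubic h by unfold_locales fact
  show ?thesis by (simp add: det_3 gram_def scale1) algebra
qed

lemma continuous_on_hess_det:
  fixes h :: "real ^ 3 \<Rightarrow> real"
  assumes "homogeneous_cubic h"
  shows "continuous_on S (\<lambda>x. hess_det h x)"
proof -
  interpret cubic h by unfold_locales fact
  show ?thesis by (simp add: det_3 gram_def) (intro continuous_intros continuous_on_polar)
qed

lemma hess_det_std_axis: "9 * hess_det (std_form a b c d) (axis 1 1) = 1"
  by (simp add: det_3 gram_def polar_std_form mat_def axis_def)

lemma hess_det_pos:
  fixes h :: "real ^ 3 \<Rightarrow> real"
  assumes "hyperbolic h U" and x: "x \<in> U"
  shows "hess_det h x > 0"
proof -
  interpret hyperbolic h U by fact
  define r where "r = h x powr (-1/3)"
  have r: "r > 0" using pos[OF x] by (simp add: r_def)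
  have p: "r *\<^sub>R x \<in> U" "h (r *\<^sub>R x) = 1"
    using retract_in_level[OF x] by (simp_all add: level_def retract_def r_def)
  obtain v where v: "T (r *\<^sub>R x) (r *\<^sub>R x) v = 0" "- 3 * T (r *\<^sub>R x) v v = 1"
    using exists_unit_tangent[OF assms(1) p(1)] by blast
  obtain A a b c d where A: "invertible A" "A *v axis 1 1 = r *\<^sub>R x"
    "(\<lambda>x. h (A *v x)) = std_form a b c d"
    using std_coordinates[OF assms(1) p v] by metis
  have "(det A)\<^sup>2 * hess_det h (r *\<^sub>R x) = hess_det (std_form a b c d) (axis 1 1)"
    using hess_det_compose[OF homogeneous, of A "axis 1 1"] A by simp
  then have "(det A)\<^sup>2 * (r ^ 3 * hess_det h x) > 0"
    using hess_det_std_axis[of a b c d] by (simp add: hess_det_scale[OF homogeneous])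
  then show ?thesis using r by (auto simp: zero_less_mult_iff)
qed

section \<open>Singular boundary points\<close>

text \<open>The bound is attained at s = 0, since 27 (2 r / 9)^2 = 4, so the difference of its sides
  has a minimum there. The first derivative gives b and the second order term the inequality for c;
  if that term vanishes as well, the third order term gives d.\<close>

lemma touching_constraints:
  fixes r :: real
  assumes r: "r > 0" "r\<^sup>2 = 3"
    and bound: "\<And>s. 27 * (2 * r / 9 + 3 * b * s + 3 * c * s\<^sup>2 + d * s ^ 3)\<^sup>2 \<le> 4 * (1 + s\<^sup>2) ^ 3"
  shows "b = 0" "r * c \<le> 1 / 3" "r * c = 1 / 3 \<Longrightarrow> d = 0"
proof -
  define \<phi> where "\<phi> s = 4 * (1 + s\<^sup>2) ^ 3 - 27 * (2 * r / 9 + 3 * b * s + 3 * c * s\<^sup>2 + d * s ^ 3)\<^sup>2" for s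
  have \<phi>0: "\<phi> 0 = 0" using r by (simp add: \<phi>_def power_divide power_mult_distrib)
  have "(\<phi> has_real_derivative (- 36 * r * b)) (at 0)"
    unfolding \<phi>_def by (rule derivative_eq_intros refl | simp)+
  then have "- 36 * r * b = 0"
    by (rule DERIV_local_min[of _ _ _ 1]) (use bound \<phi>0 in \<open>auto simp: \<phi>_def\<close>)
  then show b: "b = 0" using r by simp
  \<comment> \<open>This is \<phi>(s) / s^2 with the singularity at 0 removed.\<close>
  define \<psi> where "\<psi> s = 4 * (3 + 3 * s\<^sup>2 + s ^ 4)
    - 27 * (4 / 3 * r * c + 4 / 9 * r * d * s + 9 * c\<^sup>2 * s\<^sup>2 + 6 * c * d * s ^ 3 + d\<^sup>2 * s ^ 4)" for s
  have \<phi>\<psi>: "\<phi> s = s\<^sup>2 * \<psi> s" for s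
  proof -
    have "9 * \<phi> s = 9 * (s\<^sup>2 * \<psi> s) + 12 * (3 - r\<^sup>2)"
      unfolding \<phi>_def \<psi>_def b by (simp add: field_simps) algebra
    then show ?thesis using r by simp
  qed
  have \<psi>: "\<psi> s \<ge> 0" if "s \<noteq> 0" for s
  proof -
    have "s\<^sup>2 * \<psi> s \<ge> 0" using bound[of s] \<phi>\<psi>[of s] by (simp add: \<phi>_def)
    then show ?thesis using that by (simp add: zero_le_mult_iff)
  qed
  have "isCont \<psi> 0" unfolding \<psi>_def by (intro continuous_intros)
  then have "(\<psi> \<longlongrightarrow> \<psi> 0) (at 0)" by (simp add: isCont_def)
  then have \<psi>0: "\<psi> 0 \<ge> 0"
    by (rule tendsto_lowerbound) (use \<psi> in \<open>auto simp: eventually_at_filter\<close>)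
  then show rc: "r * c \<le> 1 / 3" by (simp add: \<psi>_def algebra_simps)
  assume eq: "r * c = 1 / 3"
  have "(\<psi> has_real_derivative (- 12 * r * d)) (at 0)"
    unfolding \<psi>_def by (rule derivative_eq_intros refl | simp)+
  moreover have "\<psi> 0 = 0" using eq by (simp add: \<psi>_def algebra_simps)
  ultimately have "- 12 * r * d = 0"
    by (intro DERIV_local_min[of \<psi> _ _ 1]) (use \<psi> \<psi>0 in \<open>auto, metis\<close>)
  then show "d = 0" using r by simp
qed

text \<open>X, Y, Z are coordinates in which the singular boundary point (1, r, 0) has Y = Z = 0 and
  the base point has X = Y = 1, Z = 0. The form is linear in X, and Y^2 - K Z^2 is the tangent cone:
  K > 0 is a node with real branches, K = 0 the degenerate case.\<close>

lemma std_form_touching: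
  fixes r :: real
  assumes r: "r > 0" "r\<^sup>2 = 3" and K: "r * c = 1 / 3 - K"
    and v: "v $ 1 = (X + 2 * Y) / 3" "v $ 2 = r * (X - Y) / 3" "v $ 3 = Z"
  shows "std_form (2 * r / 9) 0 c d v = X * (Y\<^sup>2 - K * Z\<^sup>2) - (1 - K) * Y * Z\<^sup>2 + d * Z ^ 3"
proof -
  define y where "y = r * (X - Y) / 3"
  have ry: "r * y = X - Y" using r(2) by (simp add: y_def power2_eq_square flip: mult.assoc)
  have y2: "y\<^sup>2 = (X - Y)\<^sup>2 / 3" using r(2) by (simp add: y_def power_mult_distrib power_divide)
  have y3: "2 * r / 9 * y ^ 3 = 2 / 9 * (r * y) * y\<^sup>2" by (simp add: power2_eq_square power3_eq_cube)
  have cy: "3 * c * y * Z\<^sup>2 = 3 * ((r * c) * (r * y) / 3) * Z\<^sup>2"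
    using r(2) by (simp add: power2_eq_square)
  have "std_form (2 * r / 9) 0 c d v = ((X + 2 * Y) / 3) ^ 3 - (X + 2 * Y) / 3 * (y\<^sup>2 + Z\<^sup>2)
      + (2 * r / 9 * y ^ 3 + 3 * c * y * Z\<^sup>2 + d * Z ^ 3)"
    by (simp add: std_form_def v y_def[symmetric])
  also have "\<dots> = ((X + 2 * Y) / 3) ^ 3 - (X + 2 * Y) / 3 * ((X - Y)\<^sup>2 / 3 + Z\<^sup>2)
      + (2 / 9 * (X - Y) * ((X - Y)\<^sup>2 / 3) + 3 * ((1 / 3 - K) * (X - Y) / 3) * Z\<^sup>2 + d * Z ^ 3)"
    by (simp only: y3 cy ry y2 K)
  also have "\<dots> = X * (Y\<^sup>2 - K * Z\<^sup>2) - (1 - K) * Y * Z\<^sup>2 + d * Z ^ 3"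
    by (simp add: power2_eq_square power3_eq_cube field_simps)
  finally show ?thesis .
qed

text \<open>For K = 0 and d = 0 the touching form is Y (X Y - Z^2), so the matrix takes Y, X, Z as
  coordinates.\<close>

lemma touching_tangent_normal_form:
  fixes r :: real
  assumes r: "r > 0" "r\<^sup>2 = 3" and c: "r * c = 1 / 3"
    and h: "maximal_hyperbolic (std_form (2 * r / 9) 0 c 0) U" "axis 1 1 \<in> U"
  shows "psr_isomorphic (level (std_form (2 * r / 9) 0 c 0) U) (level tangent_form tangent_cone)"
proof -
  define A where "A = (transpose (vector [vector [2 / 3, - r / 3, 0], vector [1 / 3, r / 3, 0], vector [0, 0, 1]]) :: real ^ 3 ^ 3)"
  have A: "(A *v x) $ 1 = (2 * x $ 1 + x $ 2) / 3" "(A *v x) $ 2 = (x $ 2 - x $ 1) * r / 3"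
    "(A *v x) $ 3 = x $ 3" for x
    unfolding A_def combination_3 by (simp_all add: vector_3 field_simps)
  show ?thesis
  proof (rule psr_isomorphic_by_matrix[OF h(1) maximal_hyperbolic_tangent])
    show "invertible A"
      unfolding invertible_kernel
    proof (intro allI impI)
      fix x assume "A *v x = 0"
      then have "(A *v x) $ 1 = 0" "(A *v x) $ 2 = 0" "(A *v x) $ 3 = 0" by simp_all
      then show "x = 0" unfolding A using r by (auto simp: vec3_eq_iff)
    qed
    fix x
    have "r * c = 1 / 3 - 0" using c by simp
    from std_form_touching[OF r this, of "A *v x" "x $ 2" "x $ 1" "x $ 3" 0]
    show "std_form (2 * r / 9) 0 c 0 (A *v x) = tangent_form x"
      unfolding A tangent_form_def by (simp add: power2_eq_square field_simps)
  next
    show "vector [1, 1, 0] \<in> tangent_cone"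
      by (simp add: tangent_cone_def tangent_form_def vector_3)
    have "A *v vector [1, 1, 0] = axis 1 1"
      by (simp add: vec3_eq_iff A vector_3 axis_def)
    then show "A *v vector [1, 1, 0] \<in> U" using h(2) by simp
  qed
qed

text \<open>If the bound failed, the point \<open>q\<close> below would lie in the cone, but the singular boundary point
  \<open>e = (1, r, 0)\<close> satisfies \<open>T(q, q, e) = T(q, e, e) = 0\<close>, against hyperbolicity.\<close>

lemma touching_node_sign:
  fixes r :: real
  assumes r: "r > 0" "r\<^sup>2 = 3" and z: "z\<^sup>2 = 1 / 3 - r * c" "z \<noteq> 0"
    and h: "maximal_hyperbolic (std_form (2 * r / 9) 0 c d) U" "axis 1 1 \<in> U"
  shows "d * z \<le> (2 / 3 + r * c) * z\<^sup>2"
proof (rule ccontr)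
  interpret maximal_hyperbolic "std_form (2 * r / 9) 0 c d" U by (fact h(1))
  assume "\<not> ?thesis"
  then have less: "(2 / 3 + r * c) * z\<^sup>2 < d * z" by simp
  define k where "k = z\<^sup>2"
  have k: "k > 0" using z(2) by (simp add: k_def)
  \<comment> \<open>In the coordinates of \<open>std_form_touching\<close> q has X = 1, Y = k, Z =
    z, so Y^2 = K Z^2 with K = k: it lies on a branch tangent of the node, where the derivative of
    the form towards the singular point vanishes.\<close>
  define q :: "real ^ 3" where "q = vector [(1 + 2 * k) / 3, (1 - k) * r / 3, z]"
  have q: "q $ 1 = (1 + 2 * k) / 3" "q $ 2 = (1 - k) * r / 3" "q $ 3 = z"
    by (simp_all add: q_def vector_3)
  have rc: "r * c = 1 / 3 - k" using z by (simp add: k_def)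
  have rrc: "c = r * (r * c) / 3" using r(2) by (simp add: power2_eq_square flip: mult.assoc)
  then have c': "c = r * (1 / 3 - k) / 3" unfolding rc .
  have "std_form (2 * r / 9) 0 c d q = 1 * (k\<^sup>2 - k * z\<^sup>2) - (1 - k) * k * z\<^sup>2 + d * z ^ 3"
    by (rule std_form_touching[OF r rc]) (simp_all add: q)
  also have "\<dots> = k * (d * z - (1 - k) * k)"
    by (simp add: k_def power2_eq_square power3_eq_cube algebra_simps)
  finally have "std_form (2 * r / 9) 0 c d q = k * (d * z - (1 - k) * k)" .
  moreover have "k * (d * z - (1 - k) * k) > 0"
    using less k rc by (simp add: k_def[symmetric])
  ultimately have "std_form (2 * r / 9) 0 c d q > 0" by (simp only:)
  moreover have "(q $ 2)\<^sup>2 + (q $ 3)\<^sup>2 < 3 * (q $ 1)\<^sup>2"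
  proof -
    have "(q $ 2)\<^sup>2 = (1 - k)\<^sup>2 / 3" using r(2) by (simp add: q power_mult_distrib power_divide)
    then have "3 * (q $ 1)\<^sup>2 - ((q $ 2)\<^sup>2 + (q $ 3)\<^sup>2) = k + k\<^sup>2"
      unfolding q(1,3) k_def[symmetric] by (simp add: power2_eq_square field_simps)
    moreover have "k + k\<^sup>2 > 0" using k by (simp add: add_pos_pos)
    ultimately show ?thesis by linarith
  qed
  ultimately have qU: "q \<in> U"
    using k unfolding std_cone_eq[OF h] by (simp add: std_cone_def q)
  define e :: "real ^ 3" where "e = vector [1, r, 0]"
  have e: "e $ 1 = 1" "e $ 2 = r" "e $ 3 = 0" by (simp_all add: e_def vector_3)
  have rr: "r * r = 3" using r(2) by (simp add: power2_eq_square)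
  have "r * q $ 2 = (r * r) * (1 - k) / 3" "(q $ 2)\<^sup>2 = (r * r) * (1 - k)\<^sup>2 / 9"
    by (simp_all add: q power2_eq_square)
  then have rq: "r * q $ 2 = 1 - k" "(q $ 2)\<^sup>2 = (1 - k)\<^sup>2 / 3" "r * r = 3"
    unfolding rr by simp_all
  have "T q q e = (q $ 1)\<^sup>2 - (2 * q $ 1 * (r * q $ 2) + ((q $ 2)\<^sup>2 + (q $ 3)\<^sup>2)) / 3
      + (r * r) * 2 / 9 * (q $ 2)\<^sup>2 + (r * c) * (q $ 3)\<^sup>2"
    by (simp add: polar_std_form e power2_eq_square field_simps)
  also have "\<dots> = 0"
    unfolding rq rc q(1,3) k_def[symmetric] by (simp add: power2_eq_square field_simps)
  finally have "T q q e = 0" .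
  moreover have "T q e e = q $ 1 - (q $ 1 * (r * r) + 2 * (r * q $ 2)) / 3 + 2 / 9 * (r * r) * (r * q $ 2)"
    by (simp add: polar_std_form e field_simps)
  then have "T q e e = 0"
    unfolding rq by (simp add: field_simps)
  moreover have "e \<noteq> 0" using e(1) by auto
  ultimately show False using neg[OF qU, of e] by simp
qed

text \<open>For K = k^2 > 0 the factors Y + k Z and Y - k Z of the tangent cone become the last two
  coordinates, and X is shifted. The signs of \<alpha> and \<beta> come from
  \<open>touching_node_sign\<close> at z = k and z = - k.\<close>

lemma touching_node_normal_form:
  fixes r :: real
  assumes r: "r > 0" "r\<^sup>2 = 3" and c: "r * c < 1 / 3"
    and h: "maximal_hyperbolic (std_form (2 * r / 9) 0 c d) U" "axis 1 1 \<in> U"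
  obtains \<alpha> \<beta> where "\<alpha> \<ge> 0" "\<beta> \<ge> 0"
    "psr_isomorphic (level (std_form (2 * r / 9) 0 c d) U) (level (node_form \<alpha> \<beta>) (node_cone \<alpha> \<beta>))"
proof -
  define k where "k = sqrt (1 / 3 - r * c)"
  have k: "k > 0" "k\<^sup>2 = 1 / 3 - r * c" using c by (simp_all add: k_def)
  define e where "e = 1 / k"
  have e: "e > 0" "k * e = 1" using k by (simp_all add: e_def)
  define m where "m = 2 / 3 + r * c"
  define \<alpha> where "\<alpha> = e ^ 3 * (m * k - d) / 8"
  define \<beta> where "\<beta> = e ^ 3 * (m * k + d) / 8"
  have "d * k \<le> m * k\<^sup>2" "d * (- k) \<le> m * (- k)\<^sup>2"
    unfolding m_def using k by (intro touching_node_sign[OF r _ _ h]; simp)+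
  then have "d * k \<le> (m * k) * k" "- d * k \<le> (m * k) * k"
    by (simp_all add: power2_eq_square)
  then have "d \<le> m * k" "- d \<le> m * k" using k(1) by (metis mult_le_cancel_right not_less_iff_gr_or_eq)+
  then have ab: "\<alpha> \<ge> 0" "\<beta> \<ge> 0" using e by (simp_all add: \<alpha>_def \<beta>_def)
  \<comment> \<open>P and Q shift X so as to cancel the two mixed monomials of the cubic in the last
    two coordinates; the pure cubes remain with coefficients -\<alpha> and -\<beta>.\<close>
  define P where "P = (m * k - 3 * d) * e ^ 3 / 8"
  define Q where "Q = (m * k + 3 * d) * e ^ 3 / 8"
  define A where "A = (transpose (vector [vector [1 / 3, r / 3, 0],
      vector [(1 - P) / 3, - r * (P + 1 / 2) / 3, e / 2],
      vector [(1 - Q) / 3, - r * (Q + 1 / 2) / 3, - e / 2]]) :: real ^ 3 ^ 3)"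
  have A: "(A *v x) $ 1 = (x $ 1 + (1 - P) * x $ 2 + (1 - Q) * x $ 3) / 3"
    "(A *v x) $ 2 = r * (x $ 1 - (P + 1 / 2) * x $ 2 - (Q + 1 / 2) * x $ 3) / 3"
    "(A *v x) $ 3 = e * (x $ 2 - x $ 3) / 2" for x
    unfolding A_def combination_3 by (simp_all add: vector_3 field_simps)
  have "psr_isomorphic (level (std_form (2 * r / 9) 0 c d) U) (level (node_form \<alpha> \<beta>) (node_cone \<alpha> \<beta>))"
  proof (rule psr_isomorphic_by_matrix[OF h(1) maximal_hyperbolic_node[OF ab]])
    show "invertible A"
      unfolding invertible_kernel
    proof (intro allI impI)
      fix x assume "A *v x = 0"
      then have "(A *v x) $ 1 = 0" "(A *v x) $ 2 = 0" "(A *v x) $ 3 = 0" by simp_all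
      then have *: "x $ 1 + (1 - P) * x $ 2 + (1 - Q) * x $ 3 = 0"
        "x $ 1 - (P + 1 / 2) * x $ 2 - (Q + 1 / 2) * x $ 3 = 0" "x $ 2 = x $ 3"
        unfolding A using r e by simp_all
      then have "x $ 2 = 0" by (simp add: algebra_simps)
      then show "x = 0" using * by (simp add: vec3_eq_iff)
    qed
    fix x
    have rc: "r * c = 1 / 3 - k\<^sup>2" using k by simp
    have m': "m = 1 - k\<^sup>2" using k by (simp add: m_def)
    have "std_form (2 * r / 9) 0 c d (A *v x)
      = (x $ 1 - P * x $ 2 - Q * x $ 3) * (((x $ 2 + x $ 3) / 2)\<^sup>2 - k\<^sup>2 * (e * (x $ 2 - x $ 3) / 2)\<^sup>2)
        - m * ((x $ 2 + x $ 3) / 2) * (e * (x $ 2 - x $ 3) / 2)\<^sup>2 + d * (e * (x $ 2 - x $ 3) / 2) ^ 3"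
    proof -
      define X Y Z where "X = x $ 1 - P * x $ 2 - Q * x $ 3" and "Y = (x $ 2 + x $ 3) / 2"
        and "Z = e * (x $ 2 - x $ 3) / 2"
      have "(A *v x) $ 1 = (X + 2 * Y) / 3" "(A *v x) $ 2 = r * (X - Y) / 3" "(A *v x) $ 3 = Z"
        unfolding A X_def Y_def Z_def by (simp_all add: field_simps)
      from std_form_touching[OF r rc this] have "std_form (2 * r / 9) 0 c d (A *v x)
          = X * (Y\<^sup>2 - k\<^sup>2 * Z\<^sup>2) - m * Y * Z\<^sup>2 + d * Z ^ 3"
        unfolding m' .
      then show ?thesis by (simp add: X_def Y_def Z_def)
    qed
    also have "\<dots> = node_form \<alpha> \<beta> x"
    proof -
      have "8 * ((x $ 1 - P * x $ 2 - Q * x $ 3) * (((x $ 2 + x $ 3) / 2)\<^sup>2 - k\<^sup>2 * (e * (x $ 2 - x $ 3) / 2)\<^sup>2)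
        - m * ((x $ 2 + x $ 3) / 2) * (e * (x $ 2 - x $ 3) / 2)\<^sup>2 + d * (e * (x $ 2 - x $ 3) / 2) ^ 3)
        = 8 * node_form \<alpha> \<beta> x"
        unfolding node_form_def \<alpha>_def \<beta>_def P_def Q_def using e(2) by (simp add: field_simps) algebra
      then show ?thesis by simp
    qed
    finally show "std_form (2 * r / 9) 0 c d (A *v x) = node_form \<alpha> \<beta> x" .
  next
    have "A *v vector [1 + P + Q, 1, 1] = axis 1 1"
      by (simp add: vec3_eq_iff A vector_3 axis_def field_simps)
    then show "A *v vector [1 + P + Q, 1, 1] \<in> U" using h(2) by simp
    have "1 + P + Q - \<alpha> - \<beta> = 1" by (simp add: P_def Q_def \<alpha>_def \<beta>_def field_simps)
    then show "vector [1 + P + Q, 1, 1] \<in> node_cone \<alpha> \<beta>"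
      by (simp add: node_cone_def node_form_def vector_3)
  qed
  then show ?thesis using that ab by blast
qed

text \<open>Cube roots of the nonzero coefficients are absorbed into the last two coordinates, and
  the first one compensates to keep the product; a zero coefficient takes the scale 1.\<close>

lemma node_form_normalise:
  assumes ab: "\<alpha> \<ge> 0" "\<beta> \<ge> 0"
  shows "psr_isomorphic (level (node_form \<alpha> \<beta>) (node_cone \<alpha> \<beta>))
    (level (node_form (sgn \<alpha>) (sgn \<beta>)) (node_cone (sgn \<alpha>) (sgn \<beta>)))"
proof -
  have ex: "\<exists>s>0. a = sgn a * s ^ 3" if "a \<ge> 0" for a :: real
  proof (cases "a = 0")
    case False
    then show ?thesis using that by (intro exI[of _ "root 3 a"]) (simp add: real_root_pow_pos)
  qed (auto intro: exI[of _ 1])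
  obtain s where s: "s > 0" "\<alpha> = sgn \<alpha> * s ^ 3" using ex[OF ab(1)] by blast
  obtain t where t: "t > 0" "\<beta> = sgn \<beta> * t ^ 3" using ex[OF ab(2)] by blast
  define A where "A = (transpose (vector [vector [s * t, 0, 0], vector [0, 1 / s, 0], vector [0, 0, 1 / t]]) :: real ^ 3 ^ 3)"
  have A: "(A *v x) $ 1 = s * t * x $ 1" "(A *v x) $ 2 = x $ 2 / s" "(A *v x) $ 3 = x $ 3 / t" for x
    unfolding A_def combination_3 by (simp_all add: vector_3)
  have ab': "sgn \<alpha> \<ge> 0" "sgn \<beta> \<ge> 0" using ab by (simp_all add: sgn_if)
  have eq: "node_form \<alpha> \<beta> (A *v x) = node_form (sgn \<alpha>) (sgn \<beta>) x" for x
  proof -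
    have "\<alpha> * (x $ 2 / s) ^ 3 = sgn \<alpha> * x $ 2 ^ 3" "\<beta> * (x $ 3 / t) ^ 3 = sgn \<beta> * x $ 3 ^ 3"
      using s(1) t(1) by (subst s(2) t(2); simp add: power_divide)+
    then show ?thesis using s(1) t(1) by (simp add: node_form_def A)
  qed
  let ?x = "vector [1 + sgn \<alpha> + sgn \<beta>, 1, 1] :: real ^ 3"
  have x: "?x \<in> node_cone (sgn \<alpha>) (sgn \<beta>)"
    by (simp add: node_cone_def node_form_def vector_3)
  show ?thesis
  proof (rule psr_isomorphic_by_matrix[OF maximal_hyperbolic_node[OF ab] maximal_hyperbolic_node[OF ab'] _ eq x])
    show "invertible A"
      unfolding invertible_kernel
    proof (intro allI impI)
      fix x assume "A *v x = 0"
      then have "(A *v x) $ 1 = 0" "(A *v x) $ 2 = 0" "(A *v x) $ 3 = 0" by simp_all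
      then show "x = 0" unfolding A using s t by (simp add: vec3_eq_iff)
    qed
    show "A *v ?x \<in> node_cone \<alpha> \<beta>"
      using x s(1) t(1) eq[of ?x] by (simp add: node_cone_def A vector_3)
  qed
qed

section \<open>The classification\<close>

abbreviation cubic_part :: "real \<Rightarrow> real \<Rightarrow> real \<Rightarrow> real \<Rightarrow> real \<Rightarrow> real \<Rightarrow> real" where
  "cubic_part a b c d y z \<equiv> a * y ^ 3 + 3 * b * y\<^sup>2 * z + 3 * c * y * z\<^sup>2 + d * z ^ 3"

lemma closure_std_cone:
  assumes "q \<in> closure (std_cone a b c d)"
  shows "q $ 1 \<ge> 0" "(q $ 2)\<^sup>2 + (q $ 3)\<^sup>2 \<le> 3 * (q $ 1)\<^sup>2" "std_form a b c d q \<ge> 0"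
proof -
  interpret cubic "std_form a b c d" by unfold_locales (rule homogeneous_std_form)
  have "closed {v. std_form a b c d v \<ge> 0}"
    by (intro closed_Collect_le continuous_intros continuous_on_form)
  then have "closed ({v. v $ 1 \<ge> 0 \<and> (v $ 2)\<^sup>2 + (v $ 3)\<^sup>2 \<le> 3 * (v $ 1)\<^sup>2} \<inter> {v. std_form a b c d v \<ge> 0})"
    by (intro closed_Int closed_std_cone)
  moreover have "std_cone a b c d \<subseteq> {v. v $ 1 \<ge> 0 \<and> (v $ 2)\<^sup>2 + (v $ 3)\<^sup>2 \<le> 3 * (v $ 1)\<^sup>2} \<inter> {v. std_form a b c d v \<ge> 0}"
    by (auto simp: std_cone_def)
  ultimately have "closure (std_cone a b c d) \<subseteq> {v. v $ 1 \<ge> 0 \<and> (v $ 2)\<^sup>2 + (v $ 3)\<^sup>2 \<le> 3 * (v $ 1)\<^sup>2} \<inter> {v. std_form a b c d v \<ge> 0}"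
    by (rule closure_minimal[rotated])
  then show "q $ 1 \<ge> 0" "(q $ 2)\<^sup>2 + (q $ 3)\<^sup>2 \<le> 3 * (q $ 1)\<^sup>2" "std_form a b c d q \<ge> 0"
    using assms by auto
qed

text \<open>On the circle y^2 + z^2 = 3 x^2 a zero of the form has P = 2 x^3, which is exactly the
  equality case of the bound.\<close>

lemma strict_bound_no_touching:
  assumes strict: "\<And>y z. y \<noteq> 0 \<or> z \<noteq> 0 \<Longrightarrow> 27 * (cubic_part a b c d y z)\<^sup>2 < 4 * (y\<^sup>2 + z\<^sup>2) ^ 3"
    and v: "(v $ 2)\<^sup>2 + (v $ 3)\<^sup>2 = 3 * (v $ 1)\<^sup>2" "v $ 1 > 0"
  shows "std_form a b c d v \<noteq> 0"
proof
  assume "std_form a b c d v = 0"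
  then have P: "cubic_part a b c d (v $ 2) (v $ 3) = 2 * v $ 1 ^ 3"
    using v(1) by (simp add: std_form_def power2_eq_square power3_eq_cube)
  have "v $ 2 \<noteq> 0 \<or> v $ 3 \<noteq> 0" using v by auto
  from strict[OF this] show False
    unfolding P v(1) by (simp add: power_mult_distrib flip: power_mult)
qed

text \<open>A boundary ray on which the Hessian determinant vanishes would be a real flex, hence lie on a
  line contained in the cubic (otherwise the cone crosses its tangent there), and that line would
  leave the cone through a point of the circle \<open>y\<^sup>2 + z\<^sup>2 = 3 x\<^sup>2\<close>.\<close>

lemma boundary_hess_det:
  assumes h: "maximal_hyperbolic (std_form a b c d) (std_cone a b c d)"
    and strict: "\<And>y z. y \<noteq> 0 \<or> z \<noteq> 0 \<Longrightarrow> 27 * (cubic_part a b c d y z)\<^sup>2 < 4 * (y\<^sup>2 + z\<^sup>2) ^ 3"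
    and q: "q \<in> closure (std_cone a b c d)" "q $ 1 > 0" "std_form a b c d q = 0"
  shows "hess_det (std_form a b c d) q \<noteq> 0"
proof
  let ?h = "std_form a b c d" and ?U = "std_cone a b c d"
  interpret maximal_hyperbolic ?h ?U by (fact h)
  assume D: "hess_det ?h q = 0"
  have lt: "(q $ 2)\<^sup>2 + (q $ 3)\<^sup>2 < 3 * (q $ 1)\<^sup>2"
    using closure_std_cone(2)[OF q(1)] strict_bound_no_touching[OF strict, of q] q by force
  define p :: "real ^ 3" where "p = axis 1 1"
  have p: "p $ 1 = 1" "p $ 2 = 0" "p $ 3 = 0" by (simp_all add: p_def axis_def)
  \<comment> \<open>The value is x^2 - (y^2 + z^2) / 3, so q is a smooth point of the cubic.\<close>
  have Tqqp: "T q q p > 0"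
    using lt by (simp add: polar_std_form p power2_eq_square)
  define g2 where "g2 = T q q (axis 2 1)"
  define g3 where "g3 = T q q (axis 3 1)"
  obtain n2 n3 where n23: "g2 * n2 + g3 * n3 = 0" "n2 \<noteq> 0 \<or> n3 \<noteq> 0"
  proof (cases "g2 = 0 \<and> g3 = 0")
    case False
    then show ?thesis using that[of "- g3" g2] by auto
  qed (use that[of 1 0] in auto)
  define n0 :: "real ^ 3" where "n0 = n2 *\<^sub>R axis 2 1 + n3 *\<^sub>R axis 3 1"
  have n0: "n0 $ 1 = 0" "n0 $ 2 = n2" "n0 $ 3 = n3" "T q q n0 = 0"
    using n23 by (simp_all add: n0_def axis_def expand g2_def g3_def mult.commute)
  \<comment> \<open>With q, the vector n spans the tangent plane at q. Its first coordinate is 0, so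
    q + s n stays in a slice of the cone, and the sign makes h n nonnegative.\<close>
  define n where "n = (if ?h n0 < 0 then - n0 else n0)"
  have n: "n $ 1 = 0" "n $ 2 \<noteq> 0 \<or> n $ 3 \<noteq> 0" "T q q n = 0"
    using n0 n23 by (auto simp: n_def expand)
  have hn: "?h n \<ge> 0" using scale[of "-1" n0] by (simp add: n_def)
  have sym: "T q p q = T q q p" "T q n q = 0" "T q n p = T q p n" "T n q q = 0" "T n q n = T q n n"
    "T n n q = T q n n"
    using n(3) by (simp_all add: polar_ac)
  let ?B = "vector [p, q, n] :: real ^ 3 ^ 3"
  have "det (gram ?h q ?B) = 0"
    using det_gram[of q ?B] D by simp
  \<comment> \<open>In the basis p, q, n the form \<open>T q\<close> vanishes on the pairs q, q and
    q, n. Hence D = 0 gives \<open>T q n n = 0\<close>, so h has a triple zero at q along the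
    tangent line.\<close>
  moreover have "det (gram ?h q ?B) = - ((T q q p)\<^sup>2 * T q n n)"
    by (simp add: det_3 gram_def vector_3 sym n(3) diag q(3) power2_eq_square)
  ultimately have qnn: "T q n n = 0" using Tqqp by simp
  have line: "?h (q + s *\<^sub>R n) = s ^ 3 * ?h n" for s
    by (simp add: add_scale q(3) n(3) qnn)
  have coords: "(q + s *\<^sub>R n) $ 1 = q $ 1" "(q + s *\<^sub>R n) $ i = q $ i + s * n $ i" for s i
    using n(1) by simp_all
  show False
  proof (cases "?h n = 0")
    case False
    then have pos: "?h n > 0" using hn by simp
    have "((\<lambda>s. (q $ 2 + s * n $ 2)\<^sup>2 + (q $ 3 + s * n $ 3)\<^sup>2) \<longlongrightarrow>
        (q $ 2 + 0 * n $ 2)\<^sup>2 + (q $ 3 + 0 * n $ 3)\<^sup>2) (at_right 0)"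
      by (intro tendsto_intros)
    then have "\<forall>\<^sub>F s in at_right 0. (q $ 2 + s * n $ 2)\<^sup>2 + (q $ 3 + s * n $ 3)\<^sup>2 < 3 * (q $ 1)\<^sup>2"
      by (rule order_tendstoD) (use lt in simp)
    moreover have "\<forall>\<^sub>F s in at_right (0::real). s > 0" by (simp add: eventually_at_right_less)
    ultimately have "\<forall>\<^sub>F s in at_right 0. s > 0 \<and> (q $ 2 + s * n $ 2)\<^sup>2 + (q $ 3 + s * n $ 3)\<^sup>2 < 3 * (q $ 1)\<^sup>2"
      by eventually_elim simp
    then obtain s where s: "s > 0" "(q $ 2 + s * n $ 2)\<^sup>2 + (q $ 3 + s * n $ 3)\<^sup>2 < 3 * (q $ 1)\<^sup>2"
      using eventually_happens'[of "at_right (0::real)"] by (force simp: trivial_limit_at_right_real)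
    \<comment> \<open>A point of the cone at which the nonzero vector q satisfies
      \<open>T u u q = 0\<close> and \<open>T u q q = 0\<close>, against hyperbolicity.\<close>
    define u where "u = q + s *\<^sub>R n"
    have "u \<in> ?U"
      using s pos q(2) line[of s] by (simp add: std_cone_def u_def n(1))
    moreover have "T u u q = 0" "T u q q = 0"
      by (simp_all add: u_def expand sym qnn diag q(3))
    moreover have "q \<noteq> 0" using q(2) by auto
    ultimately show False using neg by fastforce
  next
    case True
    define E where "E = (n $ 2)\<^sup>2 + (n $ 3)\<^sup>2"
    define F where "F = q $ 2 * n $ 2 + q $ 3 * n $ 3"
    define G where "G = (q $ 2)\<^sup>2 + (q $ 3)\<^sup>2 - 3 * (q $ 1)\<^sup>2"
    have E: "E > 0" using n(2) by (simp add: E_def sum_power2_gt_zero_iff)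
    have "E * G \<le> 0" using E lt by (simp add: G_def mult_nonneg_nonpos)
    then have disc: "F\<^sup>2 - E * G \<ge> 0" using zero_le_power2[of F] by linarith
    \<comment> \<open>A root of the quadratic equation for q + s n to lie on the circle; the
      discriminant is nonnegative because q is inside it.\<close>
    define s where "s = (- F + sqrt (F\<^sup>2 - E * G)) / E"
    have "E * s + F = sqrt (F\<^sup>2 - E * G)" using E by (simp add: s_def)
    then have "(E * s + F)\<^sup>2 = F\<^sup>2 - E * G" using disc by simp
    then have "E * (E * s\<^sup>2 + 2 * F * s + G) = 0" by algebra
    then have "E * s\<^sup>2 + 2 * F * s + G = 0" using E by simp
    then have "((q + s *\<^sub>R n) $ 2)\<^sup>2 + ((q + s *\<^sub>R n) $ 3)\<^sup>2 = 3 * ((q + s *\<^sub>R n) $ 1)\<^sup>2"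
      using n(1) unfolding coords E_def F_def G_def by algebra
    from strict_bound_no_touching[OF strict this] show False
      using q(2) line[of s] True by (simp add: n(1))
  qed
qed

text \<open>K is the part of the slice x = 1 where D / h does not exceed 1/9, its value at the base
  point, written as 9 D \<le> h so that it makes sense on the closure. A point of K with h = 0 would
  have D = 0, excluded by \<open>boundary_hess_det\<close>; so K is a compact subset of the
  cone.\<close>

lemma hess_det_quotient_min:
  assumes h: "maximal_hyperbolic (std_form a b c d) (std_cone a b c d)"
    and strict: "\<And>y z. y \<noteq> 0 \<or> z \<noteq> 0 \<Longrightarrow> 27 * (cubic_part a b c d y z)\<^sup>2 < 4 * (y\<^sup>2 + z\<^sup>2) ^ 3"
  obtains q where "q \<in> std_cone a b c d"
    "\<And>u. u \<in> std_cone a b c d \<Longrightarrow>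
       hess_det (std_form a b c d) q * std_form a b c d u \<le> hess_det (std_form a b c d) u * std_form a b c d q"
proof -
  let ?h = "std_form a b c d" and ?U = "std_cone a b c d" and ?D = "hess_det (std_form a b c d)"
  interpret maximal_hyperbolic ?h ?U by (fact h)
  note contD = continuous_on_hess_det[OF homogeneous]
  define K where "K = {q. q $ 1 = 1} \<inter> closure ?U \<inter> {q. 9 * ?D q \<le> ?h q}"
  have "closed {q. 9 * ?D q \<le> ?h q}" "closed {q :: real ^ 3. q $ 1 = 1}"
    by (intro closed_Collect_le closed_Collect_eq continuous_intros continuous_on_form contD)+
  then have "closed K" by (simp add: K_def closed_Int)
  moreover have "bounded K"
  proof (rule boundedI)
    fix q assume q: "q \<in> K"
    have "norm q \<le> (\<Sum>i\<in>UNIV. norm (q $ i))" by (rule norm_le_l1_cart[unfolded real_norm_def[symmetric]])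
    moreover have "(q $ 2)\<^sup>2 + (q $ 3)\<^sup>2 \<le> 3" "q $ 1 = 1"
      using closure_std_cone(2)[of q] q by (auto simp: K_def)
    then have "(q $ 2)\<^sup>2 \<le> 4" "(q $ 3)\<^sup>2 \<le> 4"
      using zero_le_power2[of "q $ 2"] zero_le_power2[of "q $ 3"] by linarith+
    then have "\<bar>q $ 2\<bar> \<le> 2" "\<bar>q $ 3\<bar> \<le> 2" by (auto intro: power2_le_imp_le)
    ultimately show "norm q \<le> 5" using \<open>q $ 1 = 1\<close> by (simp add: sum_3)
  qed
  ultimately have "compact K" by (simp add: compact_eq_bounded_closed)
  have KU: "q \<in> ?U" if q: "q \<in> K" for q
  proof (rule maximal)
    show "q \<in> closure ?U" using q by (simp add: K_def)
    have ge: "?h q \<ge> 0" using closure_std_cone(3) q by (simp add: K_def)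
    have "?U \<subseteq> {q. ?D q \<ge> 0}" using hess_det_pos[OF hyperbolic_axioms] by (auto intro: less_imp_le)
    moreover have "closed {q. ?D q \<ge> 0}" by (intro closed_Collect_le continuous_intros contD)
    ultimately have "closure ?U \<subseteq> {q. ?D q \<ge> 0}" by (rule closure_minimal)
    then have "?D q \<ge> 0" using q by (auto simp: K_def)
    moreover have "?D q \<noteq> 0" if "?h q = 0"
      by (rule boundary_hess_det[OF h strict _ _ that]) (use q in \<open>auto simp: K_def\<close>)
    ultimately show "?h q > 0" using ge q by (force simp: K_def)
  qed
  have cont: "continuous_on K (\<lambda>q. ?D q / ?h q)"
    using KU pos by (intro continuous_intros continuous_on_form contD) fastforce
  have e: "axis 1 1 \<in> ?U" by (simp add: std_cone_def std_form_axis) (simp add: axis_def)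
  then have "axis 1 1 \<in> K"
    using closure_subset[of ?U] hess_det_std_axis[of a b c d] std_form_axis[of a b c d]
    by (auto simp: K_def axis_def)
  then obtain q where q: "q \<in> K" "\<And>u. u \<in> K \<Longrightarrow> ?D q / ?h q \<le> ?D u / ?h u"
    using continuous_attains_inf[OF \<open>compact K\<close> _ cont] by blast
  have qpos: "?h q > 0" using KU[OF q(1)] pos by blast
  have min: "?D q / ?h q \<le> ?D u / ?h u" if u: "u \<in> ?U" for u
  proof -
    have u1: "u $ 1 > 0" using u by (simp add: std_cone_def)
    define w where "w = (1 / u $ 1) *\<^sub>R u"
    have w: "w \<in> ?U" "w $ 1 = 1" using cone[OF u, of "1 / u $ 1"] u1 by (simp_all add: w_def)
    have wpos: "?h w > 0" using pos w by blast
    have "?D w / ?h w = ?D u / ?h u"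
      using u1 by (simp add: w_def hess_det_scale[OF homogeneous] scale)
    moreover have "?D q / ?h q \<le> ?D w / ?h w"
    proof (cases "w \<in> K")
      case False
      then have "?h w < 9 * ?D w" using w closure_subset[of ?U] by (auto simp: K_def)
      then have "1 / 9 \<le> ?D w / ?h w" using wpos by (simp add: field_simps)
      moreover have "?D q / ?h q \<le> 1 / 9" using q(1) qpos by (simp add: K_def field_simps)
      ultimately show ?thesis by linarith
    qed (use q in blast)
    ultimately show ?thesis by simp
  qed
  show ?thesis
  proof (rule that[OF KU[OF q(1)]])
    fix u assume u: "u \<in> ?U"
    then have "?h u > 0" using pos by blast
    then show "?D q * ?h u \<le> ?D u * ?h q" using min[OF u] qpos by (simp add: field_simps)
  qed
qed

text \<open>Up to a factor, the trace of the cubic part is the derivative at the base point of the quotient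
  of the Hessian determinant by the form.\<close>

lemma critical_trace_free:
  assumes h: "maximal_hyperbolic (std_form a b c d) (std_cone a b c d)"
    and min: "\<And>u. u \<in> std_cone a b c d \<Longrightarrow> std_form a b c d u \<le> 9 * hess_det (std_form a b c d) u"
  shows "c = - a" "d = - b"
proof -
  let ?h = "std_form a b c d" and ?U = "std_cone a b c d" and ?D = "hess_det (std_form a b c d)"
  interpret maximal_hyperbolic ?h ?U by (fact h)
  have e: "axis 1 1 \<in> ?U" by (simp add: std_cone_def std_form_axis) (simp add: axis_def)
  have near: "\<exists>\<delta>>0. \<forall>s. \<bar>s\<bar> < \<delta> \<longrightarrow> axis 1 1 + s *\<^sub>R w \<in> ?U" for w
  proof -
    have "((\<lambda>s. axis 1 1 + s *\<^sub>R w) \<longlongrightarrow> axis 1 1 + 0 *\<^sub>R w) (nhds 0)"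
      by (intro tendsto_intros filterlim_ident)
    then have "\<forall>\<^sub>F s in nhds 0. axis 1 1 + s *\<^sub>R w \<in> ?U"
      using e open_cone by (intro topological_tendstoD) auto
    then show ?thesis by (auto simp: eventually_nhds_metric dist_real_def)
  qed
  show "c = - a"
  proof -
    \<comment> \<open>By hypothesis f has a local minimum 0 at s = 0, and its linear coefficient is
      -3 (a + c).\<close>
    define f where "f s = 9 * ?D (axis 1 1 + s *\<^sub>R axis 2 1) - ?h (axis 1 1 + s *\<^sub>R axis 2 1)" for s
    have f: "f s = (1 - 3 * a * s) * (1 - 3 * c * s) - 9 * b\<^sup>2 * s\<^sup>2 + s\<^sup>2 * (1 - 3 * c * s) / 3 - (1 - s\<^sup>2 + a * s ^ 3)" for s
      by (simp add: f_def det_3 gram_def polar_std_form mat_def axis_def std_form_def)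
        (simp add: field_simps power2_eq_square power3_eq_cube)
    obtain \<delta> where "\<delta> > 0" "\<And>s. \<bar>s\<bar> < \<delta> \<Longrightarrow> axis 1 1 + s *\<^sub>R axis 2 1 \<in> ?U" using near by blast
    then have "0 \<le> f s" if "\<bar>s\<bar> < \<delta>" for s
      unfolding f_def using min[of "axis 1 1 + s *\<^sub>R axis 2 1"] that by simp
    moreover have "f 0 = 0" by (simp add: f)
    moreover have "f = (\<lambda>s. (1 - 3 * a * s) * (1 - 3 * c * s) - 9 * b\<^sup>2 * s\<^sup>2 + s\<^sup>2 * (1 - 3 * c * s) / 3 - (1 - s\<^sup>2 + a * s ^ 3))"
      by (rule ext) (rule f)
    then have "(f has_real_derivative (- 3 * (a + c))) (at 0)"
      by (simp only:) (rule derivative_eq_intros refl | simp)+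
    ultimately have "- 3 * (a + c) = 0"
      using DERIV_local_min[of f "- 3 * (a + c)" 0 \<delta>] \<open>\<delta> > 0\<close> by simp
    then show ?thesis by simp
  qed
  show "d = - b"
  proof -
    define f where "f s = 9 * ?D (axis 1 1 + s *\<^sub>R axis 3 1) - ?h (axis 1 1 + s *\<^sub>R axis 3 1)" for s
    have f: "f s = (1 - 3 * b * s) * (1 - 3 * d * s) - 9 * c\<^sup>2 * s\<^sup>2 + s\<^sup>2 * (1 - 3 * b * s) / 3 - (1 - s\<^sup>2 + d * s ^ 3)" for s
      by (simp add: f_def det_3 gram_def polar_std_form mat_def axis_def std_form_def)
        (simp add: field_simps power2_eq_square power3_eq_cube)
    obtain \<delta> where "\<delta> > 0" "\<And>s. \<bar>s\<bar> < \<delta> \<Longrightarrow> axis 1 1 + s *\<^sub>R axis 3 1 \<in> ?U" using near by blast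
    then have "0 \<le> f s" if "\<bar>s\<bar> < \<delta>" for s
      unfolding f_def using min[of "axis 1 1 + s *\<^sub>R axis 3 1"] that by simp
    moreover have "f 0 = 0" by (simp add: f)
    moreover have "f = (\<lambda>s. (1 - 3 * b * s) * (1 - 3 * d * s) - 9 * c\<^sup>2 * s\<^sup>2 + s\<^sup>2 * (1 - 3 * b * s) / 3 - (1 - s\<^sup>2 + d * s ^ 3))"
      by (rule ext) (rule f)
    then have "(f has_real_derivative (- 3 * (b + d))) (at 0)"
      by (simp only:) (rule derivative_eq_intros refl | simp)+
    ultimately have "- 3 * (b + d) = 0"
      using DERIV_local_min[of f "- 3 * (b + d)" 0 \<delta>] \<open>\<delta> > 0\<close> by simp
    then show ?thesis by simp
  qed
qed

text \<open>The singular cases: b is the tangent form, a and e have \<alpha> = \<beta>, and the two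
  mixed choices both give c by \<open>node_swap\<close>.\<close>

definition node_type :: "(real ^ 3) set \<Rightarrow> bool" where
  "node_type H \<longleftrightarrow> psr_isomorphic H (level tangent_form tangent_cone) \<or>
     (\<exists>\<alpha>\<in>{0, 1}. \<exists>\<beta>\<in>{0, 1}. psr_isomorphic H (level (node_form \<alpha> \<beta>) (node_cone \<alpha> \<beta>)))"

lemma node_type_iso:
  assumes "psr_isomorphic H H'" "node_type H'" shows "node_type H"
  using assms psr_isomorphic_trans unfolding node_type_def by blast

text \<open>The direction v attains equality in the cubic bound. Taking it as second axis fixes the
  coefficient a, and \<open>touching_constraints\<close> restricts the others.\<close>

lemma touching_node_type:
  assumes h: "maximal_hyperbolic h U" and p: "p \<in> U" "h p = 1"
    and v: "polar h p p v = 0" "- 3 * polar h p v v = 1" and hv: "27 * (h v)\<^sup>2 = 4" "h v > 0"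
  shows "node_type (level h U)"
proof -
  interpret maximal_hyperbolic h U by fact
  obtain A a b c d where A: "invertible A" "A *v axis 1 1 = p" "A *v axis 2 1 = v"
    and std: "(\<lambda>x. h (A *v x)) = std_form a b c d"
    using std_coordinates[OF hyperbolic_axioms p v] by blast
  define V where "V = {x. A *v x \<in> U}"
  have V: "maximal_hyperbolic (std_form a b c d) V" "axis 1 1 \<in> V"
    using maximal_hyperbolic_compose[OF h A(1)] p A(2) by (simp_all add: V_def std)
  define r where "r = sqrt (3 :: real)"
  have r: "r > 0" "r\<^sup>2 = 3" by (simp_all add: r_def)
  have "a = h v" using fun_cong[OF std, of "axis 2 1"] A(3) by (simp add: std_form_def axis_def)
  moreover have "h v = 2 * r / 9"
  proof (rule power2_eq_imp_eq)
    show "(h v)\<^sup>2 = (2 * r / 9)\<^sup>2" using hv(1) r by (simp add: power_divide power_mult_distrib)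
  qed (use hv r in auto)
  ultimately have a: "a = 2 * r / 9" by simp
  have bound: "27 * (2 * r / 9 + 3 * b * s + 3 * c * s\<^sup>2 + d * s ^ 3)\<^sup>2 \<le> 4 * (1 + s\<^sup>2) ^ 3" for s
    using std_bound[OF V, of 1 s] by (simp add: a)
  note cons = touching_constraints[OF r bound]
  have V': "maximal_hyperbolic (std_form (2 * r / 9) 0 c d) V" using V(1) a cons(1) by simp
  have "node_type (level (std_form (2 * r / 9) 0 c d) V)"
  proof (cases "r * c = 1 / 3")
    case True
    then have "d = 0" by (rule cons(3))
    then show ?thesis
      using touching_tangent_normal_form[OF r True, of V] V' V(2) by (simp add: node_type_def)
  next
    case False
    then have "r * c < 1 / 3" using cons(2) by simp
    from touching_node_normal_form[OF r this V' V(2)] obtain \<alpha> \<beta> where ab: "\<alpha> \<ge> 0" "\<beta> \<ge> 0"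
      "psr_isomorphic (level (std_form (2 * r / 9) 0 c d) V) (level (node_form \<alpha> \<beta>) (node_cone \<alpha> \<beta>))"
      by blast
    have "sgn \<alpha> \<in> {0, 1}" "sgn \<beta> \<in> {0, 1}" using ab by (auto simp: sgn_if)
    moreover have "psr_isomorphic (level (std_form (2 * r / 9) 0 c d) V)
        (level (node_form (sgn \<alpha>) (sgn \<beta>)) (node_cone (sgn \<alpha>) (sgn \<beta>)))"
      by (rule psr_isomorphic_trans[OF ab(3) node_form_normalise[OF ab(1,2)]])
    ultimately show ?thesis unfolding node_type_def by blast
  qed
  then have "node_type (level (\<lambda>x. h (A *v x)) V)" unfolding std a cons(1) .
  then show ?thesis
    using psr_isomorphic_compose[OF A(1), of h U] node_type_iso psr_isomorphic_sym unfolding V_def by blast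
qed

text \<open>The cubic part is Re ((a - i b) (y + i z)^3), so a rotation by a third of the argument
  of a + i b makes the coefficient real; this is the triple angle formula.\<close>

lemma trace_free_rotation:
  obtains A :: "real ^ 3 ^ 3" and c where "invertible A" "A *v axis 1 1 = axis 1 1" "c \<ge> 0"
    "(\<lambda>x. std_form a b (- a) (- b) (A *v x)) = std_form c 0 (- c) 0"
proof -
  obtain c \<phi> where c: "c \<ge> 0" "a = c * cos \<phi>" "b = c * sin \<phi>"
  proof -
    obtain r \<phi> where r: "a = r * cos \<phi>" "b = r * sin \<phi>" using polar_Ex by blast
    show ?thesis
    proof (cases "r \<ge> 0")
      case False
      then show ?thesis using that[of "- r" "\<phi> + pi"] r by simp
    qed (use that r in blast)
  qed
  define k l where "k = cos (\<phi> / 3)" and "l = sin (\<phi> / 3)"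
  have kl: "k\<^sup>2 + l\<^sup>2 = 1" by (simp add: k_def l_def)
  have "cos \<phi> = cos (\<phi> / 3 + (\<phi> / 3 + \<phi> / 3))" "sin \<phi> = sin (\<phi> / 3 + (\<phi> / 3 + \<phi> / 3))" by simp_all
  then have "cos \<phi> = k ^ 3 - 3 * k * l\<^sup>2" "sin \<phi> = 3 * k\<^sup>2 * l - l ^ 3"
    unfolding cos_add sin_add k_def[symmetric] l_def[symmetric]
    by (simp_all add: power2_eq_square power3_eq_cube algebra_simps)
  then have ab: "a = c * (k ^ 3 - 3 * k * l\<^sup>2)" "b = c * (3 * k\<^sup>2 * l - l ^ 3)" using c by simp_all
  define A where "A = (transpose (vector [vector [1, 0, 0], vector [0, k, l], vector [0, - l, k]]) :: real ^ 3 ^ 3)"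
  have A: "(A *v x) $ 1 = x $ 1" "(A *v x) $ 2 = k * x $ 2 - l * x $ 3" "(A *v x) $ 3 = l * x $ 2 + k * x $ 3" for x
    unfolding A_def combination_3 by (simp_all add: vector_3)
  show ?thesis
  proof (rule that[of A c])
    show "invertible A"
      unfolding invertible_kernel
    proof (intro allI impI)
      fix x assume "A *v x = 0"
      then have "(A *v x) $ 1 = 0" "(A *v x) $ 2 = 0" "(A *v x) $ 3 = 0" by simp_all
      then have x: "x $ 1 = 0" "k * x $ 2 - l * x $ 3 = 0" "l * x $ 2 + k * x $ 3 = 0" unfolding A .
      have "(k\<^sup>2 + l\<^sup>2) * x $ 2 = 0" "(k\<^sup>2 + l\<^sup>2) * x $ 3 = 0" using x(2,3) by algebra+
      then show "x = 0" using x(1) kl by (simp add: vec3_eq_iff)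
    qed
    show "A *v axis 1 1 = axis 1 1" by (simp add: vec3_eq_iff A axis_def)
    show "(\<lambda>x. std_form a b (- a) (- b) (A *v x)) = std_form c 0 (- c) 0"
    proof
      fix x
      have "((A *v x) $ 2)\<^sup>2 + ((A *v x) $ 3)\<^sup>2 = (k\<^sup>2 + l\<^sup>2) * ((x $ 2)\<^sup>2 + (x $ 3)\<^sup>2)"
        unfolding A by algebra
      moreover have "cubic_part a b (- a) (- b) ((A *v x) $ 2) ((A *v x) $ 3)
          = (k\<^sup>2 + l\<^sup>2) ^ 3 * cubic_part c 0 (- c) 0 (x $ 2) (x $ 3)"
        unfolding A ab by algebra
      ultimately show "std_form a b (- a) (- b) (A *v x) = std_form c 0 (- c) 0 x"
        by (simp only: std_form_def A(1) kl) simp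
    qed
  qed (rule c)
qed

theorem normal_form:
  fixes h :: "real ^ 3 \<Rightarrow> real"
  assumes h: "maximal_hyperbolic h U"
  shows "node_type (level h U) \<or>
    (\<exists>c\<ge>0. 27 * c\<^sup>2 < 4 \<and> psr_isomorphic (level h U) (level (std_form c 0 (- c) 0) (std_cone c 0 (- c) 0)))"
proof -
  interpret h: maximal_hyperbolic h U by fact
  obtain p where "p \<in> level h U" using h.level_nonempty by blast
  then have p: "p \<in> U" "h p = 1" by (auto simp: level_def)
  obtain v where v: "polar h p p v = 0" "- 3 * polar h p v v = 1"
    using exists_unit_tangent[OF h.hyperbolic_axioms p(1)] by blast
  obtain A a b c d where A: "invertible A" "A *v axis 1 1 = p"
    and std: "(\<lambda>x. h (A *v x)) = std_form a b c d"
    using std_coordinates[OF h.hyperbolic_axioms p v] by metis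
  let ?h = "std_form a b c d"
  have V: "maximal_hyperbolic ?h {x. A *v x \<in> U}" "axis 1 1 \<in> {x. A *v x \<in> U}"
    using maximal_hyperbolic_compose[OF h A(1)] p A(2) by (simp_all add: std)
  note VU = std_cone_eq[OF V]
  let ?U = "std_cone a b c d"
  have V: "maximal_hyperbolic ?h ?U" "axis 1 1 \<in> ?U" using V unfolding VU .
  interpret g: maximal_hyperbolic ?h ?U by (fact V(1))
  have iso: "psr_isomorphic (level h U) (level ?h ?U)"
    using psr_isomorphic_sym[OF psr_isomorphic_compose[OF A(1), of h U]] by (simp only: std VU)
  show ?thesis
  proof (cases "\<forall>y z. y \<noteq> 0 \<or> z \<noteq> 0 \<longrightarrow> 27 * (cubic_part a b c d y z)\<^sup>2 < 4 * (y\<^sup>2 + z\<^sup>2) ^ 3")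
    case False
    then obtain y z where yz: "y \<noteq> 0 \<or> z \<noteq> 0" "27 * (cubic_part a b c d y z)\<^sup>2 \<ge> 4 * (y\<^sup>2 + z\<^sup>2) ^ 3"
      by (auto simp: not_less)
    then have eq: "27 * (cubic_part a b c d y z)\<^sup>2 = 4 * (y\<^sup>2 + z\<^sup>2) ^ 3"
      using std_bound[OF V, of y z] by simp
    define m where "m = y\<^sup>2 + z\<^sup>2"
    have m: "m > 0" using yz(1) by (simp add: m_def sum_power2_gt_zero_iff)
    define w0 :: "real ^ 3" where "w0 = vector [0, y, z]"
    \<comment> \<open>The cubic part is odd, so one of w0 and - w0 has the nonnegative value wanted
      for \<open>touching_node_type\<close>.\<close>
    define \<sigma> where "\<sigma> = (if ?h w0 \<ge> 0 then 1 else - 1 :: real)"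
    define w where "w = (\<sigma> / sqrt m) *\<^sub>R w0"
    have \<sigma>: "\<sigma> * \<sigma> = 1" "\<sigma> * ?h w0 \<ge> 0" "\<sigma> ^ 3 = \<sigma>" by (auto simp: \<sigma>_def)
    have hw0: "?h w0 = cubic_part a b c d y z" by (simp add: w0_def std_form_def vector_3)
    have "g.T (axis 1 1) (axis 1 1) w0 = 0" "- 3 * g.T (axis 1 1) w0 w0 = m"
      by (simp_all add: polar_std_form w0_def vector_3 axis_def m_def power2_eq_square)
    then have wT: "g.T (axis 1 1) (axis 1 1) w = 0" "- 3 * g.T (axis 1 1) w w = 1"
      using m \<sigma>(1) by (simp_all add: w_def g.expand field_simps)
    have hw: "?h w = \<sigma> * ?h w0 / sqrt m ^ 3"
      using \<sigma>(3) by (simp add: w_def g.scale power_divide)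
    then have "?h w \<ge> 0" using \<sigma>(2) m by simp
    moreover have "27 * (?h w)\<^sup>2 = 4"
    proof -
      have "(sqrt m ^ 3)\<^sup>2 = ((sqrt m)\<^sup>2) ^ 3" by (simp only: power_mult[symmetric] mult.commute)
      then have "(sqrt m ^ 3)\<^sup>2 = m ^ 3" using m by simp
      moreover have "\<sigma>\<^sup>2 = 1" using \<sigma>(1) by (simp add: power2_eq_square)
      ultimately have "27 * (?h w)\<^sup>2 = 27 * (?h w0)\<^sup>2 / m ^ 3"
        unfolding hw by (simp add: power_divide power_mult_distrib)
      then show ?thesis using m eq by (simp add: hw0 m_def[symmetric])
    qed
    moreover from this have "?h w \<noteq> 0" by auto
    ultimately have "node_type (level ?h ?U)"
      using touching_node_type[OF V std_form_axis wT] by simp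
    then show ?thesis using node_type_iso[OF iso] by blast
  next
    case True
    obtain q where q: "q \<in> ?U" "\<And>u. u \<in> ?U \<Longrightarrow> hess_det ?h q * ?h u \<le> hess_det ?h u * ?h q"
      using hess_det_quotient_min[OF V(1)] True by blast
    define r where "r = ?h q powr (-1/3)"
    have r: "r > 0" using g.pos[OF q(1)] by (simp add: r_def)
    define q1 where "q1 = r *\<^sub>R q"
    have q1: "q1 \<in> ?U" "?h q1 = 1"
      using g.retract_in_level[OF q(1)] by (simp_all add: level_def g.retract_def r_def q1_def)
    have q1min: "hess_det ?h q1 * ?h u \<le> hess_det ?h u" if u: "u \<in> ?U" for u
    proof -
      have "r ^ 3 * (hess_det ?h q * ?h u) \<le> r ^ 3 * (hess_det ?h u * ?h q)"
        using r q(2)[OF u] by (intro mult_left_mono) auto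
      then have "hess_det ?h q1 * ?h u \<le> hess_det ?h u * ?h q1"
        by (simp add: q1_def hess_det_scale[OF g.homogeneous] g.scale mult_ac)
      then show ?thesis by (simp add: q1(2))
    qed
    obtain w where w: "g.T q1 q1 w = 0" "- 3 * g.T q1 w w = 1"
      using exists_unit_tangent[OF g.hyperbolic_axioms q1(1)] by blast
    obtain B a' b' c' d' where B: "invertible B" "B *v axis 1 1 = q1"
      and std': "(\<lambda>x. ?h (B *v x)) = std_form a' b' c' d'"
      using std_coordinates[OF g.hyperbolic_axioms q1 w] by metis
    let ?h' = "std_form a' b' c' d'"
    have W: "maximal_hyperbolic ?h' {x. B *v x \<in> ?U}" "axis 1 1 \<in> {x. B *v x \<in> ?U}"
      using maximal_hyperbolic_compose[OF V(1) B(1)] q1 B(2) by (simp_all add: std')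
    note WU = std_cone_eq[OF W]
    let ?U' = "std_cone a' b' c' d'"
    have W: "maximal_hyperbolic ?h' ?U'" "axis 1 1 \<in> ?U'" using W unfolding WU .
    have D': "hess_det ?h' x = (det B)\<^sup>2 * hess_det ?h (B *v x)" for x
      using hess_det_compose[OF g.homogeneous, of B x] by (simp only: std')
    \<comment> \<open>In coordinates adapted to the minimum, minimality says that the quotient is at
      least its value at the base point, which is always 1/9.\<close>
    have le: "?h' u \<le> 9 * hess_det ?h' u" if "u \<in> ?U'" for u
    proof -
      from that
      have "B *v u \<in> ?U" unfolding WU[symmetric] by simp
      from mult_left_mono[OF q1min[OF this], of "(det B)\<^sup>2"]
      have "hess_det ?h' (axis 1 1) * ?h (B *v u) \<le> hess_det ?h' u"
        by (simp add: D' B(2) mult.assoc)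
      moreover have "hess_det ?h' (axis 1 1) = 1 / 9" using hess_det_std_axis[of a' b' c' d'] by simp
      ultimately show "?h' u \<le> 9 * hess_det ?h' u" using fun_cong[OF std', of u] by simp
    qed
    have tf: "c' = - a'" "d' = - b'"
      by (rule critical_trace_free[OF W(1)], erule le)+
    obtain R :: "real ^ 3 ^ 3" and e where R: "invertible R" "R *v axis 1 1 = axis 1 1" "e \<ge> 0"
      and rot: "(\<lambda>x. ?h' (R *v x)) = std_form e 0 (- e) 0"
      by (rule trace_free_rotation[of a' b', folded tf])
    let ?N = "std_form e 0 (- e) 0" and ?C = "std_cone e 0 (- e) 0"
    have X: "maximal_hyperbolic ?N {x. R *v x \<in> ?U'}" "axis 1 1 \<in> {x. R *v x \<in> ?U'}"
      using maximal_hyperbolic_compose[OF W(1) R(1)] W(2) R(2) by (simp_all add: rot)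
    note XU = std_cone_eq[OF X]
    have X: "maximal_hyperbolic ?N ?C" "axis 1 1 \<in> ?C" using X unfolding XU .
    have "psr_isomorphic (level ?h ?U) (level ?h' ?U')"
      using psr_isomorphic_sym[OF psr_isomorphic_compose[OF B(1), of ?h ?U]] by (simp only: std' WU)
    moreover have "psr_isomorphic (level ?h' ?U') (level ?N ?C)"
      using psr_isomorphic_sym[OF psr_isomorphic_compose[OF R(1), of ?h' ?U']] by (simp only: rot XU)
    ultimately have iso': "psr_isomorphic (level h U) (level ?N ?C)"
      using iso psr_isomorphic_trans by blast
    have "27 * e\<^sup>2 \<le> 4" using std_bound[OF X, of 1 0] by simp
    show ?thesis
    proof (cases "27 * e\<^sup>2 < 4")
      case True
      then show ?thesis using iso' R(3) by blast
    next
      \<comment> \<open>The strict bound was assumed at the old base point; equality at the new one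
        again leads to the singular cases.\<close>
      case False
      then have e: "27 * e\<^sup>2 = 4" using \<open>27 * e\<^sup>2 \<le> 4\<close> by simp
      have "e \<noteq> 0" using e by auto
      have "polar ?N (axis 1 1) (axis 1 1) (axis 2 1) = 0" "- 3 * polar ?N (axis 1 1) (axis 2 1) (axis 2 1) = 1"
        by (simp_all add: polar_std_form axis_def)
      moreover have "?N (axis 2 1) = e" by (simp add: std_form_def axis_def)
      ultimately have "node_type (level ?N ?C)"
        using touching_node_type[OF X std_form_axis, of "axis 2 1"] e \<open>e \<noteq> 0\<close> R(3) by simp
      then show ?thesis using node_type_iso[OF iso'] by blast
    qed
  qed
qed

section \<open>The normal forms are inequivalent\<close>

text \<open>A cone containing 0. Its \<open>dim\<close>, that of the linear span, is the invariant
  compared below.\<close>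

definition singular_set :: "('a::real_vector \<Rightarrow> real) \<Rightarrow> 'a set" where
  "singular_set h = {q. \<forall>v. polar h q q v = 0}"

lemma singular_set_image:
  fixes A :: "real ^ 'n ^ 'n"
  assumes A: "invertible A" and h: "\<And>x. h x = h' (A *v x)"
  shows "(\<lambda>x. A *v x) ` singular_set h = singular_set h'"
proof -
  have "h = (\<lambda>x. h' (A *v x))" using h by blast
  then have T: "polar h x y z = polar h' (A *v x) (A *v y) (A *v z)" for x y z
    using polar_compose[of h' A x y z] by simp
  show ?thesis
  proof (intro equalityI subsetI)
    fix y assume "y \<in> (\<lambda>x. A *v x) ` singular_set h"
    then obtain x where x: "y = A *v x" "\<And>v. polar h x x v = 0" by (auto simp: singular_set_def)
    have "polar h' y y w = 0" for w
    proof -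
      obtain v where "A *v v = w" using invertible_surj[OF A] by blast
      then show ?thesis using x T[of x x v] by simp
    qed
    then show "y \<in> singular_set h'" by (simp add: singular_set_def)
  next
    fix y assume y: "y \<in> singular_set h'"
    obtain x where x: "A *v x = y" using invertible_surj[OF A] by blast
    have "x \<in> singular_set h" using y x T by (simp add: singular_set_def)
    then show "y \<in> (\<lambda>x. A *v x) ` singular_set h" using x by blast
  qed
qed

lemma dim_singular_set:
  fixes A :: "real ^ 'n ^ 'n"
  assumes A: "invertible A" and h: "\<And>x. h x = h' (A *v x)"
  shows "dim (singular_set h) = dim (singular_set h')"
proof -
  have "dim ((\<lambda>x. A *v x) ` singular_set h) = dim (singular_set h)"
    by (rule dim_image_eq) (auto intro!: inj_onI invertible_inj[OF A])
  then show ?thesis by (simp only: singular_set_image[where h = h and h' = h', OF A h])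
qed

text \<open>S need not be a subspace; it contains the chosen axes and lies in their span.\<close>

lemma dim_coordinate_subspace:
  fixes S :: "(real ^ 'n) set"
  assumes "\<And>i. i \<in> I \<Longrightarrow> axis i 1 \<in> S" "\<And>q j. q \<in> S \<Longrightarrow> j \<notin> I \<Longrightarrow> q $ j = 0"
  shows "dim S = card I"
proof (rule dim_unique)
  let ?B = "(\<lambda>i. axis i 1 :: real ^ 'n) ` I"
  show "?B \<subseteq> S" using assms(1) by blast
  show "S \<subseteq> span ?B"
  proof
    fix q assume q: "q \<in> S"
    have "(\<Sum>i\<in>UNIV. (q $ i) *\<^sub>R axis i 1) \<in> span ?B"
    proof (rule span_sum)
      fix i
      show "(q $ i) *\<^sub>R axis i 1 \<in> span ?B"
        using assms(2)[OF q, of i] by (cases "i \<in> I") (auto intro: span_scale span_base span_zero)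
    qed
    then show "q \<in> span ?B"
      using basis_expansion[of q] by (simp add: scalar_mult_eq_scaleR)
  qed
  show "independent ?B"
    by (rule independent_mono[OF independent_Basis]) (auto simp: Basis_vec_def)
  show "card ?B = card I"
    by (rule card_image) (auto intro!: inj_onI simp: axis_eq_axis)
qed

lemma singular_set_node:
  "q \<in> singular_set (node_form \<alpha> \<beta>) \<longleftrightarrow>
    q $ 2 * q $ 3 = 0 \<and> q $ 1 * q $ 3 = 3 * \<alpha> * (q $ 2)\<^sup>2 \<and> q $ 1 * q $ 2 = 3 * \<beta> * (q $ 3)\<^sup>2"
proof -
  have *: "3 * polar (node_form \<alpha> \<beta>) q q v = v $ 1 * (q $ 2 * q $ 3)
      + v $ 2 * (q $ 1 * q $ 3 - 3 * \<alpha> * (q $ 2)\<^sup>2) + v $ 3 * (q $ 1 * q $ 2 - 3 * \<beta> * (q $ 3)\<^sup>2)" for v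
    by (simp add: polar_node_form power2_eq_square field_simps)
  show ?thesis
  proof
    assume "q \<in> singular_set (node_form \<alpha> \<beta>)"
    then have 0: "polar (node_form \<alpha> \<beta>) q q v = 0" for v by (simp add: singular_set_def)
    show "q $ 2 * q $ 3 = 0 \<and> q $ 1 * q $ 3 = 3 * \<alpha> * (q $ 2)\<^sup>2 \<and> q $ 1 * q $ 2 = 3 * \<beta> * (q $ 3)\<^sup>2"
      using *[of "axis 1 1"] *[of "axis 2 1"] *[of "axis 3 1"] unfolding 0 by (simp add: axis_def)
  next
    assume "q $ 2 * q $ 3 = 0 \<and> q $ 1 * q $ 3 = 3 * \<alpha> * (q $ 2)\<^sup>2 \<and> q $ 1 * q $ 2 = 3 * \<beta> * (q $ 3)\<^sup>2"
    then have "3 * polar (node_form \<alpha> \<beta>) q q v = 0" for v unfolding * by simp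
    then show "q \<in> singular_set (node_form \<alpha> \<beta>)" by (simp add: singular_set_def)
  qed
qed

lemma singular_set_tangent:
  "q \<in> singular_set tangent_form \<longleftrightarrow> q $ 1 = 0 \<and> q $ 3 = 0"
proof -
  have *: "3 * polar tangent_form q q v = v $ 1 * (2 * q $ 1 * q $ 2 - (q $ 3)\<^sup>2)
      + v $ 2 * (q $ 1)\<^sup>2 - v $ 3 * (2 * q $ 1 * q $ 3)" for v
    by (simp add: polar_tangent_form power2_eq_square field_simps)
  show ?thesis
  proof
    assume "q \<in> singular_set tangent_form"
    then have 0: "polar tangent_form q q v = 0" for v by (simp add: singular_set_def)
    show "q $ 1 = 0 \<and> q $ 3 = 0"
      using *[of "axis 1 1"] *[of "axis 2 1"] unfolding 0 by (simp add: axis_def)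
  next
    assume "q $ 1 = 0 \<and> q $ 3 = 0"
    then have "3 * polar tangent_form q q v = 0" for v unfolding * by simp
    then show "q \<in> singular_set tangent_form" by (simp add: singular_set_def)
  qed
qed

text \<open>Comparing the squared lengths of the two sides of the last two gradient equations, with
  y^2 + z^2 = 3 x^2 from the first, gives 3 (4 - 27 c^2) x^4 = 0.\<close>

lemma singular_set_trace_free:
  assumes "27 * c\<^sup>2 < 4"
  shows "singular_set (std_form c 0 (- c) 0) = {0}"
proof -
  have "q = 0" if "q \<in> singular_set (std_form c 0 (- c) 0)" for q
  proof -
    have 0: "polar (std_form c 0 (- c) 0) q q v = 0" for v using that by (simp add: singular_set_def)
    have *: "3 * polar (std_form c 0 (- c) 0) q q v = v $ 1 * (3 * (q $ 1)\<^sup>2 - ((q $ 2)\<^sup>2 + (q $ 3)\<^sup>2))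
        - v $ 2 * (2 * q $ 1 * q $ 2 - 3 * c * ((q $ 2)\<^sup>2 - (q $ 3)\<^sup>2))
        - v $ 3 * (2 * q $ 1 * q $ 3 + 6 * c * q $ 2 * q $ 3)" for v
      by (simp add: polar_std_form power2_eq_square field_simps)
    have 1: "(q $ 2)\<^sup>2 + (q $ 3)\<^sup>2 = 3 * (q $ 1)\<^sup>2"
      and 2: "2 * q $ 1 * q $ 2 = 3 * c * ((q $ 2)\<^sup>2 - (q $ 3)\<^sup>2)"
      and 3: "2 * q $ 1 * q $ 3 = - 6 * c * q $ 2 * q $ 3"
      using *[of "axis 1 1"] *[of "axis 2 1"] *[of "axis 3 1"] unfolding 0 by (simp_all add: axis_def)
    have "4 * (q $ 1)\<^sup>2 * ((q $ 2)\<^sup>2 + (q $ 3)\<^sup>2) = (2 * q $ 1 * q $ 2)\<^sup>2 + (2 * q $ 1 * q $ 3)\<^sup>2" by algebra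
    also have "\<dots> = 9 * c\<^sup>2 * ((q $ 2)\<^sup>2 + (q $ 3)\<^sup>2)\<^sup>2" unfolding 2 3 by algebra
    finally have "3 * (4 - 27 * c\<^sup>2) * (q $ 1) ^ 4 = 0" unfolding 1 by algebra
    then have "q $ 1 = 0" using assms by simp
    then show "q = 0" using 1 by (simp add: vec3_eq_iff sum_power2_eq_zero_iff)
  qed
  moreover have "0 \<in> singular_set (std_form c 0 (- c) 0)"
    by (simp add: singular_set_def polar_std_form)
  ultimately show ?thesis by blast
qed

text \<open>Triangle, conic with secant, nodal cubic and conic with tangent have 3, 2, 1 and 1
  singular points, in independent positions; the trace free forms have no real one.\<close>

lemma dim_singular_sets:
  "dim (singular_set (node_form 0 0)) = 3" "dim (singular_set (node_form 1 0)) = 2"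
  "dim (singular_set (node_form 1 1)) = 1" "dim (singular_set tangent_form) = 1"
  "27 * c\<^sup>2 < 4 \<Longrightarrow> dim (singular_set (std_form c 0 (- c) 0)) = 0"
proof -
  have ex3: "j \<noteq> 1 \<Longrightarrow> j = 2 \<or> j = 3" "j \<noteq> 2 \<Longrightarrow> j = 1 \<or> j = 3" for j :: 3
    using exhaust_3[of j] by auto
  have "dim (singular_set (node_form 0 0)) = card (UNIV :: 3 set)"
    by (rule dim_coordinate_subspace) (auto simp: singular_set_node axis_def)
  then show "dim (singular_set (node_form 0 0)) = 3" by simp
  have "dim (singular_set (node_form 1 0)) = card {1, 3 :: 3}"
    by (rule dim_coordinate_subspace) (auto simp: singular_set_node axis_def dest: ex3)
  then show "dim (singular_set (node_form 1 0)) = 2" by simp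
  have "dim (singular_set (node_form 1 1)) = card {1 :: 3}"
    by (rule dim_coordinate_subspace) (auto simp: singular_set_node axis_def dest: ex3)
  then show "dim (singular_set (node_form 1 1)) = 1" by simp
  have "dim (singular_set tangent_form) = card {2 :: 3}"
    by (rule dim_coordinate_subspace) (auto simp: singular_set_tangent axis_def dest: ex3)
  then show "dim (singular_set tangent_form) = 1" by simp
  show "dim (singular_set (std_form c 0 (- c) 0)) = 0" if "27 * c\<^sup>2 < 4"
    unfolding singular_set_trace_free[OF that] by simp
qed

text \<open>Both cubics have one singular point q. For the node \<open>T q\<close> is a multiple of
  the product of the two branch tangents, hence indefinite; for the tangency it is a multiple of a
  square.\<close>

lemma node_tangent_inequivalent:
  assumes A: "invertible A" and h: "\<And>x. node_form 1 1 x = tangent_form (A *v x)"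
  shows False
proof -
  have "node_form 1 1 = (\<lambda>x. tangent_form (A *v x))" using h by blast
  then have T: "polar (node_form 1 1) x y z = polar tangent_form (A *v x) (A *v y) (A *v z)" for x y z
    using polar_compose[of tangent_form A x y z] by simp
  define q where "q = A *v axis 1 1"
  have "axis 1 1 \<in> singular_set (node_form 1 1)" by (simp add: singular_set_node axis_def)
  then have "q \<in> singular_set tangent_form"
    unfolding q_def using singular_set_image[where h = "node_form 1 1" and h' = tangent_form, OF A h] by blast
  then have "q $ 1 = 0" "q $ 3 = 0" by (simp_all add: singular_set_tangent)
  then have q: "polar tangent_form q v v = q $ 2 * (v $ 1)\<^sup>2 / 3" for v
    by (simp add: polar_tangent_form power2_eq_square)
  have "polar (node_form 1 1) (axis 1 1) (vector [0, 1, 1]) (vector [0, 1, 1]) > 0"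
    "polar (node_form 1 1) (axis 1 1) (vector [0, 1, -1]) (vector [0, 1, -1]) < 0"
    by (simp_all add: polar_node_form axis_def vector_3)
  then have "q $ 2 * ((A *v vector [0, 1, 1]) $ 1)\<^sup>2 > 0" "q $ 2 * ((A *v vector [0, 1, -1]) $ 1)\<^sup>2 < 0"
    unfolding T q_def[symmetric] q by simp_all
  then show False by (auto simp: zero_less_mult_iff mult_less_0_iff)
qed

text \<open>The quotient of the Hessian determinant by the form has a unique critical ray in the cone, so an
  equivalence preserves the base point and acts orthogonally on the tangent plane there.\<close>

lemma trace_free_parameter_le:
  assumes c: "27 * c\<^sup>2 < 4" and c': "c' \<ge> 0" "27 * c'\<^sup>2 < 4"
    and iso: "psr_isomorphic (level (std_form c 0 (- c) 0) (std_cone c 0 (- c) 0))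
      (level (std_form c' 0 (- c') 0) (std_cone c' 0 (- c') 0))"
  shows "c \<le> c'"
proof -
  let ?h = "std_form c 0 (- c) 0" and ?U = "std_cone c 0 (- c) 0"
  let ?h' = "std_form c' 0 (- c') 0" and ?U' = "std_cone c' 0 (- c') 0"
  have mh: "maximal_hyperbolic ?h ?U" "maximal_hyperbolic ?h' ?U'"
    using maximal_hyperbolic_trace_free[of c 0] maximal_hyperbolic_trace_free[of c' 0] c c' by simp_all
  obtain A where A: "invertible A" and h: "\<And>x. ?h x = ?h' (A *v x)" and U: "?U = {x. A *v x \<in> ?U'}"
    using psr_isomorphic_imp_compose[OF mh iso] by metis
  have comp: "?h = (\<lambda>x. ?h' (A *v x))" using h by blast
  have T: "polar ?h x y z = polar ?h' (A *v x) (A *v y) (A *v z)" for x y z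
    by (subst comp) (rule polar_compose)
  have D: "hess_det ?h x = (det A)\<^sup>2 * hess_det ?h' (A *v x)" for x
    by (subst comp) (rule hess_det_compose[OF homogeneous_std_form])
  have hd: "27 * hess_det ?h x = 3 * ?h x + (4 - 27 * c\<^sup>2) * (x $ 1 * ((x $ 2)\<^sup>2 + (x $ 3)\<^sup>2))"
    and hd': "27 * hess_det ?h' x = 3 * ?h' x + (4 - 27 * c'\<^sup>2) * (x $ 1 * ((x $ 2)\<^sup>2 + (x $ 3)\<^sup>2))" for x
    using hess_det_std_form[of c 0 x] hess_det_std_form[of c' 0 x] by simp_all
  have e: "axis 1 1 \<in> ?U" "axis 1 1 \<in> ?U'"
    by (simp_all add: std_cone_def std_form_axis) (simp_all add: axis_def)
  define q where "q = A *v axis 1 1"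
  have q: "q \<in> ?U'" "?h' q = 1"
    using e(1) h[of "axis 1 1"] U by (auto simp: q_def std_form_axis)
  have q1: "q $ 1 > 0" using q(1) by (simp add: std_cone_def)
  have Dq: "9 * ((det A)\<^sup>2 * hess_det ?h' q) = 1"
    using D[of "axis 1 1"] hess_det_std_axis[of c 0 "- c" 0] by (simp add: q_def)
  obtain w where w: "A *v w = axis 1 1" using invertible_surj[OF A] by blast
  have wU: "w \<in> ?U" using e(2) w U by simp
  have "?h w = 1" using h[of w] by (simp add: w std_form_axis)
  then have "27 * hess_det ?h w \<ge> 3"
    unfolding hd using wU c by (auto simp: std_cone_def intro!: mult_nonneg_nonneg)
  moreover have "9 * hess_det ?h w = (det A)\<^sup>2"
    using D[of w] hess_det_std_axis[of c' 0 "- c'" 0] by (simp add: w)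
  \<comment> \<open>D / h is at least 1/9 on either cone, with equality at the base point.
    Evaluation at w bounds (det A)^2 from below; evaluation at q then forces the minimal value
    there, so q lies on the base ray.\<close>
  ultimately have "(det A)\<^sup>2 \<ge> 1" by simp
  moreover have ge: "9 * hess_det ?h' q \<ge> 1"
  proof -
    have "(4 - 27 * c'\<^sup>2) * (q $ 1 * ((q $ 2)\<^sup>2 + (q $ 3)\<^sup>2)) \<ge> 0"
      using c'(2) q1 by (intro mult_nonneg_nonneg) auto
    then show ?thesis using hd'[of q] q(2) by simp
  qed
  ultimately have "1 * (9 * hess_det ?h' q) \<le> (det A)\<^sup>2 * (9 * hess_det ?h' q)"
    by (intro mult_right_mono) auto
  moreover have "(det A)\<^sup>2 * (9 * hess_det ?h' q) = 1" using Dq by simp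
  ultimately have "9 * hess_det ?h' q = 1" using ge by linarith
  then have "(4 - 27 * c'\<^sup>2) * (q $ 1 * ((q $ 2)\<^sup>2 + (q $ 3)\<^sup>2)) = 0"
    using hd'[of q] unfolding q(2) by linarith
  then have q23: "q $ 2 = 0" "q $ 3 = 0"
    using c'(2) q1 by (simp_all add: sum_power2_eq_zero_iff)
  then have "q $ 1 ^ 3 = 1 ^ 3" using q(2) by (simp add: std_form_def)
  then have "q $ 1 = 1" by (rule power_eq_imp_eq_base) (use q1 in auto)
  then have qe: "q = axis 1 1" using q23 by (simp add: vec3_eq_iff axis_def)
  define v where "v = A *v axis 2 1"
  have "polar ?h' q q v = polar ?h (axis 1 1) (axis 1 1) (axis 2 1)"
    "polar ?h' q v v = polar ?h (axis 1 1) (axis 2 1) (axis 2 1)"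
    by (simp_all add: T q_def v_def)
  then have v: "v $ 1 = 0" "(v $ 2)\<^sup>2 + (v $ 3)\<^sup>2 = 1"
    unfolding qe by (simp_all add: polar_std_form axis_def power2_eq_square)
  have "c = ?h (axis 2 1)" by (simp add: std_form_def axis_def)
  also have "\<dots> = ?h' v" by (simp add: h v_def)
  also have "\<dots> = c' * (v $ 2 ^ 3 - 3 * v $ 2 * (v $ 3)\<^sup>2)"
    by (simp add: std_form_def v(1) algebra_simps)
  also have "\<dots> \<le> c' * 1"
  proof (rule mult_left_mono)
    \<comment> \<open>The left side adds the squares of the real and imaginary parts of (v2 + i
      v3)^3, where v2 + i v3 has modulus 1.\<close>
    have "(v $ 2 ^ 3 - 3 * v $ 2 * (v $ 3)\<^sup>2)\<^sup>2 + (3 * (v $ 2)\<^sup>2 * v $ 3 - v $ 3 ^ 3)\<^sup>2 = ((v $ 2)\<^sup>2 + (v $ 3)\<^sup>2) ^ 3"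
      by algebra
    then have "(v $ 2 ^ 3 - 3 * v $ 2 * (v $ 3)\<^sup>2)\<^sup>2 \<le> 1\<^sup>2"
      using zero_le_power2[of "3 * (v $ 2)\<^sup>2 * v $ 3 - v $ 3 ^ 3"] unfolding v(2) power_one by linarith
    then show "v $ 2 ^ 3 - 3 * v $ 2 * (v $ 3)\<^sup>2 \<le> 1" by (rule power2_le_imp_le) simp
  qed (rule c')
  finally show ?thesis by simp
qed

section \<open>The model surfaces\<close>

lemma vector_Collect_iff:
  "v \<in> {vector [x, y, z] :: real ^ 3 | x y z. P x y z} \<longleftrightarrow> P (v $ 1) (v $ 2) (v $ 3)"
proof
  assume "P (v $ 1) (v $ 2) (v $ 3)"
  moreover have "v = vector [v $ 1, v $ 2, v $ 3]" by (simp add: vec3_eq_iff vector_3)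
  ultimately show "v \<in> {vector [x, y, z] :: real ^ 3 | x y z. P x y z}" by blast
qed (auto simp: vector_3)

lemma psr_isomorphic_preimage:
  fixes A :: "real ^ 'n ^ 'n"
  assumes A: "invertible A" and "\<And>v. v \<in> M \<longleftrightarrow> A *v v \<in> H"
  shows "psr_isomorphic M H"
proof -
  have "(\<lambda>v. A *v v) ` M = H"
    using assms(2) invertible_surj[OF A] by (metis (no_types, lifting) image_iff subsetI subset_antisym)
  then show ?thesis using A by (auto simp: psr_isomorphic_def)
qed

lemma invertible_3I:
  fixes A :: "real ^ 3 ^ 3"
  assumes "\<And>v. (A *v v) $ 1 = 0 \<Longrightarrow> (A *v v) $ 2 = 0 \<Longrightarrow> (A *v v) $ 3 = 0 \<Longrightarrow> v = 0"
  shows "invertible A"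
  unfolding invertible_kernel using assms by simp

lemma model_A: "psr_isomorphic (model_surface SurfA) (level (node_form 0 0) (node_cone 0 0))"
proof -
  define A where "A = (transpose (vector [vector [0, 1, 0], vector [0, 0, 1], vector [1, 0, 0]]) :: real ^ 3 ^ 3)"
  have A: "(A *v v) $ 1 = v $ 3" "(A *v v) $ 2 = v $ 1" "(A *v v) $ 3 = v $ 2" for v
    unfolding A_def combination_3 by (simp_all add: vector_3)
  show ?thesis
  proof (rule psr_isomorphic_preimage)
    show "invertible A" by (rule invertible_3I) (simp add: A vec3_eq_iff)
    show "v \<in> model_surface SurfA \<longleftrightarrow> A *v v \<in> level (node_form 0 0) (node_cone 0 0)" for v
      unfolding model_surface.simps vector_Collect_iff
      by (auto simp: level_def node_cone_def node_form_def A mult_ac)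
  qed
qed

lemma model_B: "psr_isomorphic (model_surface SurfB) (level tangent_form tangent_cone)"
proof -
  have "model_surface SurfB = level tangent_form tangent_cone"
    unfolding model_surface.simps set_eq_iff vector_Collect_iff
    by (auto simp: level_def tangent_cone_def tangent_form_def)
  then show ?thesis by (simp add: psr_isomorphic_refl)
qed

lemma model_C: "psr_isomorphic (model_surface SurfC) (level (node_form 1 0) (node_cone 1 0))"
proof -
  define A where "A = (transpose (vector [vector [0, - 1, 0], vector [0, 0, 1], vector [- 1, 0, 0]]) :: real ^ 3 ^ 3)"
  have A: "(A *v v) $ 1 = - v $ 3" "(A *v v) $ 2 = - v $ 1" "(A *v v) $ 3 = v $ 2" for v
    unfolding A_def combination_3 by (simp_all add: vector_3)
  show ?thesis
  proof (rule psr_isomorphic_preimage)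
    show "invertible A" by (rule invertible_3I) (simp add: A vec3_eq_iff)
    fix v
    have "node_form 1 0 (A *v v) = v $ 1 * (v $ 2 * v $ 3 + (v $ 1)\<^sup>2)"
      unfolding node_form_def A by algebra
    then show "v \<in> model_surface SurfC \<longleftrightarrow> A *v v \<in> level (node_form 1 0) (node_cone 1 0)"
      unfolding model_surface.simps vector_Collect_iff
      by (auto simp: level_def node_cone_def A)
  qed
qed

lemma model_D: "psr_isomorphic (model_surface SurfD) (level (std_form 0 0 (- 0) 0) (std_cone 0 0 (- 0) 0))"
proof -
  define A where "A = (transpose (vector [vector [0, 1, 0], vector [0, 0, 1], vector [- 1, 0, 0]]) :: real ^ 3 ^ 3)"
  have A: "(A *v v) $ 1 = - v $ 3" "(A *v v) $ 2 = v $ 1" "(A *v v) $ 3 = v $ 2" for v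
    unfolding A_def combination_3 by (simp_all add: vector_3)
  show ?thesis
  proof (rule psr_isomorphic_preimage)
    show "invertible A" by (rule invertible_3I) (simp add: A vec3_eq_iff)
    fix v
    have eq: "std_form 0 0 (- 0) 0 (A *v v) = v $ 3 * ((v $ 1)\<^sup>2 + (v $ 2)\<^sup>2 - (v $ 3)\<^sup>2)"
      unfolding std_form_def A by algebra
    have "(v $ 1)\<^sup>2 + (v $ 2)\<^sup>2 < 3 * (v $ 3)\<^sup>2"
      if "v $ 3 * ((v $ 1)\<^sup>2 + (v $ 2)\<^sup>2 - (v $ 3)\<^sup>2) = 1" "v $ 3 < 0"
    proof -
      have "v $ 3 * ((v $ 1)\<^sup>2 + (v $ 2)\<^sup>2 - (v $ 3)\<^sup>2) > 0" using that by simp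
      then have "(v $ 1)\<^sup>2 + (v $ 2)\<^sup>2 < (v $ 3)\<^sup>2" using that(2) by (simp add: zero_less_mult_iff)
      then show ?thesis using zero_le_power2[of "v $ 3"] by linarith
    qed
    then show "v \<in> model_surface SurfD \<longleftrightarrow> A *v v \<in> level (std_form 0 0 (- 0) 0) (std_cone 0 0 (- 0) 0)"
      unfolding model_surface.simps vector_Collect_iff level_def std_cone_def mem_Collect_eq eq
      by (auto simp: A)
  qed
qed

lemma model_E: "psr_isomorphic (model_surface SurfE) (level (node_form 1 1) (node_cone 1 1))"
proof -
  \<comment> \<open>The last two new coordinates are the linear factors of y^2 - z^2, scaled by 1/2
    and with signs making them positive on the surface. The term 3 y in the first one absorbs the
    mixed part of the sum of their cubes.\<close>
  define A where "A = (transpose (vector [vector [4, 0, 0], vector [3, - 1 / 2, - 1 / 2], vector [0, - 1 / 2, 1 / 2]]) :: real ^ 3 ^ 3)"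
  have A: "(A *v v) $ 1 = 4 * v $ 1 + 3 * v $ 2" "(A *v v) $ 2 = - (v $ 2 + v $ 3) / 2"
    "(A *v v) $ 3 = (v $ 3 - v $ 2) / 2" for v
    unfolding A_def combination_3 by (simp_all add: vector_3 field_simps)
  show ?thesis
  proof (rule psr_isomorphic_preimage)
    show "invertible A" by (rule invertible_3I) (simp add: A vec3_eq_iff)
    fix v
    have eq: "node_form 1 1 (A *v v) = v $ 1 * ((v $ 2)\<^sup>2 - (v $ 3)\<^sup>2) + v $ 2 ^ 3"
      unfolding node_form_def A by (simp add: power2_eq_square power3_eq_cube field_simps)
    have fwd: "- (v $ 2 + v $ 3) / 2 > 0 \<and> (v $ 3 - v $ 2) / 2 > 0"
      if "v $ 1 * ((v $ 2)\<^sup>2 - (v $ 3)\<^sup>2) + v $ 2 ^ 3 = 1" "v $ 2 < 0" "v $ 1 > 0"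
    proof -
      have "v $ 2 ^ 3 < 0" using that(2) by (simp add: power_less_zero_eq)
      then have "v $ 1 * ((v $ 2)\<^sup>2 - (v $ 3)\<^sup>2) > 0" using that(1) by linarith
      then have "(v $ 3)\<^sup>2 < (v $ 2)\<^sup>2" using that(3) by (simp add: zero_less_mult_iff)
      then have "\<bar>v $ 3\<bar> < \<bar>v $ 2\<bar>" by (intro power2_less_imp_less[of "\<bar>v $ 3\<bar>" "\<bar>v $ 2\<bar>"]) auto
      then show ?thesis using that(2) by (auto simp: abs_if split: if_splits)
    qed
    have bwd: "v $ 2 < 0 \<and> v $ 1 > 0"
      if "v $ 1 * ((v $ 2)\<^sup>2 - (v $ 3)\<^sup>2) + v $ 2 ^ 3 = 1" "- (v $ 2 + v $ 3) / 2 > 0" "(v $ 3 - v $ 2) / 2 > 0"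
    proof -
      have v2: "v $ 2 < 0" using that(2,3) by simp
      have "v $ 2 ^ 3 < 0" using v2 by (simp add: power_less_zero_eq)
      then have "v $ 1 * ((v $ 2)\<^sup>2 - (v $ 3)\<^sup>2) > 0" using that(1) by linarith
      moreover have "(v $ 2)\<^sup>2 - (v $ 3)\<^sup>2 > 0"
      proof -
        have "(- (v $ 2 + v $ 3)) * (v $ 3 - v $ 2) > 0" using that(2,3) by (intro mult_pos_pos) auto
        then show ?thesis by (simp add: power2_eq_square algebra_simps)
      qed
      ultimately show ?thesis using v2 by (simp add: zero_less_mult_iff)
    qed
    show "v \<in> model_surface SurfE \<longleftrightarrow> A *v v \<in> level (node_form 1 1) (node_cone 1 1)"
      unfolding model_surface.simps vector_Collect_iff level_def node_cone_def mem_Collect_eq eq A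
      using fwd bwd by auto
  qed
qed

text \<open>The Weierstrass parameter of the trace free normal form, in terms of \<open>t\<^sup>2 = 1 + 54 c\<^sup>2\<close>.\<close>

definition weierstrass_param :: "real \<Rightarrow> real" where
  "weierstrass_param t = - (t ^ 4 + 18 * t\<^sup>2 - 27) / (8 * t ^ 3)"

text \<open>Multiplied by 8 t^3, the numbers 1 + b and 1 - b factor as (3 - t)^3 (t + 1) and (t +
  3)^3 (t - 1). The ends t = 1 and t = 3 correspond to c = 0 and 27 c^2 = 4.\<close>

lemma weierstrass_param_range:
  assumes "1 < t" "t < 3"
  shows "weierstrass_param t \<in> {-1<..<1}"
proof -
  have t: "8 * t ^ 3 > 0" using assms by simp
  have "(3 - t) ^ 3 * (t + 1) > 0" "(t + 3) ^ 3 * (t - 1) > 0" using assms by simp_all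
  moreover have "(3 - t) ^ 3 * (t + 1) = 8 * t ^ 3 - (t ^ 4 + 18 * t\<^sup>2 - 27)"
    "(t + 3) ^ 3 * (t - 1) = 8 * t ^ 3 + (t ^ 4 + 18 * t\<^sup>2 - 27)"
    by algebra+
  ultimately have "t ^ 4 + 18 * t\<^sup>2 - 27 < 8 * t ^ 3" "- (8 * t ^ 3) < t ^ 4 + 18 * t\<^sup>2 - 27" by simp_all
  then show ?thesis using t by (simp add: weierstrass_param_def field_simps)
qed

lemma weierstrass_param_surj:
  assumes "b \<in> {-1<..<1}"
  obtains t where "1 < t" "t < 3" "weierstrass_param t = b"
proof -
  have ends: "weierstrass_param 1 = 1" "weierstrass_param 3 = - 1" by (simp_all add: weierstrass_param_def)
  have "continuous_on {1..3} weierstrass_param"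
    unfolding weierstrass_param_def by (intro continuous_intros) auto
  then obtain t where t: "1 \<le> t" "t \<le> 3" "weierstrass_param t = b"
    using IVT2'[of weierstrass_param 3 b 1] assms ends by auto
  then have "t \<noteq> 1" "t \<noteq> 3" using ends assms by auto
  then show ?thesis using that[of t] t by simp
qed

section \<open>The Weierstrass cubic and its oval\<close>

definition weierstrass_form :: "real \<Rightarrow> real ^ 3 \<Rightarrow> real" where
  "weierstrass_form b v = (v $ 2)\<^sup>2 * v $ 3 - 4 * v $ 1 ^ 3 + 3 * v $ 1 * (v $ 3)\<^sup>2 + b * v $ 3 ^ 3"

text \<open>In the chart z = -1 the second condition reads x > -1/2, where 3 x - 4 x^3 has its local
  minimum; it separates the oval from the unbounded branch.\<close>

definition weierstrass_sector :: "(real ^ 3) set" where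
  "weierstrass_sector = {v. v $ 3 < 0 \<and> 2 * v $ 1 > v $ 3}"

text \<open>On the edge z = 0 the form is -4 x^3 with x \<ge> 0, on the edge 2 x = z it is y^2 z +
  (1 + b) z^3 with z < 0; both are nonpositive.\<close>

lemma weierstrass_sector_boundary:
  assumes "b > - 1" and v: "v \<in> closure weierstrass_sector" "weierstrass_form b v > 0"
  shows "v \<in> weierstrass_sector"
proof -
  have "closure weierstrass_sector \<subseteq> {v. v $ 3 \<le> 0 \<and> 2 * v $ 1 \<ge> v $ 3}"
    unfolding weierstrass_sector_def
    by (intro closure_minimal closed_Collect_conj closed_Collect_le continuous_intros) auto
  then have v': "v $ 3 \<le> 0" "2 * v $ 1 \<ge> v $ 3" using v(1) by auto
  have "v $ 3 \<noteq> 0"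
  proof
    assume 0: "v $ 3 = 0"
    then have "v $ 1 ^ 3 \<ge> 0" using v' by simp
    then show False using v(2) 0 by (simp add: weierstrass_form_def)
  qed
  then have neg: "v $ 3 < 0" using v' by simp
  moreover have "2 * v $ 1 \<noteq> v $ 3"
  proof
    assume eq: "2 * v $ 1 = v $ 3"
    have "weierstrass_form b v = (v $ 2)\<^sup>2 * v $ 3 + (1 + b) * v $ 3 ^ 3"
      unfolding weierstrass_form_def eq[symmetric] by (simp add: power2_eq_square power3_eq_cube algebra_simps)
    moreover have "v $ 3 ^ 3 \<le> 0" using neg by (simp add: power_less_zero_eq less_imp_le)
    then have "(1 + b) * v $ 3 ^ 3 \<le> 0" using assms(1) by (intro mult_nonneg_nonpos) auto
    moreover have "(v $ 2)\<^sup>2 * v $ 3 \<le> 0" using neg by (intro mult_nonneg_nonpos) auto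
    ultimately show False using v(2) by simp
  qed
  ultimately show ?thesis using v' by (simp add: weierstrass_sector_def)
qed

text \<open>3 x - 4 x^3 increases on [-1/2, 1/2] and decreases afterwards, so g y is at least g x or
  at least g z.\<close>

lemma weierstrass_oval_interval:
  fixes b :: real
  defines "g \<equiv> \<lambda>x. 3 * x - 4 * x ^ 3 - b"
  assumes x: "x > - 1 / 2" "g x > 0" and z: "g z > 0" and y: "x \<le> y" "y \<le> z"
  shows "g y > 0"
proof (cases "y \<le> 1 / 2")
  case True
  have "\<bar>x\<bar> \<le> 1 / 2" "\<bar>y\<bar> \<le> 1 / 2" using x y True by auto
  then have "x\<^sup>2 \<le> (1 / 2)\<^sup>2" "y\<^sup>2 \<le> (1 / 2)\<^sup>2" by (metis abs_le_square_iff abs_of_pos half_gt_zero_iff zero_less_one)+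
  moreover have "2 * (x * y) \<le> x\<^sup>2 + y\<^sup>2" using sum_squares_bound[of x y] by simp
  ultimately have "4 * (x\<^sup>2 + x * y + y\<^sup>2) \<le> 3" by (simp add: power2_eq_square)
  then have "(y - x) * (3 - 4 * (x\<^sup>2 + x * y + y\<^sup>2)) \<ge> 0" using y by (intro mult_nonneg_nonneg) auto
  moreover have "g y = g x + (y - x) * (3 - 4 * (x\<^sup>2 + x * y + y\<^sup>2))" unfolding g_def by algebra
  ultimately show ?thesis using x(2) by simp
next
  case False
  then have "y * y \<ge> 1 / 2 * (1 / 2)" "y * z \<ge> 1 / 2 * (1 / 2)" "z * z \<ge> 1 / 2 * (1 / 2)"
    using y by (intro mult_mono; simp)+
  then have "(z - y) * (4 * (y\<^sup>2 + y * z + z\<^sup>2) - 3) \<ge> 0"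
    using y by (intro mult_nonneg_nonneg) (auto simp: power2_eq_square)
  moreover have "g y = g z + (z - y) * (4 * (y\<^sup>2 + y * z + z\<^sup>2) - 3)" unfolding g_def by algebra
  ultimately show ?thesis using z by simp
qed

lemma connected_weierstrass_cone:
  "connected {v \<in> weierstrass_sector. weierstrass_form b v > 0}"
proof -
  define g where "g x = 3 * x - 4 * x ^ 3 - b" for x :: real
  define G where "G = {x. x > - 1 / 2 \<and> g x > 0}"
  have "is_interval G"
    unfolding is_interval_1
  proof (intro ballI allI impI, elim conjE)
    fix x z y assume "x \<in> G" "z \<in> G" "x \<le> y" "y \<le> z"
    then show "y \<in> G" using weierstrass_oval_interval[of x b z y] by (simp add: G_def g_def)
  qed
  then have "convex G" by (rule is_interval_convex)
  define P where "P = {p :: real ^ 3. p $ 1 > 0} \<inter> ((\<lambda>p. p $ 2) -` G \<inter> (\<lambda>p. p $ 3) -` {-1<..<1})"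
  have "convex P"
    unfolding P_def
    by (intro convex_Int convex_positive_coordinate convex_linear_vimage[OF linear_vec_nth]
        \<open>convex G\<close> convex_real_interval)
  \<comment> \<open>p1 is the scale -z, p2 the abscissa in the chart z = -1, and p3 the ordinate as
    a fraction of its extreme value sqrt g; this exhibits the region as a continuous image of a
    convex prism.\<close>
  let ?f = "\<lambda>p :: real ^ 3. vector [p $ 1 * p $ 2, p $ 1 * p $ 3 * sqrt (g (p $ 2)), - p $ 1] :: real ^ 3"
  have form: "weierstrass_form b v = p ^ 3 * (g x - y\<^sup>2)"
    if "v $ 1 = p * x" "v $ 2 = p * y" "v $ 3 = - p" for v p x y
    unfolding weierstrass_form_def g_def that by algebra
  have "?f ` P = {v \<in> weierstrass_sector. weierstrass_form b v > 0}"
  proof (intro equalityI subsetI)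
    fix v assume "v \<in> ?f ` P"
    then obtain p where p: "p \<in> P" and v: "v = ?f p" by blast
    have p': "p $ 1 > 0" "p $ 2 > - 1 / 2" "g (p $ 2) > 0" "- 1 < p $ 3" "p $ 3 < 1"
      using p by (auto simp: P_def G_def)
    have vs: "v $ 1 = p $ 1 * p $ 2" "v $ 2 = p $ 1 * p $ 3 * sqrt (g (p $ 2))" "v $ 3 = - p $ 1"
      by (simp_all add: v vector_3)
    have "v \<in> weierstrass_sector"
      using p'(1) mult_strict_left_mono[OF p'(2,1)] by (simp add: weierstrass_sector_def vs)
    moreover have "weierstrass_form b v = p $ 1 ^ 3 * (g (p $ 2) - (p $ 3 * sqrt (g (p $ 2)))\<^sup>2)"
      by (rule form) (simp_all only: vs mult.assoc)
    then have "weierstrass_form b v = p $ 1 ^ 3 * (g (p $ 2) * (1 - (p $ 3)\<^sup>2))"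
      using p'(3) by (simp add: power_mult_distrib right_diff_distrib mult.commute)
    moreover have "(p $ 3)\<^sup>2 < 1" using p'(4,5) by (simp add: abs_square_less_1 abs_less_iff)
    ultimately show "v \<in> {v \<in> weierstrass_sector. weierstrass_form b v > 0}" using p' by simp
  next
    fix v assume "v \<in> {v \<in> weierstrass_sector. weierstrass_form b v > 0}"
    then have v: "v $ 3 < 0" "2 * v $ 1 > v $ 3" "weierstrass_form b v > 0"
      by (auto simp: weierstrass_sector_def)
    let ?x = "v $ 1 / (- v $ 3)"
    have "(- v $ 3) ^ 3 > 0" using v(1) by (intro zero_less_power) simp
    moreover have "weierstrass_form b v = (- v $ 3) ^ 3 * (g ?x - (v $ 2 / (- v $ 3))\<^sup>2)"
      by (rule form) (use v(1) in simp_all)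
    ultimately have "g ?x - (v $ 2 / (- v $ 3))\<^sup>2 > 0"
      using v(3) by (simp only: zero_less_mult_iff) linarith
    then have lt: "(v $ 2 / (- v $ 3))\<^sup>2 < g ?x" by linarith
    then have gx: "g ?x > 0" using zero_le_power2[of "v $ 2 / (- v $ 3)"] by linarith
    define s where "s = v $ 2 / (- v $ 3) / sqrt (g ?x)"
    have "s\<^sup>2 = (v $ 2 / (- v $ 3))\<^sup>2 / g ?x"
      unfolding s_def power_divide[of _ "sqrt (g ?x)"] using gx by simp
    then have "s\<^sup>2 < 1" using lt gx by (simp only: divide_less_eq_1) blast
    then have s: "- 1 < s" "s < 1" by (auto simp: abs_square_less_1 abs_less_iff)
    have "?x > - 1 / 2" using v(1,2) by (simp add: field_simps)
    then have "vector [- v $ 3, ?x, s] \<in> P"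
      using v(1) gx s by (simp add: P_def G_def vector_3)
    moreover have "v = ?f (vector [- v $ 3, ?x, s])"
      using v(1) gx by (simp add: vec3_eq_iff vector_3 s_def)
    ultimately show "v \<in> ?f ` P" by (rule rev_image_eqI)
  qed
  moreover have "continuous_on P ?f"
    unfolding g_def by (intro continuous_on_vector_3 continuous_intros)
  ultimately show ?thesis
    using connected_continuous_image[of P ?f] convex_connected[OF \<open>convex P\<close>] by simp
qed

definition trace_free_param :: "real \<Rightarrow> real" where
  "trace_free_param t = sqrt ((t\<^sup>2 - 1) / 54)"

lemma trace_free_param:
  assumes "1 \<le> t" "t < 3"
  shows "trace_free_param t \<ge> 0" "27 * (trace_free_param t)\<^sup>2 < 4" "t\<^sup>2 = 1 + 54 * (trace_free_param t)\<^sup>2"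
proof -
  have "t\<^sup>2 \<ge> 1" using assms by simp
  then have c: "(trace_free_param t)\<^sup>2 = (t\<^sup>2 - 1) / 54" by (simp add: trace_free_param_def)
  have "t\<^sup>2 < 3\<^sup>2" using assms by (intro power_strict_mono) auto
  then show "27 * (trace_free_param t)\<^sup>2 < 4" "t\<^sup>2 = 1 + 54 * (trace_free_param t)\<^sup>2" using c by simp_all
  show "trace_free_param t \<ge> 0" using \<open>t\<^sup>2 \<ge> 1\<close> by (simp add: trace_free_param_def)
qed

text \<open>The line through the three real flexes of the trace free form is \<open>x = 0\<close>; \<open>u\<close> below is the
  tangent at one of them, and completing the cube brings the form into Weierstrass shape.\<close>

lemma trace_free_weierstrass:
  assumes t: "1 < t" "t < 3"
  defines "c \<equiv> trace_free_param t" and "b \<equiv> weierstrass_param t"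
  obtains A :: "real ^ 3 ^ 3" where "invertible A"
    "\<And>v. weierstrass_form b (A *v v) = std_form c 0 (- c) 0 v" "A *v axis 1 1 \<in> weierstrass_sector"
proof -
  have c: "c > 0" "t\<^sup>2 = 1 + 54 * c\<^sup>2" "27 * c\<^sup>2 < 4"
  proof -
    show tc: "t\<^sup>2 = 1 + 54 * c\<^sup>2" "27 * c\<^sup>2 < 4" using trace_free_param[of t] t by (simp_all add: c_def)
    have "c \<ge> 0" using trace_free_param[of t] t by (simp add: c_def)
    moreover have "t\<^sup>2 > 1" using t by simp
    then have "c \<noteq> 0" using tc(1) by auto
    ultimately show "c > 0" by simp
  qed
  \<comment> \<open>With u = x + 3 c y the form becomes - z^2 u + e y^3 + (27 c^2 - 1) y^2 u - 9 c y
    u^2 + u^3.\<close>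
  define e where "e = c * (4 - 27 * c\<^sup>2)"
  have e: "e > 0" using c by (simp add: e_def)
  define \<delta> where "\<delta> = root 3 (e / 4)"
  have \<delta>: "\<delta> > 0" "\<delta> ^ 3 = e / 4" using e by (simp_all add: \<delta>_def)
  define \<kappa> where "\<kappa> = t / (6 * \<delta>\<^sup>2)"
  have \<kappa>: "\<kappa> > 0" using t \<delta> by (simp add: \<kappa>_def)
  define \<mu> where "\<mu> = 1 / sqrt \<kappa>"
  have \<mu>: "\<mu> > 0" "\<mu>\<^sup>2 * \<kappa> = 1" using \<kappa> by (simp_all add: \<mu>_def power_divide)
  \<comment> \<open>Y = y + w u completes the cube, as 3 e w = 27 c^2 - 1. The scales satisfy 4
    \<delta>^3 = e, \<mu>^2 \<kappa> = 1 and 3 \<delta> \<kappa>^2 = K, where K must equal 3 e w^2 +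
    9 c to match the term y u^2.\<close>
  define w where "w = (t\<^sup>2 - 3) / (6 * e)"
  define K where "K = 3 * \<delta> * \<kappa>\<^sup>2"
  define M where "M = b * \<kappa> ^ 3"
  have ew: "3 * e * w = 27 * c\<^sup>2 - 1" using e c(2) by (simp add: w_def)
  have eK: "3 * e * K = t\<^sup>2"
  proof -
    have "3 * (4 * \<delta> ^ 3) * (3 * \<delta> * (t / (6 * \<delta>\<^sup>2))\<^sup>2) = t\<^sup>2"
      using \<delta>(1) by (simp add: field_simps power2_eq_square power3_eq_cube)
    then show ?thesis using \<delta>(2) by (simp add: K_def \<kappa>_def)
  qed
  have eM: "108 * e\<^sup>2 * M = - (t ^ 4 + 18 * t\<^sup>2 - 27)"
  proof -
    have "108 * (4 * \<delta> ^ 3)\<^sup>2 * (t / (6 * \<delta>\<^sup>2)) ^ 3 = 8 * t ^ 3"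
      using \<delta>(1) by (simp add: field_simps power2_eq_square power3_eq_cube)
    then have "108 * e\<^sup>2 * \<kappa> ^ 3 = 8 * t ^ 3" using \<delta>(2) by (simp add: \<kappa>_def)
    moreover have "b * (8 * t ^ 3) = - (t ^ 4 + 18 * t\<^sup>2 - 27)"
      using t by (simp add: b_def weierstrass_param_def)
    moreover have "108 * e\<^sup>2 * M = b * (108 * e\<^sup>2 * \<kappa> ^ 3)" by (simp add: M_def)
    ultimately show ?thesis by (simp only:)
  qed
  have 1: "3 * e * w\<^sup>2 - K = - 9 * c"
  proof -
    have "(3 * e) * (3 * e * w\<^sup>2 - K) = (3 * e * w)\<^sup>2 - 3 * e * K" by algebra
    also have "\<dots> = (3 * e) * (- 9 * c)" unfolding ew eK c(2) unfolding e_def by algebra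
    finally show ?thesis using e by (simp only: mult_cancel_left) simp
  qed
  have 2: "e * w ^ 3 - K * w - M = 1"
  proof -
    have "(108 * e\<^sup>2) * (e * w ^ 3 - K * w - M) = 4 * (3 * e * w) ^ 3 - 12 * (3 * e * K) * (3 * e * w) - 108 * e\<^sup>2 * M"
      by algebra
    also have "\<dots> = 4 * (27 * c\<^sup>2 - 1) ^ 3 - 12 * t\<^sup>2 * (27 * c\<^sup>2 - 1) + ((t\<^sup>2)\<^sup>2 + 18 * t\<^sup>2 - 27)"
      unfolding ew eK eM by algebra
    also have "\<dots> = (108 * e\<^sup>2) * 1" unfolding c(2) e_def by algebra
    finally show ?thesis using e by (simp only: mult_cancel_left) simp
  qed
  define A where "A = (transpose (vector [vector [- \<delta> * w, 0, - \<kappa>],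
      vector [- \<delta> * (1 + 3 * c * w), 0, - 3 * c * \<kappa>], vector [0, \<mu>, 0]]) :: real ^ 3 ^ 3)"
  have A: "(A *v v) $ 1 = - \<delta> * (v $ 2 + w * (v $ 1 + 3 * c * v $ 2))" "(A *v v) $ 2 = \<mu> * v $ 3"
    "(A *v v) $ 3 = - \<kappa> * (v $ 1 + 3 * c * v $ 2)" for v
    unfolding A_def combination_3 by (simp_all add: vector_3 algebra_simps)
  show ?thesis
  proof (rule that[of A])
    show "invertible A"
    proof (rule invertible_3I)
      fix v assume "(A *v v) $ 1 = 0" "(A *v v) $ 2 = 0" "(A *v v) $ 3 = 0"
      then have "v $ 2 + w * (v $ 1 + 3 * c * v $ 2) = 0" "v $ 3 = 0" "v $ 1 + 3 * c * v $ 2 = 0"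
        unfolding A using \<delta>(1) \<mu>(1) \<kappa> by simp_all
      then show "v = 0" by (simp add: vec3_eq_iff)
    qed
    fix v :: "real ^ 3"
    define u where "u = v $ 1 + 3 * c * v $ 2"
    define Y where "Y = v $ 2 + w * u"
    have "weierstrass_form b (A *v v)
        = - (\<mu>\<^sup>2 * \<kappa>) * (v $ 3)\<^sup>2 * u + 4 * \<delta> ^ 3 * Y ^ 3 - K * Y * u\<^sup>2 - M * u ^ 3"
      unfolding weierstrass_form_def A u_def[symmetric] Y_def[symmetric] K_def M_def by algebra
    also have "\<dots> = - (v $ 3)\<^sup>2 * u + e * Y ^ 3 - K * Y * u\<^sup>2 - M * u ^ 3"
      unfolding \<mu> \<delta>(2) by simp
    also have "\<dots> = - (v $ 3)\<^sup>2 * u + e * v $ 2 ^ 3 + (3 * e * w) * (v $ 2)\<^sup>2 * u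
        + (3 * e * w\<^sup>2 - K) * v $ 2 * u\<^sup>2 + (e * w ^ 3 - K * w - M) * u ^ 3"
      unfolding Y_def by algebra
    also have "\<dots> = std_form c 0 (- c) 0 v"
      unfolding ew 1 2 unfolding std_form_def e_def u_def by algebra
    finally show "weierstrass_form b (A *v v) = std_form c 0 (- c) 0 v" .
  next
    \<comment> \<open>This is the second sector condition at the image of the base point; it reduces
      to (3 - t) (t + 1) > 0.\<close>
    have "\<kappa> - 2 * (\<delta> * w) > 0"
    proof -
      have "\<delta> * w = (t\<^sup>2 - 3) / (24 * \<delta>\<^sup>2)"
      proof -
        have "w = (t\<^sup>2 - 3) / (24 * \<delta> ^ 3)" unfolding w_def \<delta>(2) by simp
        then show ?thesis using \<delta>(1) by (simp add: power2_eq_square power3_eq_cube)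
      qed
      then have "\<kappa> - 2 * (\<delta> * w) = t / (6 * \<delta>\<^sup>2) - 2 * ((t\<^sup>2 - 3) / (24 * \<delta>\<^sup>2))"
        by (simp only: \<kappa>_def)
      also have "\<dots> = (2 * t - (t\<^sup>2 - 3)) / (12 * \<delta>\<^sup>2)"
        using \<delta>(1) by (simp add: field_simps)
      finally have "\<kappa> - 2 * (\<delta> * w) = (2 * t - (t\<^sup>2 - 3)) / (12 * \<delta>\<^sup>2)" .
      moreover have "2 * t - (t\<^sup>2 - 3) = (3 - t) * (t + 1)" by algebra
      moreover have "(3 - t) * (t + 1) > 0" using t by simp
      ultimately show ?thesis using \<delta>(1) by simp
    qed
    then show "A *v axis 1 1 \<in> weierstrass_sector"
      using \<kappa> by (simp add: weierstrass_sector_def A axis_def)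
  qed
qed

text \<open>The model is cut out by a sector rather than by the cone, and the two are matched by
  connectedness: the image of the cone cannot cross the boundary of the sector, where the form is
  nonpositive, and the positive part of the sector is connected, so it lies in one
  component.\<close>

lemma model_F:
  assumes t: "1 < t" "t < 3"
  defines "c \<equiv> trace_free_param t"
  shows "psr_isomorphic (model_surface (SurfF (weierstrass_param t)))
    (level (std_form c 0 (- c) 0) (std_cone c 0 (- c) 0))"
proof -
  let ?h = "std_form c 0 (- c) 0" and ?U = "std_cone c 0 (- c) 0"
  define b where "b = weierstrass_param t"
  have b: "b > - 1" using weierstrass_param_range[OF t] by (simp add: b_def)
  have c: "27 * (c\<^sup>2 + 0\<^sup>2) \<le> 4" using trace_free_param(2)[of t] t by (simp add: c_def)
  have mh: "maximal_hyperbolic ?h ?U" using maximal_hyperbolic_trace_free[OF c] by simp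
  interpret maximal_hyperbolic ?h ?U by (rule mh)
  obtain A :: "real ^ 3 ^ 3" where A: "invertible A"
    and form: "\<And>v. weierstrass_form b (A *v v) = ?h v" and e: "A *v axis 1 1 \<in> weierstrass_sector"
    using trace_free_weierstrass[OF t] unfolding b_def c_def by metis
  obtain B where B: "A ** B = mat 1" "B ** A = mat 1" using A by (auto simp: invertible_def)
  have AB: "A *v (B *v v) = v" "B *v (A *v v) = v" for v
    by (simp_all add: matrix_vector_mul_assoc B)
  have eU: "axis 1 1 \<in> ?U" by (simp add: std_cone_def std_form_axis) (simp add: axis_def)
  have "open weierstrass_sector"
    unfolding weierstrass_sector_def by (intro open_Collect_conj open_Collect_less continuous_intros)
  have 1: "(\<lambda>v. A *v v) ` ?U \<subseteq> weierstrass_sector"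
  proof (rule ccontr)
    assume "\<not> ?thesis"
    moreover have "connected ((\<lambda>v. A *v v) ` ?U)"
      by (intro connected_continuous_image continuous_on_matrix_mult connected_cone)
    moreover have "A *v axis 1 1 \<in> (\<lambda>v. A *v v) ` ?U \<inter> weierstrass_sector" using e eU by blast
    ultimately have "(\<lambda>v. A *v v) ` ?U \<inter> frontier weierstrass_sector \<noteq> {}"
      by (intro connected_Int_frontier) blast+
    then obtain v where v: "v \<in> ?U" "A *v v \<in> closure weierstrass_sector" "A *v v \<notin> weierstrass_sector"
      using \<open>open weierstrass_sector\<close> by (auto simp: frontier_def interior_open)
    then show False using weierstrass_sector_boundary[OF b] form pos by metis
  qed
  let ?S = "{v \<in> weierstrass_sector. weierstrass_form b v > 0}"
  have 2: "(\<lambda>v. B *v v) ` ?S \<subseteq> ?U"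
  proof (rule connected_subset)
    show "connected ((\<lambda>v. B *v v) ` ?S)"
      by (intro connected_continuous_image continuous_on_matrix_mult connected_weierstrass_cone)
    have "A *v axis 1 1 \<in> ?S" using e form[of "axis 1 1"] by (simp add: std_form_axis)
    then have "B *v (A *v axis 1 1) \<in> (\<lambda>v. B *v v) ` ?S" by (rule imageI)
    then show "(\<lambda>v. B *v v) ` ?S \<inter> ?U \<noteq> {}" unfolding AB using eU by blast
    show "?h x > 0" if "x \<in> (\<lambda>v. B *v v) ` ?S" for x
      using that AB form[of x] by auto
  qed
  have "v \<in> level ?h ?U \<longleftrightarrow> A *v v \<in> model_surface (SurfF b)" for v
  proof -
    have "A *v v \<in> model_surface (SurfF b) \<longleftrightarrow> A *v v \<in> weierstrass_sector \<and> ?h v = 1"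
      unfolding form[symmetric] model_surface.simps vector_Collect_iff
      by (auto simp: weierstrass_sector_def weierstrass_form_def)
    moreover have "v \<in> ?U" if "A *v v \<in> weierstrass_sector" "?h v = 1"
    proof -
      have "A *v v \<in> ?S" using that form[of v] by simp
      then have "B *v (A *v v) \<in> ?U" using 2 by blast
      then show ?thesis by (simp only: AB)
    qed
    ultimately show ?thesis using 1 by (auto simp: level_def)
  qed
  from psr_isomorphic_sym[OF psr_isomorphic_preimage[OF A this]] show ?thesis by (simp only: b_def)
qed

section \<open>Assembling the labelled list\<close>

lemma complete_if_isomorphic:
  assumes h: "maximal_hyperbolic h U" and iso: "psr_isomorphic M (level h U)"
  shows "complete_projective_special_real M"
proof -
  obtain A where A: "invertible A" "(\<lambda>x. A *v x) ` M = level h U"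
    using iso by (auto simp: psr_isomorphic_def)
  have "M = level (\<lambda>x. h (A *v x)) {x. A *v x \<in> U}"
  proof (intro equalityI subsetI)
    fix x assume "x \<in> level (\<lambda>x. h (A *v x)) {x. A *v x \<in> U}"
    then have "A *v x \<in> (\<lambda>x. A *v x) ` M" unfolding A(2) by (simp add: level_def)
    then show "x \<in> M" using invertible_inj[OF A(1)] by auto
  next
    fix x assume "x \<in> M"
    then have "A *v x \<in> level h U" using A(2) by blast
    then show "x \<in> level (\<lambda>x. h (A *v x)) {x. A *v x \<in> U}" by (simp add: level_def)
  qed
  then show ?thesis
    unfolding complete_projective_special_real_iff
    using maximal_hyperbolic_compose[OF h A(1)] by blast
qed

lemma node_swap:
  "psr_isomorphic (level (node_form 0 1) (node_cone 0 1)) (level (node_form 1 0) (node_cone 1 0))"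
proof -
  define A where "A = (transpose (vector [vector [1, 0, 0], vector [0, 0, 1], vector [0, 1, 0]]) :: real ^ 3 ^ 3)"
  have A: "(A *v v) $ 1 = v $ 1" "(A *v v) $ 2 = v $ 3" "(A *v v) $ 3 = v $ 2" for v
    unfolding A_def combination_3 by (simp_all add: vector_3)
  show ?thesis
  proof (rule psr_isomorphic_preimage)
    show "invertible A" by (rule invertible_3I) (simp add: A vec3_eq_iff)
    show "v \<in> level (node_form 0 1) (node_cone 0 1) \<longleftrightarrow> A *v v \<in> level (node_form 1 0) (node_cone 1 0)" for v
      by (auto simp: level_def node_cone_def node_form_def A mult_ac)
  qed
qed

text \<open>Any right inverse of \<open>weierstrass_param\<close> will do: distinct b get distinct
  roots because b is recovered from its root.\<close>

definition weierstrass_root :: "real \<Rightarrow> real" where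
  "weierstrass_root b = (SOME t. 1 < t \<and> t < 3 \<and> weierstrass_param t = b)"

lemma weierstrass_root:
  assumes "b \<in> {-1<..<1}"
  shows "1 < weierstrass_root b" "weierstrass_root b < 3" "weierstrass_param (weierstrass_root b) = b"
proof -
  have "\<exists>t. 1 < t \<and> t < 3 \<and> weierstrass_param t = b"
    using weierstrass_param_surj[OF assms] by metis
  from someI_ex[OF this]
  show "1 < weierstrass_root b" "weierstrass_root b < 3" "weierstrass_param (weierstrass_root b) = b"
    by (simp_all add: weierstrass_root_def)
qed

fun label_param :: "surface_label \<Rightarrow> real" where
  "label_param (SurfF b) = trace_free_param (weierstrass_root b)"
| "label_param _ = 0"

fun label_form :: "surface_label \<Rightarrow> real ^ 3 \<Rightarrow> real" where
  "label_form SurfA = node_form 0 0"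
| "label_form SurfB = tangent_form"
| "label_form SurfC = node_form 1 0"
| "label_form SurfE = node_form 1 1"
| "label_form l = std_form (label_param l) 0 (- label_param l) 0"

fun label_cone :: "surface_label \<Rightarrow> (real ^ 3) set" where
  "label_cone SurfA = node_cone 0 0"
| "label_cone SurfB = tangent_cone"
| "label_cone SurfC = node_cone 1 0"
| "label_cone SurfE = node_cone 1 1"
| "label_cone l = std_cone (label_param l) 0 (- label_param l) 0"

lemma label_param:
  assumes "l \<in> surface_labels"
  shows "label_param l \<ge> 0" "27 * (label_param l)\<^sup>2 < 4"
proof -
  have "label_param l \<ge> 0 \<and> 27 * (label_param l)\<^sup>2 < 4"
  proof (cases l)
    case (SurfF b)
    then have "b \<in> {-1<..<1}" using assms by (auto simp: surface_labels_def)
    from weierstrass_root[OF this] show ?thesis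
      using trace_free_param[of "weierstrass_root b"] by (simp add: SurfF)
  qed simp_all
  then show "label_param l \<ge> 0" "27 * (label_param l)\<^sup>2 < 4" by simp_all
qed

lemma label_maximal_hyperbolic:
  assumes "l \<in> surface_labels"
  shows "maximal_hyperbolic (label_form l) (label_cone l)"
proof -
  have tf: "maximal_hyperbolic (std_form c 0 (- c) 0) (std_cone c 0 (- c) 0)" if "27 * c\<^sup>2 < 4" for c
    using maximal_hyperbolic_trace_free[of c 0] that by simp
  show ?thesis
    using tf[OF label_param(2)[OF assms]] maximal_hyperbolic_node maximal_hyperbolic_tangent
    by (cases l) auto
qed

lemma label_isomorphic:
  assumes "l \<in> surface_labels"
  shows "psr_isomorphic (model_surface l) (level (label_form l) (label_cone l))"
proof (cases l)
  case (SurfF b)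
  then have "b \<in> {-1<..<1}" using assms by (auto simp: surface_labels_def)
  note r = weierstrass_root[OF this]
  from model_F[OF r(1,2)] show ?thesis
    unfolding r(3) SurfF label_form.simps label_cone.simps label_param.simps .
qed (use model_A model_B model_C model_D model_E in simp_all)

text \<open>The dimension of the singular set separates a, c, the pair b, e and the class of d and
  f. The pair b, e differs in the tangent cone at the singular point; d and the members of f differ
  in the parameter c, which is 0 for d and positive on f.\<close>

lemma label_unique:
  assumes l: "l \<in> surface_labels" "l' \<in> surface_labels"
    and iso: "psr_isomorphic (level (label_form l) (label_cone l)) (level (label_form l') (label_cone l'))"
  shows "l = l'"
proof -
  note mh = label_maximal_hyperbolic[OF l(1)] label_maximal_hyperbolic[OF l(2)]
  obtain A where A: "invertible A" "\<And>x. label_form l x = label_form l' (A *v x)"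
    using psr_isomorphic_imp_compose[OF mh iso] by metis
  have dims: "dim (singular_set (label_form l)) = dim (singular_set (label_form l'))"
    by (rule dim_singular_set[where h = "label_form l" and h' = "label_form l'", OF A])
  define sd where "sd l = (case l of SurfA \<Rightarrow> 3 :: nat | SurfC \<Rightarrow> 2 | SurfB \<Rightarrow> 1 | SurfE \<Rightarrow> 1 | _ \<Rightarrow> 0)" for l
  have sd: "dim (singular_set (label_form l)) = sd l" if "l \<in> surface_labels" for l
    using dim_singular_sets(1-4) dim_singular_sets(5)[OF label_param(2)[OF that]]
    by (cases l) (simp_all add: sd_def)
  have sd_eq: "sd l = sd l'" using dims sd l by simp
  have eq0: "label_param l = label_param l'" if "sd l = 0"
  proof -
    have form: "label_form k = std_form (label_param k) 0 (- label_param k) 0"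
      "label_cone k = std_cone (label_param k) 0 (- label_param k) 0" if "sd k = 0" for k
      using that by (cases k; simp add: sd_def)+
    note iso' = iso[unfolded form[OF that] form[OF that[unfolded sd_eq]]]
    show ?thesis
      using trace_free_parameter_le[OF label_param(2)[OF l(1)] label_param[OF l(2)] iso']
        trace_free_parameter_le[OF label_param(2)[OF l(2)] label_param[OF l(1)] psr_isomorphic_sym[OF iso']]
      by simp
  qed
  have root: "1 + 54 * (label_param (SurfF b))\<^sup>2 = (weierstrass_root b)\<^sup>2"
    "weierstrass_root b > 1" "weierstrass_param (weierstrass_root b) = b"
    if "SurfF b \<in> surface_labels" for b
  proof -
    have b: "b \<in> {-1<..<1}" using that by (auto simp: surface_labels_def)
    note r = weierstrass_root[OF b]
    show "1 + 54 * (label_param (SurfF b))\<^sup>2 = (weierstrass_root b)\<^sup>2"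
      using trace_free_param(3)[of "weierstrass_root b"] r by simp
    show "weierstrass_root b > 1" "weierstrass_param (weierstrass_root b) = b" by (fact r(1) r(3))+
  qed
  have ne1: "label_param (SurfF b) \<noteq> 0" if "SurfF b \<in> surface_labels" for b
  proof
    assume "label_param (SurfF b) = 0"
    then have "(weierstrass_root b)\<^sup>2 = 1" using root(1)[OF that] by simp
    then show False using root(2)[OF that] by (simp add: power2_eq_1_iff)
  qed
  have BE: "\<not> psr_isomorphic (level (label_form SurfE) (label_cone SurfE)) (level (label_form SurfB) (label_cone SurfB))"
  proof
    assume "psr_isomorphic (level (label_form SurfE) (label_cone SurfE)) (level (label_form SurfB) (label_cone SurfB))"
    then obtain A where A: "invertible A" "\<And>x. label_form SurfE x = label_form SurfB (A *v x)"
      using psr_isomorphic_imp_compose[OF label_maximal_hyperbolic label_maximal_hyperbolic, of SurfE SurfB]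
      by (metis insertCI surface_labels_def Un_iff)
    show False by (rule node_tangent_inequivalent[of A]) (use A in simp_all)
  qed
  have cases: "l = l' \<or> l = SurfE \<and> l' = SurfB \<or> l = SurfB \<and> l' = SurfE \<or>
    (\<exists>b. l = SurfD \<and> l' = SurfF b) \<or> (\<exists>b. l = SurfF b \<and> l' = SurfD) \<or>
    (\<exists>b b'. l = SurfF b \<and> l' = SurfF b')"
    using sd_eq by (cases l; cases l'; simp add: sd_def)
  consider "l = l'" | "l = SurfE" "l' = SurfB" | "l = SurfB" "l' = SurfE"
    | b where "l = SurfD" "l' = SurfF b" | b where "l = SurfF b" "l' = SurfD"
    | b b' where "l = SurfF b" "l' = SurfF b'"
    using cases by blast
  then show ?thesis
  proof cases
    case 2
    then show ?thesis using BE iso by simp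
  next
    case 3
    then show ?thesis using BE psr_isomorphic_sym[OF iso] by simp
  next
    case (4 b)
    have b: "SurfF b \<in> surface_labels" using l(2) unfolding 4 .
    have "label_param (SurfF b) = 0" using eq0 unfolding 4 by (simp add: sd_def)
    then show ?thesis using ne1[OF b] by simp
  next
    case (5 b)
    have b: "SurfF b \<in> surface_labels" using l(1) unfolding 5 .
    have "label_param (SurfF b) = 0" using eq0 unfolding 5 by (simp add: sd_def)
    then show ?thesis using ne1[OF b] by simp
  next
    case (6 b b')
    have b: "SurfF b \<in> surface_labels" "SurfF b' \<in> surface_labels" using l unfolding 6 .
    have "label_param (SurfF b) = label_param (SurfF b')" using eq0 unfolding 6 by (simp add: sd_def)
    then have "(weierstrass_root b)\<^sup>2 = (weierstrass_root b')\<^sup>2"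
      using root(1)[OF b(1)] root(1)[OF b(2)] by simp
    then have "weierstrass_root b = weierstrass_root b'"
      by (rule power2_eq_imp_eq) (use root(2)[OF b(1)] root(2)[OF b(2)] in simp_all)
    then have "b = b'" using root(3)[OF b(1)] root(3)[OF b(2)] by metis
    then show ?thesis unfolding 6 by simp
  qed
qed

lemma label_exists:
  assumes "maximal_hyperbolic h (U :: (real ^ 3) set)"
  shows "\<exists>l\<in>surface_labels. psr_isomorphic (level h U) (model_surface l)"
proof -
  let ?H = "level h U"
  have label: ?thesis if "l \<in> surface_labels" "psr_isomorphic ?H (level (label_form l) (label_cone l))" for l
    using that psr_isomorphic_trans[OF that(2) psr_isomorphic_sym[OF label_isomorphic[OF that(1)]]] by blast
  have mem: "SurfA \<in> surface_labels" "SurfB \<in> surface_labels" "SurfC \<in> surface_labels"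
    "SurfD \<in> surface_labels" "SurfE \<in> surface_labels"
    by (simp_all add: surface_labels_def)
  from normal_form[OF assms] show ?thesis
  proof (elim disjE exE conjE)
    assume "node_type ?H"
    then consider "psr_isomorphic ?H (level tangent_form tangent_cone)"
      | \<alpha> \<beta> where "\<alpha> \<in> {0, 1}" "\<beta> \<in> {0, 1}"
        "psr_isomorphic ?H (level (node_form \<alpha> \<beta>) (node_cone \<alpha> \<beta>))"
      unfolding node_type_def by blast
    then show ?thesis
    proof cases
      case 1
      then show ?thesis using label[OF mem(2)] by simp
    next
      case (2 \<alpha> \<beta>)
      note iso = this(3)
      from 2(1,2) consider "\<alpha> = 0" "\<beta> = 0" | "\<alpha> = 0" "\<beta> = 1" | "\<alpha> = 1" "\<beta> = 0" | "\<alpha> = 1" "\<beta> = 1" by blast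
      then show ?thesis
      proof cases
        case 1
        then show ?thesis using label[OF mem(1)] iso by simp
      next
        case 2
        then show ?thesis using label[OF mem(3)] psr_isomorphic_trans[OF _ node_swap] iso by simp
      next
        case 3
        then show ?thesis using label[OF mem(3)] iso by simp
      next
        case 4
        then show ?thesis using label[OF mem(5)] iso by simp
      qed
    qed
  next
    fix c assume c: "0 \<le> c" "27 * c\<^sup>2 < 4"
      and iso: "psr_isomorphic ?H (level (std_form c 0 (- c) 0) (std_cone c 0 (- c) 0))"
    show ?thesis
    proof (cases "c = 0")
      case True
      then show ?thesis using label[OF mem(4)] iso by simp
    next
      case False
      define t where "t = sqrt (1 + 54 * c\<^sup>2)"
      have t2: "t\<^sup>2 = 1 + 54 * c\<^sup>2" by (simp add: t_def)
      have "c\<^sup>2 > 0" using False by simp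
      then have t: "1 < t" "t < 3"
        using c real_sqrt_less_mono[of 1 "1 + 54 * c\<^sup>2"] real_sqrt_less_mono[of "1 + 54 * c\<^sup>2" 9]
        by (simp_all add: t_def)
      have "trace_free_param t = c" using c by (simp add: trace_free_param_def t2)
      then have "psr_isomorphic ?H (model_surface (SurfF (weierstrass_param t)))"
        using model_F[OF t] iso psr_isomorphic_trans psr_isomorphic_sym by metis
      moreover have "SurfF (weierstrass_param t) \<in> surface_labels"
        using weierstrass_param_range[OF t] by (simp add: surface_labels_def)
      ultimately show ?thesis by blast
    qed
  qed
qed

theorem theorem1:
  shows "(\<forall>l \<in> surface_labels. complete_projective_special_real (model_surface l)) \<and>
         (\<forall>H :: (real ^ 3) set. complete_projective_special_real H \<longrightarrow>
            (\<exists>!l. l \<in> surface_labels \<and> psr_isomorphic H (model_surface l)))"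
proof (intro conjI ballI allI impI)
  fix l assume l: "l \<in> surface_labels"
  show "complete_projective_special_real (model_surface l)"
    by (rule complete_if_isomorphic[OF label_maximal_hyperbolic[OF l] label_isomorphic[OF l]])
next
  fix H :: "(real ^ 3) set" assume "complete_projective_special_real H"
  then obtain h U where "maximal_hyperbolic h U" "H = level h U"
    unfolding complete_projective_special_real_iff by blast
  then obtain l where l: "l \<in> surface_labels" "psr_isomorphic H (model_surface l)"
    using label_exists by blast
  moreover have "l' = l" if l': "l' \<in> surface_labels" "psr_isomorphic H (model_surface l')" for l'
  proof (rule label_unique[OF l'(1) l(1)])
    have "psr_isomorphic (model_surface l') (model_surface l)"
      using psr_isomorphic_trans[OF psr_isomorphic_sym[OF l'(2)] l(2)] .
    then show "psr_isomorphic (level (label_form l') (label_cone l')) (level (label_form l) (label_cone l))"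
      using label_isomorphic[OF l(1)] label_isomorphic[OF l'(1)] psr_isomorphic_trans psr_isomorphic_sym
      by blast
  qed
  ultimately show "\<exists>!l. l \<in> surface_labels \<and> psr_isomorphic H (model_surface l)" by blast
qed

end
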